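(* Let $(X,d,\mu)$ be a complete $Q$-Ahlfors regular metric measure space, $Q\ge1$, supporting a $p$-Poincaré inequality with $p>Q$, and let $V$ be a Banach space. Let $0<\varepsilon<1/8$ and $\alpha_p=1-\frac Qp$. Let $K\subset X$ be compact, and let $\Omega\subset X$ be open with $K\subset\Omega$. Assume that $U\subset X$ is a nonempty measurable set with $$\lambda\operatorname{diam}U<\operatorname{dist}(U,X\setminus K),$$ where $\lambda$ is the Poincaré radial constant. Then there exists a positive constant $C$ such that every continuous $f\colon X\to V$ satisfies $$C^{-1}\|f\|_{\dot M^{1,p}(U)}\le[f]_{p,\alpha_p,\varepsilon}(K)\le C\|f\|_{\dot M^{1,p}(\Omega)}.$$
   Context: A metric measure space $(X,d,\mu)$ is a metric space with a nonnegative Borel measure $\mu$ giving every ball positive finite measure. It is $Q$-Ahlfors regular if there is $C_\mu\ge 1$ with $C_\mu^{-1}r^Q\le\mu(B(x,r))\le C_\mu r^Q$ for all $x\in X$, $r\in(0,\operatorname{diam}X)$. Write $\fint_B u\,d\mu=\mu(B)^{-1}\int_B u\,d\mu=:u_B$. For $u\colon X\to\mathbb{R}$, $\operatorname{Lip}u(x):=\limsup_{r\to0}\sup_{y\in B(x,r)}\frac{|u(x)-u(y)|}{r}$. $X$ supports an $s$-Poincaré inequality ($s\ge1$) if there are $C_P>0$, $\lambda\ge1$ such that for every Lipschitz $u\colon X\to\mathbb{R}$ and every ball $B(z,r)\subset X$, $\fint_{B(z,r)}|u-u_{B(z,r)}|\,d\mu\le C_P\,r\left(\fint_{B(z,\lambda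 r)}(\operatorname{Lip}u)^s\,d\mu\right)^{1/s}$. By the Keith–Zhong theorem, a space as in the claim supports an $s$-Poincaré inequality for some $1\le s<p$; such an $s$ is fixed, and the Poincaré radial constant $\lambda$ is the constant $\lambda$ in this $s$-Poincaré inequality. For $f\colon X\to V$, $\alpha>0$, $B\subset X$, $|f|_{\alpha,B}:=\sup\left\{\frac{\|f(x)-f(y)\|}{d(x,y)^\alpha}: x,y\in B\text{ distinct}\right\}$. Compactly Hölder seminorm: for $K\subset X$ compact, $\varepsilon\in(0,1)$ and $0<r<1$, let $\mathcal B_{\varepsilon,K}(r)$ be the collection of all at most countable families $\mathcal B=\{B_i\}_{i\in I}$ of balls $B_i=B(x_i,\rho)$ of a common radius $\rho$ such that $K\subset\bigcup_i B_i$, $B_i\cap K\ne\emptyset$ for all $i$, $0<\rho<r$, and $B(x_i,\varepsilon\rho)\cap B(x_j,\varepsilon\rho)=\emptyset$ for $i\ne j$. Then $$[f]_{p,\alpha_p,\varepsilon}(K)^p:=\inf_{0<r<1}\ \sup_{\mathcal B\in\mathcal B_{\varepsilon,K}(r)}\ \sum_{B_i\in\mathcal B}|f|_{\alpha_p,B_i}^p\in[0,\infty].$$ Hajłasz seminorm: for measurable $A\subset X$, a measurable $g\colon A\to[0,\infty]$ is a Hajłasz gradient of $f$ on $A$ if there is a $\mu$-null set $E$ with $\|f(x)-f(y)\|\le d(x,y)[g(x)+g(y)]$ for all $x,y\in A\setminus E$. $\|f\|_{\dot M^{1,p}(A)}$ is the infimum of $\|g\|_{L^p(A)}$ over all Hajłasz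 gradients $g$ of $f$ on $A$, with $\inf\emptyset:=\infty$. Also $\operatorname{dist}(U,\emptyset)=\infty$. *)

theory Defs
  imports "HOL-Analysis.Analysis"
begin

text \<open>Real powers on the extended half-line; only used for exponents \<open>a > 0\<close>,
  so that \<open>0\<^sup>a = 0\<close> and \<open>\<infinity>\<^sup>a = \<infinity>\<close>.\<close>

definition epowr :: "ennreal \<Rightarrow> real \<Rightarrow> ennreal" where
  "epowr x a = (if x = \<infinity> then \<infinity> else ennreal (enn2real x powr a))"

text \<open>The library's \<open>diameter\<close> and \<open>setdist\<close> are real-valued, hence meaningless on unbounded sets
  and \<open>0\<close> for the empty set, respectively. Here an unbounded set has diameter \<open>\<infinity>\<close>, and the
  distance to the empty set is \<open>\<infinity>\<close>.\<close>

definition ediam :: "'a::metric_space set \<Rightarrow> ennreal" where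
  "ediam A = (SUP x\<in>A. SUP y\<in>A. ennreal (dist x y))"

definition edistance :: "'a::metric_space set \<Rightarrow> 'a set \<Rightarrow> ennreal" where
  "edistance A B = (INF x\<in>A. INF y\<in>B. ennreal (dist x y))"

text \<open>The metric space \<open>X\<close> is a whole type. Balls are open.\<close>

definition metric_measure_space :: "'a::metric_space measure \<Rightarrow> bool" where
  "metric_measure_space \<mu> \<longleftrightarrow> sets \<mu> = sets borel \<and>
     (\<forall>x r. 0 < r \<longrightarrow> 0 < emeasure \<mu> (ball x r) \<and> emeasure \<mu> (ball x r) < \<infinity>)"

definition ahlfors_regular :: "'a::metric_space measure \<Rightarrow> real \<Rightarrow> bool" where
  "ahlfors_regular \<mu> Q \<longleftrightarrow> (\<exists>C\<ge>1. \<forall>x r. 0 < r \<and> ennreal r < ediam (UNIV :: 'a set) \<longrightarrow>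
     ennreal (r powr Q / C) \<le> emeasure \<mu> (ball x r) \<and>
     emeasure \<mu> (ball x r) \<le> ennreal (C * r powr Q))"

definition avg :: "'a measure \<Rightarrow> 'a set \<Rightarrow> ('a \<Rightarrow> real) \<Rightarrow> real" where
  "avg \<mu> B u = (LINT x:B|\<mu>. u x) / measure \<mu> B"

definition Lip :: "('a::metric_space \<Rightarrow> real) \<Rightarrow> 'a \<Rightarrow> ennreal" where
  "Lip u x = Limsup (at_right 0) (\<lambda>r. SUP y\<in>ball x r. ennreal (\<bar>u x - u y\<bar> / r))"

text \<open>The \<open>s\<close>-Poincare inequality with explicit constants: \<open>C\<close> is the multiplicative constant and
  \<open>l\<close> the radial constant. The right-hand average is taken in \<open>[0,\<infinity>]\<close>; the left-hand side is a
  Bochner integral of a Lipschitz function over a bounded set of finite measure.\<close>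

definition poincare_inequality_with ::
    "'a::metric_space measure \<Rightarrow> real \<Rightarrow> real \<Rightarrow> real \<Rightarrow> bool" where
  "poincare_inequality_with \<mu> s C l \<longleftrightarrow> 0 < C \<and> 1 \<le> l \<and>
     (\<forall>u z r. (\<exists>L. L-lipschitz_on UNIV u) \<and> 0 < r \<longrightarrow>
        ennreal (avg \<mu> (ball z r) (\<lambda>x. \<bar>u x - avg \<mu> (ball z r) u\<bar>))
        \<le> ennreal (C * r) *
           epowr ((\<integral>\<^sup>+x\<in>ball z (l * r). epowr (Lip u x) s \<partial>\<mu>) / emeasure \<mu> (ball z (l * r))) (1 / s))"

definition supports_poincare :: "'a::metric_space measure \<Rightarrow> real \<Rightarrow> bool" where
  "supports_poincare \<mu> s \<longleftrightarrow> 1 \<le> s \<and> (\<exists>C l. poincare_inequality_with \<mu> s C l)"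

definition holder_seminorm :: "real \<Rightarrow> ('a::metric_space \<Rightarrow> 'b::real_normed_vector) \<Rightarrow> 'a set \<Rightarrow> ennreal" where
  "holder_seminorm \<alpha> f B =
     (SUP (x, y)\<in>{(x, y). x \<in> B \<and> y \<in> B \<and> x \<noteq> y}. ennreal (norm (f x - f y) / dist x y powr \<alpha>))"

text \<open>A triple \<open>(I, c, \<rho>)\<close> stands for the at most countable family of balls \<open>ball (c i) \<rho>\<close>,
  \<open>i \<in> I\<close>, with index set \<open>I\<close> contained in the natural numbers.\<close>

definition admissible_families ::
    "real \<Rightarrow> 'a::metric_space set \<Rightarrow> real \<Rightarrow> (nat set \<times> (nat \<Rightarrow> 'a) \<times> real) set" where
  "admissible_families \<epsilon> K r = {(I, c, \<rho>).
     K \<subseteq> (\<Union>i\<in>I. ball (c i) \<rho>) \<and>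
     (\<forall>i\<in>I. ball (c i) \<rho> \<inter> K \<noteq> {}) \<and>
     0 < \<rho> \<and> \<rho> < r \<and>
     (\<forall>i\<in>I. \<forall>j\<in>I. i \<noteq> j \<longrightarrow> ball (c i) (\<epsilon> * \<rho>) \<inter> ball (c j) (\<epsilon> * \<rho>) = {})}"

definition compactly_holder_seminorm ::
    "real \<Rightarrow> real \<Rightarrow> real \<Rightarrow> ('a::metric_space \<Rightarrow> 'b::real_normed_vector) \<Rightarrow> 'a set \<Rightarrow> ennreal" where
  "compactly_holder_seminorm p \<alpha> \<epsilon> f K =
     epowr (INF r\<in>{0<..<1}. SUP (I, c, \<rho>)\<in>admissible_families \<epsilon> K r.
              \<Sum>\<^sub>\<infinity>i\<in>I. epowr (holder_seminorm \<alpha> f (ball (c i) \<rho>)) p) (1 / p)"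

text \<open>A gradient is a function on \<open>A\<close>: its values outside \<open>A\<close> are irrelevant, both for
  measurability and for the norm.\<close>

definition hajlasz_gradient ::
    "'a::metric_space measure \<Rightarrow> ('a \<Rightarrow> 'b::real_normed_vector) \<Rightarrow> 'a set \<Rightarrow> ('a \<Rightarrow> ennreal) \<Rightarrow> bool" where
  "hajlasz_gradient M f A g \<longleftrightarrow> g \<in> borel_measurable (restrict_space M A) \<and>
     (\<exists>E\<in>null_sets M. \<forall>x\<in>A - E. \<forall>y\<in>A - E.
        ennreal (norm (f x - f y)) \<le> ennreal (dist x y) * (g x + g y))"

definition hajlasz_seminorm ::
    "'a::metric_space measure \<Rightarrow> real \<Rightarrow> ('a \<Rightarrow> 'b::real_normed_vector) \<Rightarrow> 'a set \<Rightarrow> ennreal" where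
  "hajlasz_seminorm M p f A =
     (INF g\<in>{g. hajlasz_gradient M f A g}. epowr (\<integral>\<^sup>+x\<in>A. epowr (g x) p \<partial>M) (1 / p))"

end

theory Submission
  imports Defs
begin

text \<open>
Both inequalities compare, at each small scale \<open>\<rho>\<close>, the sum of \<open>|f|\<^sub>\<alpha>\<^sup>p\<close> over a family of balls of
radius \<open>\<rho>\<close> with the integral of the \<open>p\<close>-th power of a gradient. The exponent \<open>\<alpha> = 1 - Q/p\<close> makes the
two scale in the same way: a ball of radius \<open>\<rho>\<close> on which \<open>f\<close> oscillates by \<open>L \<rho>\<^sup>\<alpha>\<close> carries a discrete
gradient \<open>L \<rho>\<^bsup>\<alpha>-1\<^esup>\<close>, whose \<open>p\<close>-th power integrates over a ball of volume \<open>\<rho>\<^sup>Q\<close> to \<open>L\<^sup>p\<close>, up to a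
constant.

Upper bound. Let \<open>g\<close> be a Hajlasz gradient of \<open>f\<close>. Every ball of radius \<open>t\<close> around a point \<open>z\<close>
contains a point where \<open>g\<^sup>p\<close> hardly exceeds its mean, hence is at most a constant times \<open>t\<^bsup>-Q\<^esup>\<close> times the
integral of \<open>g\<^sup>p\<close>. Telescoping along such points for \<open>t = d, d/2, d/4, \<dots>\<close> gives a geometric
series, which converges because \<open>p > Q\<close>, and the continuity of \<open>f\<close> identifies its limit as \<open>f z\<close>. So
\<open>|f|\<^sub>\<alpha>\<^sup>p\<close> on a ball is bounded by the integral of \<open>g\<^sup>p\<close> over the tripled ball
(\<open>holder_le_gradient_integral\<close>). The tripled balls of a family overlap boundedly, and for small \<open>\<rho>\<close>
they lie in \<open>\<Omega>\<close>; summation gives \<open>compactly_holder_le_hajlasz\<close>.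

Lower bound. Fix a scale \<open>\<rho>\<close> and a \<open>\<rho>/2\<close>-net of \<open>K\<close>. For a vector \<open>w\<close> the real function
\<open>\<parallel>f(\<cdot>) - w\<parallel>\<close> oscillates no more than \<open>f\<close>, and averaging it with a partition of unity
subordinate to the net produces a Lipschitz function \<open>u\<close> whose pointwise Lipschitz constant inside
\<open>K\<close> is at most a constant times the discrete gradient \<open>g\<close>. The \<open>s\<close>-Poincare inequality, telescoped
over balls of radius at least \<open>\<rho>\<close>, gives
\<open>|u x - u y| \<le> C d(x,y) (h x + h y)\<close> plus a small error, where \<open>h\<^sup>s\<close> is the maximal function of \<open>g\<^sup>s\<close>
over balls of radius at least \<open>\<rho>\<close>. With \<open>w = f x\<close> this bounds \<open>\<parallel>f x - f y\<parallel>\<close> itself, so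
the target space needs no duality. Since \<open>p/s > 1\<close>, the maximal theorem bounds the integral of
\<open>h\<^sup>p\<close> by that of \<open>g\<^sup>p\<close>, that is, by the sum of \<open>|f|\<^sub>\<alpha>\<^sup>p\<close> (\<open>gradient_above_scale\<close>). Only finitely many
balls are needed at a fixed scale, so a finite covering argument suffices for the maximal theorem.
The strict inequality \<open>\<lambda> diam U < dist(U, X - K)\<close> leaves room for balls of radius \<open>(1 + \<eta>) d(x,y)\<close>
around \<open>x\<close>, whose \<open>\<lambda>\<close>-dilation stays in \<open>K\<close> and which contain the balls of radius \<open>\<eta> d(x,y)\<close>
around \<open>y\<close>.

It remains to let \<open>\<rho>\<close> tend to \<open>0\<close>. The functions with the required \<open>L\<^sup>p\<close> bound that are gradients of \<open>f\<close>
up to an error \<open>\<delta>\<close> form a set that is closed under midpoints and shrinks with \<open>\<delta>\<close>. Almost minimisers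
of the integral of \<open>e\<^bsup>-h\<^esup>\<close> over these sets converge almost everywhere, by the identity
\<open>e\<^bsup>-a\<^esup> + e\<^bsup>-b\<^esup> - 2 e\<^bsup>-(a+b)/2\<^esup> = (e\<^bsup>-a/2\<^esup> - e\<^bsup>-b/2\<^esup>)\<^sup>2\<close>
(\<open>AE_limit_from_decreasing_midpoint_convex\<close>). The limit is a Hajlasz gradient on \<open>U\<close>, and Fatou's
lemma bounds its norm (\<open>hajlasz_le_compactly_holder\<close>).
\<close>

section \<open>Powers of extended nonnegative reals\<close>

lemma epowr_ennreal: "0 \<le> x \<Longrightarrow> epowr (ennreal x) a = ennreal (x powr a)"
  by (simp add: epowr_def)

lemma epowr_top [simp]: "epowr \<infinity> a = \<infinity>" "epowr top a = top"
  by (simp_all add: epowr_def)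

lemma epowr_mono: "x \<le> y \<Longrightarrow> 0 < a \<Longrightarrow> epowr x a \<le> epowr y a"
  by (cases x; cases y) (auto simp: epowr_ennreal top_unique intro!: ennreal_leI powr_mono2)

lemma epowr_cancel: "0 < a \<Longrightarrow> epowr (epowr x a) (1 / a) = x" "0 < a \<Longrightarrow> epowr (epowr x (1 / a)) a = x"
  by (cases x; simp add: epowr_ennreal powr_powr)+

lemma epowr_mult: "0 < c \<Longrightarrow> 0 < a \<Longrightarrow> epowr (ennreal c * x) a = ennreal (c powr a) * epowr x a"
  by (cases x) (auto simp: epowr_ennreal ennreal_mult_top powr_mult ennreal_mult[symmetric])

lemma epowr_measurable [measurable]: "(\<lambda>x. epowr x a) \<in> borel_measurable borel"
  unfolding epowr_def by measurable

lemma epowr_le_iff: "0 < a \<Longrightarrow> epowr x a \<le> y \<longleftrightarrow> x \<le> epowr y (1 / a)"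
  by (metis epowr_cancel epowr_mono zero_less_divide_1_iff)

text \<open>Only the monotonicity of the power enters: with \<open>epowr_le_iff\<close>, a strict lower bound for the left-hand
side becomes one for \<open>liminf X\<close> and hence holds eventually along the sequence.\<close>
lemma epowr_liminf_le:
  fixes X :: "nat \<Rightarrow> ennreal"
  assumes "0 < a"
  shows "epowr (liminf X) a \<le> liminf (\<lambda>n. epowr (X n) a)"
  unfolding le_Liminf_iff
proof (intro allI impI)
  fix y assume "y < epowr (liminf X) a"
  then have "epowr y (1 / a) < liminf X"
    using epowr_le_iff[OF assms, of "liminf X" y] by (simp add: not_le[symmetric])
  then have "\<forall>\<^sub>F n in sequentially. epowr y (1 / a) < X n"
    by (rule less_LiminfD)
  then show "\<forall>\<^sub>F n in sequentially. y < epowr (X n) a"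
    by eventually_elim (use epowr_le_iff[OF assms] in \<open>simp add: not_le[symmetric]\<close>)
qed

section \<open>Two-sided volume bounds and bounded overlap\<close>

text \<open>Ahlfors regularity controls balls only below the diameter of the space. Here the two-sided bound
holds up to a prescribed radius \<open>R\<close>, so that no estimate below has to mention the diameter;
\<open>regular_measure_exists\<close> provides it for every \<open>R\<close> if the space has at least two points.\<close>
locale regular_measure =
  fixes \<mu> :: "'a::metric_space measure" and Q C R :: real
  assumes sets_mu [simp, measurable_cong]: "sets \<mu> = sets borel"
    and Q_ge: "1 \<le> Q" and C_ge: "1 \<le> C" and R_pos: "0 < R"
    and finite_ball: "emeasure \<mu> (ball x r) < \<infinity>"
    and lower: "0 < r \<Longrightarrow> r \<le> R \<Longrightarrow> r powr Q / C \<le> measure \<mu> (ball x r)"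
    and upper: "0 < r \<Longrightarrow> r \<le> R \<Longrightarrow> measure \<mu> (ball x r) \<le> C * r powr Q"
begin

lemma space_mu [simp]: "space \<mu> = UNIV"
  using sets_eq_imp_space_eq[OF sets_mu] by simp

lemma ball_sets [measurable, simp]: "ball x r \<in> sets \<mu>"
  by simp

lemma fmeasurable_ball [simp]: "ball x r \<in> fmeasurable \<mu>"
  using finite_ball by (auto intro!: fmeasurableI)

lemma emeasure_ball: "emeasure \<mu> (ball x r) = ennreal (measure \<mu> (ball x r))"
  using finite_ball[of x r] by (intro emeasure_eq_ennreal_measure) auto

lemma measure_ball_pos: "0 < r \<Longrightarrow> 0 < measure \<mu> (ball x r)"
proof -
  assume "0 < r"
  then have "0 < min r R powr Q / C"
    using R_pos C_ge by simp
  also have "\<dots> \<le> measure \<mu> (ball x (min r R))"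
    using \<open>0 < r\<close> R_pos by (intro lower) auto
  also have "\<dots> \<le> measure \<mu> (ball x r)"
    by (intro measure_mono_fmeasurable) auto
  finally show ?thesis .
qed

text \<open>Volume counting: the small disjoint balls all lie in one ball of radius \<open>(a + 1) \<rho>\<close>, and each of
them occupies a fixed fraction of its volume.\<close>
lemma card_overlap_le:
  fixes c :: "'i \<Rightarrow> 'a"
  assumes fin: "finite F" and "0 < \<epsilon>" "\<epsilon> \<le> 1" "0 < \<rho>" "0 \<le> a" and aR: "(a + 1) * \<rho> \<le> R"
    and mem: "\<And>i. i \<in> F \<Longrightarrow> x \<in> ball (c i) (a * \<rho>)"
    and disj: "\<And>i j. i \<in> F \<Longrightarrow> j \<in> F \<Longrightarrow> i \<noteq> j \<Longrightarrow> ball (c i) (\<epsilon> * \<rho>) \<inter> ball (c j) (\<epsilon> * \<rho>) = {}"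
  shows "real (card F) \<le> C\<^sup>2 * ((a + 1) / \<epsilon>) powr Q"
proof -
  have e1: "\<epsilon> * \<rho> \<le> \<rho>" using assms by (simp add: mult_le_cancel_right1)
  have "\<rho> \<le> (a + 1) * \<rho>" using assms by (simp add: mult_le_cancel_right1)
  then have eR: "\<epsilon> * \<rho> \<le> R" using e1 aR by linarith
  have "real (card F) * ((\<epsilon> * \<rho>) powr Q / C) = (\<Sum>i\<in>F. (\<epsilon> * \<rho>) powr Q / C)"
    by simp
  also have "\<dots> \<le> (\<Sum>i\<in>F. measure \<mu> (ball (c i) (\<epsilon> * \<rho>)))"
    using assms eR by (intro sum_mono lower) auto
  also have "\<dots> = measure \<mu> (\<Union>i\<in>F. ball (c i) (\<epsilon> * \<rho>))"
    using disj fin finite_ball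
    by (intro measure_finite_Union[symmetric]) (auto simp: disjoint_family_on_def less_top)
  also have "\<dots> \<le> measure \<mu> (ball x ((a + 1) * \<rho>))"
  proof (intro measure_mono_fmeasurable)
    show "(\<Union>i\<in>F. ball (c i) (\<epsilon> * \<rho>)) \<subseteq> ball x ((a + 1) * \<rho>)"
    proof safe
      fix i y assume i: "i \<in> F" and y: "y \<in> ball (c i) (\<epsilon> * \<rho>)"
      have "dist x y \<le> dist (c i) x + dist (c i) y" by (metis dist_commute dist_triangle)
      also have "\<dots> < a * \<rho> + \<rho>" using mem[OF i] y e1 by (simp del: dist_commute)
      finally show "y \<in> ball x ((a + 1) * \<rho>)" by (simp add: algebra_simps)
    qed
  qed (use fin in auto)
  also have "\<dots> \<le> C * ((a + 1) * \<rho>) powr Q"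
    using assms by (intro upper) auto
  finally have "real (card F) * ((\<epsilon> * \<rho>) powr Q / C) \<le> C * ((a + 1) * \<rho>) powr Q" .
  then have "\<rho> powr Q * (real (card F) * \<epsilon> powr Q) \<le> \<rho> powr Q * (C\<^sup>2 * (a + 1) powr Q)"
    using assms C_ge unfolding powr_mult by (simp add: divide_simps power2_eq_square ac_simps)
  then have "real (card F) * \<epsilon> powr Q \<le> C\<^sup>2 * (a + 1) powr Q"
    using assms by simp
  then show ?thesis
    using assms by (simp add: powr_divide divide_simps)
qed

lemma finite_overlap:
  fixes c :: "'i \<Rightarrow> 'a"
  assumes "0 < \<epsilon>" "\<epsilon> \<le> 1" "0 < \<rho>" "0 \<le> a" "(a + 1) * \<rho> \<le> R"
    and disj: "\<And>i j. i \<in> I \<Longrightarrow> j \<in> I \<Longrightarrow> i \<noteq> j \<Longrightarrow> ball (c i) (\<epsilon> * \<rho>) \<inter> ball (c j) (\<epsilon> * \<rho>) = {}"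
  shows "finite {i\<in>I. x \<in> ball (c i) (a * \<rho>)}" (is "finite ?J")
    and "real (card {i\<in>I. x \<in> ball (c i) (a * \<rho>)}) \<le> C\<^sup>2 * ((a + 1) / \<epsilon>) powr Q"
proof -
  have *: "real (card F) \<le> C\<^sup>2 * ((a + 1) / \<epsilon>) powr Q" if "F \<subseteq> ?J" "finite F" for F
    using that assms by (intro card_overlap_le[where \<rho>=\<rho> and x=x and c=c]) auto
  show fin: "finite ?J"
  proof (rule ccontr)
    assume "infinite ?J"
    then obtain F where "F \<subseteq> ?J" "finite F" "card F = Suc (nat \<lfloor>C\<^sup>2 * ((a + 1) / \<epsilon>) powr Q\<rfloor>)"
      using infinite_arbitrarily_large by blast
    then show False using *[of F] by (simp add: le_nat_floor) linarith
  qed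
  show "real (card ?J) \<le> C\<^sup>2 * ((a + 1) / \<epsilon>) powr Q"
    by (rule * [OF order_refl fin])
qed

end

text \<open>On a bounded space with at least two points, balls of radius above the diameter \<open>D\<close> are the whole
space. Their measure is finite and, for radii between \<open>D\<close> and \<open>R\<close>, comparable to any power of the
radius, at the price of a larger constant.\<close>
lemma regular_measure_exists:
  fixes \<mu> :: "'a::metric_space measure"
  assumes mm: "metric_measure_space \<mu>" and Q: "1 \<le> Q" and ar: "ahlfors_regular \<mu> Q"
    and R: "0 < R" and xy: "(x0::'a) \<noteq> y0"
  shows "\<exists>C. regular_measure \<mu> Q C R"
proof -
  from ar obtain C where C: "C \<ge> 1" and
    bd: "\<And>x r. 0 < r \<Longrightarrow> ennreal r < ediam (UNIV :: 'a set) \<Longrightarrow>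
     ennreal (r powr Q / C) \<le> emeasure \<mu> (ball x r) \<and> emeasure \<mu> (ball x r) \<le> ennreal (C * r powr Q)"
    unfolding ahlfors_regular_def by blast
  have sm: "sets \<mu> = sets borel" and fin: "\<And>x r. 0 < r \<Longrightarrow> emeasure \<mu> (ball x r) < \<infinity>"
    using mm unfolding metric_measure_space_def by auto
  have fin': "emeasure \<mu> (ball x r) < \<infinity>" for x r
    using fin[of r x] by (cases "0 < r") (auto simp: ball_empty)
  have em: "emeasure \<mu> (ball x r) = ennreal (measure \<mu> (ball x r))" for x r
    using fin'[of x r] by (intro emeasure_eq_ennreal_measure) auto
  have bd': "r powr Q / C \<le> measure \<mu> (ball x r) \<and> measure \<mu> (ball x r) \<le> C * r powr Q"
    if "0 < r" "ennreal r < ediam (UNIV :: 'a set)" for x r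
    using bd[OF that, of x] C unfolding em by (simp add: ennreal_le_iff)
  have dle: "ennreal (dist x y) \<le> ediam (UNIV :: 'a set)" for x y :: 'a
    unfolding ediam_def by (meson SUP_upper2 UNIV_I order_refl)
  show ?thesis
  proof (cases "ediam (UNIV :: 'a set) = \<infinity>")
    case True
    then have "regular_measure \<mu> Q C R"
      using bd' C Q R sm fin' by unfold_locales auto
    then show ?thesis ..
  next
    case False
    define D where "D = enn2real (ediam (UNIV :: 'a set))"
    have D: "ediam (UNIV :: 'a set) = ennreal D"
      using False unfolding D_def by (simp add: less_top)
    have dD: "dist x y \<le> D" for x y :: 'a
      using dle[of x y] unfolding D by (metis D_def dist_not_less_zero enn2real_nonneg ennreal_le_iff)
    have Dpos: "0 < D" using dD[of x0 y0] xy by (metis less_le_trans zero_less_dist_iff)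
    define m where "m = measure \<mu> (ball x0 (2 * D))"
    have ballm: "measure \<mu> (ball x r) \<le> m" for x r
    proof -
      have "ball x0 (2 * D) = UNIV" using dD Dpos by (auto intro!: le_less_trans[OF dD])
      moreover have "ball x0 (2 * D) \<in> fmeasurable \<mu>"
        using fin' sm by (auto intro!: fmeasurableI)
      ultimately show ?thesis unfolding m_def
        by (intro measure_mono_fmeasurable) (auto simp: sm)
    qed
    define C' where "C' = C + C * (2 * R / D) powr Q + m / D powr Q"
    have m0: "0 \<le> m" unfolding m_def by simp
    have C': "C \<le> C'" "C * (2 * R / D) powr Q \<le> C'" "m / D powr Q \<le> C'"
      using C m0 unfolding C'_def by simp_all
    have "regular_measure \<mu> Q C' R"
    proof
      fix x r assume r: "0 < (r::real)" "r \<le> R"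
      show "r powr Q / C' \<le> measure \<mu> (ball x r)"
      proof (cases "r < D")
        case True
        have "r powr Q / C' \<le> r powr Q / C" using C C' by (intro divide_left_mono) auto
        also have "\<dots> \<le> measure \<mu> (ball x r)" using bd'[of r x] r True D by (simp add: ennreal_less_iff)
        finally show ?thesis .
      next
        case False
        have "r powr Q / C' \<le> R powr Q / (C * (2 * R / D) powr Q)"
          using r C C' R Dpos Q by (intro frac_le powr_mono2) auto
        also have "\<dots> = (D / 2) powr Q / C"
          using R Dpos C by (simp add: powr_divide powr_mult field_simps)
        also have "\<dots> \<le> measure \<mu> (ball x (D / 2))"
          using bd'[of "D / 2" x] Dpos D by (simp add: ennreal_less_iff)
        also have "\<dots> \<le> measure \<mu> (ball x r)"
          using False Dpos fin' sm by (intro measure_mono_fmeasurable) (auto intro!: fmeasurableI)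
        finally show ?thesis .
      qed
      show "measure \<mu> (ball x r) \<le> C' * r powr Q"
      proof (cases "r < D")
        case True
        have "measure \<mu> (ball x r) \<le> C * r powr Q" using bd'[of r x] r True D by (simp add: ennreal_less_iff)
        also have "\<dots> \<le> C' * r powr Q" using C' by (intro mult_right_mono) auto
        finally show ?thesis .
      next
        case False
        have "measure \<mu> (ball x r) \<le> m / D powr Q * D powr Q" using ballm Dpos by simp
        also have "\<dots> \<le> C' * r powr Q"
          using False Dpos Q C' C by (intro mult_mono powr_mono2) auto
        finally show ?thesis .
      qed
    qed (use sm Q C C' R fin' in auto)
    then show ?thesis ..
  qed
qed

section \<open>Telescoping along dyadic balls\<close>

text \<open>The points chosen in the balls of radius \<open>d / 2 ^ k\<close> converge to \<open>z\<close>, and consecutive values of \<open>f\<close>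
differ by at most a multiple of \<open>(d / 2 ^ k) powr (1 - \<beta>)\<close>. These bounds form a convergent geometric
series because \<open>\<beta> < 1\<close>.\<close>
lemma telescoping_at_point:
  fixes f :: "'a::metric_space \<Rightarrow> 'b::real_normed_vector" and g :: "'a \<Rightarrow> real"
  assumes cont: "continuous_on UNIV f" and "0 < d" and "0 \<le> H" and b: "0 < \<beta>" "\<beta> < 1"
    and pick: "\<And>t. 0 < t \<Longrightarrow> t \<le> d \<Longrightarrow> \<exists>w\<in>P. dist z w < t \<and> g w \<le> H * t powr - \<beta>"
    and grad: "\<And>a b. a \<in> P \<Longrightarrow> b \<in> P \<Longrightarrow> norm (f a - f b) \<le> dist a b * (g a + g b)"
  shows "\<exists>w\<in>P. dist z w < d \<and> g w \<le> H * d powr - \<beta> \<and>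
           norm (f w - f z) \<le> 8 / (1 - 2 powr (\<beta> - 1)) * (H * d powr (1 - \<beta>))"
proof -
  define \<theta> :: real where "\<theta> = 2 powr (\<beta> - 1)"
  have th: "0 < \<theta>" "\<theta> < 1" using b unfolding \<theta>_def by (simp_all add: powr_less_one)
  define t where "t k = d / 2 ^ k" for k :: nat
  have t: "0 < t k" "t k \<le> d" "t (Suc k) = t k / 2" for k
    using \<open>0 < d\<close> by (auto simp: t_def divide_le_eq mult_le_cancel_left1)
  have "\<forall>k. \<exists>w. w \<in> P \<and> dist z w < t k \<and> g w \<le> H * t k powr - \<beta>"
    using pick[OF t(1,2)] by blast
  then obtain w where w: "\<And>k. w k \<in> P" "\<And>k. dist z (w k) < t k" "\<And>k. g (w k) \<le> H * t k powr - \<beta>"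
    by metis
  define D where "D = 8 * (H * d powr (1 - \<beta>))"
  have D0: "0 \<le> D" using assms unfolding D_def by simp
  have step: "norm (f (w k) - f (w (Suc k))) \<le> D * \<theta> ^ k" for k
  proof -
    have "dist (w k) (w (Suc k)) \<le> dist z (w k) + dist z (w (Suc k))"
      by (metis dist_commute dist_triangle)
    also have "\<dots> \<le> 2 * t k" using w(2)[of k] w(2)[of "Suc k"] t(1)[of k] t(3)[of k] by linarith
    finally have d1: "dist (w k) (w (Suc k)) \<le> 2 * t k" .
    have sq: "t (Suc k) powr - \<beta> = 2 powr \<beta> * t k powr - \<beta>"
      using t(1)[of k] by (simp add: t(3) powr_divide powr_minus field_simps)
    have le2: "2 powr \<beta> \<le> (2::real)" using b powr_mono[of \<beta> 1 "2::real"] by simp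
    have "g (w k) + g (w (Suc k)) \<le> H * t k powr - \<beta> + H * (2 powr \<beta> * t k powr - \<beta>)"
      using w(3)[of k] w(3)[of "Suc k"] unfolding sq by linarith
    also have "\<dots> = (1 + 2 powr \<beta>) * (H * t k powr - \<beta>)" by (simp add: algebra_simps)
    also have "\<dots> \<le> 4 * (H * t k powr - \<beta>)"
      using le2 \<open>0 \<le> H\<close> by (intro mult_right_mono) auto
    finally have g1: "g (w k) + g (w (Suc k)) \<le> 4 * (H * t k powr - \<beta>)" .
    have "norm (f (w k) - f (w (Suc k))) \<le> dist (w k) (w (Suc k)) * (g (w k) + g (w (Suc k)))"
      by (intro grad w)
    also have "\<dots> \<le> dist (w k) (w (Suc k)) * (4 * (H * t k powr - \<beta>))"
      by (intro mult_left_mono g1) auto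
    also have "\<dots> \<le> (2 * t k) * (4 * (H * t k powr - \<beta>))"
      using \<open>0 \<le> H\<close> by (intro mult_right_mono d1) auto
    also have "\<dots> = 8 * H * t k powr (1 - \<beta>)"
      using t(1)[of k] by (simp add: powr_diff powr_minus field_simps)
    also have "t k powr (1 - \<beta>) = d powr (1 - \<beta>) * \<theta> ^ k"
    proof -
      have "((2::real) ^ k) powr (1 - \<beta>) = (2 powr real k) powr (1 - \<beta>)"
        by (subst powr_realpow) auto
      also have "\<dots> = inverse (2 powr ((\<beta> - 1) * real k))"
        by (simp only: powr_powr powr_minus[symmetric]) (simp add: algebra_simps)
      also have "2 powr ((\<beta> - 1) * real k) = \<theta> ^ k"
        unfolding \<theta>_def by (simp add: powr_powr[symmetric] powr_realpow)
      finally have *: "((2::real) ^ k) powr (1 - \<beta>) = inverse (\<theta> ^ k)" .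
      show ?thesis unfolding t_def powr_divide * by (simp add: divide_inverse)
    qed
    finally show ?thesis unfolding D_def by (simp add: mult_ac)
  qed
  have part: "norm (f (w 0) - f (w n)) \<le> D / (1 - \<theta>)" for n
  proof -
    have "norm (f (w 0) - f (w n)) \<le> (\<Sum>k<n. D * \<theta> ^ k)"
    proof (induction n)
      case (Suc n)
      have "norm (f (w 0) - f (w (Suc n))) \<le> norm (f (w 0) - f (w n)) + norm (f (w n) - f (w (Suc n)))"
        using dist_triangle[of "f (w 0)" "f (w (Suc n))" "f (w n)"] by (simp add: dist_norm)
      then show ?case using Suc step[of n] by simp
    qed simp
    also have "\<dots> = D * ((1 - \<theta> ^ n) / (1 - \<theta>))"
      using th by (simp add: sum_distrib_left[symmetric] sum_gp_strict)
    also have "\<dots> \<le> D * (1 / (1 - \<theta>))"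
      using th D0 by (intro mult_left_mono divide_right_mono) auto
    finally show ?thesis by simp
  qed
  have "(\<lambda>k. dist (w k) z) \<longlonglongrightarrow> 0"
  proof (rule tendsto_sandwich[of "\<lambda>_. 0" _ _ t])
    show "t \<longlonglongrightarrow> 0" unfolding t_def by (intro LIMSEQ_divide_realpow_zero) simp
    show "\<forall>\<^sub>F k in sequentially. dist (w k) z \<le> t k"
      using w(2) by (simp add: dist_commute less_imp_le)
  qed auto
  then have "w \<longlonglongrightarrow> z" by (subst tendsto_dist_iff)
  then have "(\<lambda>k. f (w k)) \<longlonglongrightarrow> f z"
    using cont isCont_tendsto_compose[of z f w sequentially]
    by (simp add: continuous_on_eq_continuous_at)
  then have "(\<lambda>k. norm (f (w 0) - f (w k))) \<longlonglongrightarrow> norm (f (w 0) - f z)"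
    by (intro tendsto_intros)
  then have "norm (f (w 0) - f z) \<le> D / (1 - \<theta>)"
    using part by (intro LIMSEQ_le_const2) auto
  moreover have "t 0 = d" unfolding t_def by simp
  ultimately show ?thesis
    using w(1)[of 0] w(2)[of 0] w(3)[of 0] unfolding D_def \<theta>_def
    by (intro bexI[of _ "w 0"]) simp_all
qed

lemma holder_from_good_points:
  fixes f :: "'a::metric_space \<Rightarrow> 'b::real_normed_vector" and g :: "'a \<Rightarrow> real"
  assumes cont: "continuous_on UNIV f" and xy: "x \<noteq> y" and "0 \<le> H" and b: "0 < \<beta>" "\<beta> < 1"
    and pick: "\<And>z t. z \<in> {x, y} \<Longrightarrow> 0 < t \<Longrightarrow> t \<le> dist x y \<Longrightarrow>
                 \<exists>w\<in>P. dist z w < t \<and> g w \<le> H * t powr - \<beta>"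
    and grad: "\<And>a b. a \<in> P \<Longrightarrow> b \<in> P \<Longrightarrow> norm (f a - f b) \<le> dist a b * (g a + g b)"
  shows "norm (f x - f y) \<le> (16 / (1 - 2 powr (\<beta> - 1)) + 6) * H * dist x y powr (1 - \<beta>)"
proof -
  define d where "d = dist x y"
  have d: "0 < d" using xy unfolding d_def by simp
  obtain v where v: "v \<in> P" "dist x v < d" "g v \<le> H * d powr - \<beta>"
      "norm (f v - f x) \<le> 8 / (1 - 2 powr (\<beta> - 1)) * (H * d powr (1 - \<beta>))"
    using telescoping_at_point[OF cont d \<open>0 \<le> H\<close> b, of P x g] pick grad unfolding d_def by blast
  obtain w where w: "w \<in> P" "dist y w < d" "g w \<le> H * d powr - \<beta>"
      "norm (f w - f y) \<le> 8 / (1 - 2 powr (\<beta> - 1)) * (H * d powr (1 - \<beta>))"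
    using telescoping_at_point[OF cont d \<open>0 \<le> H\<close> b, of P y g] pick grad unfolding d_def by blast
  have "dist v w \<le> dist x v + dist x y + dist y w"
    using dist_triangle[of v w x] dist_triangle[of x w y] by (simp add: dist_commute)
  then have dvw: "dist v w \<le> 3 * d" using v(2) w(2) unfolding d_def by linarith
  have "norm (f v - f w) \<le> dist v w * (g v + g w)" by (intro grad v w)
  also have "\<dots> \<le> dist v w * (2 * (H * d powr - \<beta>))" using v(3) w(3) by (intro mult_left_mono) auto
  also have "\<dots> \<le> (3 * d) * (2 * (H * d powr - \<beta>))" using \<open>0 \<le> H\<close> by (intro mult_right_mono dvw) auto
  also have "\<dots> = 6 * (H * d powr (1 - \<beta>))" using d by (simp add: powr_diff powr_minus field_simps)
  finally have m: "norm (f v - f w) \<le> 6 * (H * d powr (1 - \<beta>))" .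
  have "norm (f x - f y) \<le> norm (f v - f x) + norm (f v - f w) + norm (f w - f y)"
    using dist_triangle[of "f x" "f y" "f v"] dist_triangle[of "f v" "f y" "f w"]
    by (simp add: dist_norm norm_minus_commute)
  then have "norm (f x - f y) \<le> 2 * (8 / (1 - 2 powr (\<beta> - 1)) * (H * d powr (1 - \<beta>))) + 6 * (H * d powr (1 - \<beta>))"
    using v(4) w(4) m by linarith
  then show ?thesis unfolding d_def[symmetric] by (simp add: algebra_simps)
qed

section \<open>The Morrey estimate for Hajlasz gradients\<close>

context regular_measure
begin

text \<open>Chebyshev's inequality: if \<open>h\<close> exceeded this value on the ball outside \<open>E\<close>, then its integral
would be at least \<open>G\<close>.\<close>
lemma exists_small_value:
  assumes E: "E \<in> null_sets (completion \<mu>)" and sub: "ball z t \<subseteq> A"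
    and t: "0 < t" "t \<le> R"
    and I: "(\<integral>\<^sup>+x\<in>A. h x \<partial>completion \<mu>) < ennreal G"
  shows "\<exists>w\<in>ball z t - E. h w \<le> ennreal (C * G * t powr - Q)"
proof (rule ccontr)
  assume "\<not> ?thesis"
  then have big: "\<And>w. w \<in> ball z t - E \<Longrightarrow> ennreal (C * G * t powr - Q) \<le> h w"
    by (meson linear)
  have G: "0 < G" using I by (metis ennreal_less_zero_iff not_less_zero zero_less_iff_neq_zero gr_zeroI)
  have "ennreal G \<le> ennreal (C * G * t powr - Q * (t powr Q / C))"
    using C_ge t G by (simp add: powr_minus field_simps)
  also have "\<dots> \<le> ennreal (C * G * t powr - Q * measure \<mu> (ball z t))"
    using lower[of t z] t G C_ge by (intro ennreal_leI mult_left_mono) auto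
  also have "\<dots> = ennreal (C * G * t powr - Q) * emeasure (completion \<mu>) (ball z t)"
    using G C_ge by (simp add: emeasure_ball ennreal_mult)
  also have "\<dots> = (\<integral>\<^sup>+x. ennreal (C * G * t powr - Q) * indicator (ball z t) x \<partial>completion \<mu>)"
    by (intro nn_integral_cmult_indicator[symmetric]) auto
  also have "\<dots> \<le> (\<integral>\<^sup>+x\<in>A. h x \<partial>completion \<mu>)"
  proof (rule nn_integral_mono_AE)
    show "AE x in completion \<mu>. ennreal (C * G * t powr - Q) * indicator (ball z t) x \<le> h x * indicator A x"
      using AE_not_in[OF E] by eventually_elim (use big sub in \<open>auto simp: indicator_def\<close>)
  qed
  finally show False using I by simp
qed

text \<open>Morrey's embedding. The points needed for the telescoping argument are those where \<open>g\<^sup>p\<close> is not much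
larger than its mean; the exponent there is \<open>\<beta> = Q / p\<close>. A ball of radius at most \<open>2 \<rho>\<close> around a
point of the given ball stays in the tripled one. The strict bound \<open>G\<close> on the integral leaves room
for Chebyshev's inequality even when the integral vanishes.\<close>
lemma holder_le_gradient_integral:
  fixes f :: "'a \<Rightarrow> 'b::real_normed_vector"
  assumes cont: "continuous_on UNIV f" and p: "Q < p"
    and \<rho>: "0 < \<rho>" "2 * \<rho> \<le> R" and E: "E \<in> null_sets (completion \<mu>)"
    and grad: "\<And>x y. x \<in> ball c (3 * \<rho>) - E \<Longrightarrow> y \<in> ball c (3 * \<rho>) - E \<Longrightarrow>
                ennreal (norm (f x - f y)) \<le> ennreal (dist x y) * (g x + g y)"
  shows "epowr (holder_seminorm (1 - Q / p) f (ball c \<rho>)) p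
     \<le> ennreal ((16 / (1 - 2 powr (Q / p - 1)) + 6) powr p * C)
        * (\<integral>\<^sup>+x\<in>ball c (3 * \<rho>). epowr (g x) p \<partial>completion \<mu>)"
proof -
  define I where "I = (\<integral>\<^sup>+x\<in>ball c (3 * \<rho>). epowr (g x) p \<partial>completion \<mu>)"
  define \<kappa> where "\<kappa> = 16 / (1 - 2 powr (Q / p - 1)) + (6::real)"
  have p0: "0 < p" using p Q_ge by simp
  have \<beta>: "0 < Q / p" "Q / p < 1" using p p0 Q_ge by auto
  have "(2::real) powr (Q / p - 1) < 1" using \<beta> by (simp add: powr_less_one)
  then have \<kappa>: "0 < \<kappa>" unfolding \<kappa>_def by (simp add: add_pos_pos)
  have key: "epowr (holder_seminorm (1 - Q / p) f (ball c \<rho>)) p \<le> ennreal (\<kappa> powr p * C * G)"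
    if G: "I < ennreal G" for G
  proof -
    have G0: "0 < G" using G by (metis ennreal_less_zero_iff not_less_zero zero_less_iff_neq_zero gr_zeroI)
    define H where "H = (C * G) powr (1 / p)"
    define P where "P = {w \<in> ball c (3 * \<rho>) - E. g w < \<infinity>}"
    have bd: "norm (f x - f y) \<le> \<kappa> * H * dist x y powr (1 - Q / p)"
      if x: "x \<in> ball c \<rho>" and y: "y \<in> ball c \<rho>" and xy: "x \<noteq> y" for x y
      unfolding \<kappa>_def
    proof (rule holder_from_good_points[OF cont xy _ \<beta>, where P=P and g="\<lambda>x. enn2real (g x)"])
      show "0 \<le> H" unfolding H_def by simp
      fix z t assume z: "z \<in> {x, y}" and t: "0 < t" "t \<le> dist x y"
      have "dist x y \<le> dist c x + dist c y" by (metis dist_commute dist_triangle)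
      then have t2: "t < 2 * \<rho>" using t x y by simp
      have "ball z t \<subseteq> ball c (3 * \<rho>)"
      proof
        fix w assume "w \<in> ball z t"
        moreover have "dist c w \<le> dist c z + dist z w" by (rule dist_triangle)
        ultimately show "w \<in> ball c (3 * \<rho>)" using t2 z x y by auto
      qed
      from exists_small_value[OF E this t(1) _ G[unfolded I_def]] t2 \<rho>
      obtain w where w: "w \<in> ball z t - E" "epowr (g w) p \<le> ennreal (C * G * t powr - Q)" by auto
      have "g w \<le> epowr (ennreal (C * G * t powr - Q)) (1 / p)"
        using w(2) epowr_le_iff[OF p0] by blast
      also have "\<dots> = ennreal (H * t powr - (Q / p))"
        using C_ge G0 unfolding H_def by (simp add: epowr_ennreal powr_mult powr_powr)
      finally have gw: "g w \<le> ennreal (H * t powr - (Q / p))" .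
      then have "g w < \<infinity>" by (simp add: le_less_trans)
      moreover have "enn2real (g w) \<le> H * t powr - (Q / p)"
        using gw by (intro enn2real_leI) (auto simp: H_def)
      moreover have "w \<in> ball c (3 * \<rho>)" using w(1) \<open>ball z t \<subseteq> ball c (3 * \<rho>)\<close> by auto
      ultimately show "\<exists>w\<in>P. dist z w < t \<and> enn2real (g w) \<le> H * t powr - (Q / p)"
        using w(1) unfolding P_def by auto
    next
      fix a b assume ab: "a \<in> P" "b \<in> P"
      have "ennreal (norm (f a - f b)) \<le> ennreal (dist a b) * (g a + g b)"
        using ab unfolding P_def by (intro grad) auto
      also have "\<dots> = ennreal (dist a b * (enn2real (g a) + enn2real (g b)))"
        using ab unfolding P_def by (simp add: ennreal_mult ennreal_plus less_top)
      finally show "norm (f a - f b) \<le> dist a b * (enn2real (g a) + enn2real (g b))"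
        by (subst (asm) ennreal_le_iff) auto
    qed
    have "holder_seminorm (1 - Q / p) f (ball c \<rho>) \<le> ennreal (\<kappa> * H)"
      unfolding holder_seminorm_def
      using bd by (intro SUP_least) (auto intro!: ennreal_leI simp: divide_le_eq)
    then have "epowr (holder_seminorm (1 - Q / p) f (ball c \<rho>)) p \<le> epowr (ennreal (\<kappa> * H)) p"
      using p0 by (intro epowr_mono)
    also have "\<dots> = ennreal (\<kappa> powr p * C * G)"
      using \<kappa> p0 G0 C_ge unfolding H_def by (simp add: epowr_ennreal powr_mult powr_powr mult.assoc)
    finally show ?thesis .
  qed
  have m0: "0 < \<kappa> powr p * C" using \<kappa> C_ge by simp
  have "epowr (holder_seminorm (1 - Q / p) f (ball c \<rho>)) p \<le> ennreal (\<kappa> powr p * C) * I"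
  proof (cases I)
    case top
    have "ennreal (\<kappa> powr p * C) \<noteq> 0" using m0 by (simp only: ennreal_eq_0_iff not_le)
    then show ?thesis using top by (simp only: ennreal_mult_top) simp
  next
    case (real i)
    show ?thesis
    proof (rule ennreal_le_epsilon)
      fix e :: real assume e: "0 < e"
      have "epowr (holder_seminorm (1 - Q / p) f (ball c \<rho>)) p
            \<le> ennreal (\<kappa> powr p * C * (i + e / (\<kappa> powr p * C)))"
        using e m0 real by (intro key) (simp add: ennreal_less_iff)
      also have "\<dots> = ennreal (\<kappa> powr p * C * i) + ennreal e"
      proof -
        have "0 \<le> \<kappa> powr p * C * i" using real C_ge by simp
        moreover have "a * (i + e / a) = a * i + e" if "0 < a" for a :: real
          using that by (simp add: field_simps)
        note this[OF m0]
        ultimately show ?thesis using e by simp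
      qed
      also have "ennreal (\<kappa> powr p * C * i) = ennreal (\<kappa> powr p * C) * I"
        using m0 real by (simp add: ennreal_mult)
      finally show "epowr (holder_seminorm (1 - Q / p) f (ball c \<rho>)) p
        \<le> ennreal (\<kappa> powr p * C) * I + ennreal e" .
    qed
  qed
  then show ?thesis unfolding I_def \<kappa>_def .
qed

lemma sum_overlapping_integrals_le:
  fixes c :: "'i \<Rightarrow> 'a"
  assumes fin: "finite F" and eps: "0 < \<epsilon>" "\<epsilon> \<le> 1" and \<rho>: "0 < \<rho>" and a: "0 \<le> a" "(a + 1) * \<rho> \<le> R"
    and disj: "\<And>i j. i \<in> F \<Longrightarrow> j \<in> F \<Longrightarrow> i \<noteq> j \<Longrightarrow> ball (c i) (\<epsilon> * \<rho>) \<inter> ball (c j) (\<epsilon> * \<rho>) = {}"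
    and sub: "\<And>i. i \<in> F \<Longrightarrow> ball (c i) (a * \<rho>) \<subseteq> A"
    and h: "(\<lambda>x. h x * indicator A x) \<in> borel_measurable (completion \<mu>)"
  shows "(\<Sum>i\<in>F. \<integral>\<^sup>+x\<in>ball (c i) (a * \<rho>). h x \<partial>completion \<mu>)
     \<le> ennreal (C\<^sup>2 * ((a + 1) / \<epsilon>) powr Q) * (\<integral>\<^sup>+x\<in>A. h x \<partial>completion \<mu>)"
proof -
  have eq: "h x * indicator (ball (c i) (a * \<rho>)) x = h x * indicator A x * indicator (ball (c i) (a * \<rho>)) x"
    if "i \<in> F" for i x
    using sub[OF that] by (auto simp: indicator_def)
  have m: "(\<lambda>x. h x * indicator A x * indicator (ball (c i) (a * \<rho>)) x) \<in> borel_measurable (completion \<mu>)" for i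
    by (intro borel_measurable_times_ennreal h borel_measurable_indicator) simp
  have "(\<Sum>i\<in>F. \<integral>\<^sup>+x\<in>ball (c i) (a * \<rho>). h x \<partial>completion \<mu>)
      = (\<integral>\<^sup>+x. (\<Sum>i\<in>F. h x * indicator A x * indicator (ball (c i) (a * \<rho>)) x) \<partial>completion \<mu>)"
    using m by (subst nn_integral_sum) (auto intro!: sum.cong nn_integral_cong simp: eq)
  also have "\<dots> \<le> (\<integral>\<^sup>+x. ennreal (C\<^sup>2 * ((a + 1) / \<epsilon>) powr Q) * (h x * indicator A x) \<partial>completion \<mu>)"
  proof (rule nn_integral_mono)
    fix x
    have "(\<Sum>i\<in>F. h x * indicator A x * indicator (ball (c i) (a * \<rho>)) x)
        = h x * indicator A x * of_nat (card {i \<in> F. x \<in> ball (c i) (a * \<rho>)})"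
      using fin by (simp add: sum_distrib_left[symmetric] indicator_def sum.If_cases Int_def)
    moreover have "of_nat (card {i \<in> F. x \<in> ball (c i) (a * \<rho>)}) \<le> ennreal (C\<^sup>2 * ((a + 1) / \<epsilon>) powr Q)"
      using finite_overlap(2)[OF eps \<rho> a, of F c x] disj by (simp add: ennreal_of_nat_eq_real_of_nat ennreal_leI)
    ultimately have "(\<Sum>i\<in>F. h x * indicator A x * indicator (ball (c i) (a * \<rho>)) x)
        \<le> (h x * indicator A x) * ennreal (C\<^sup>2 * ((a + 1) / \<epsilon>) powr Q)"
      by (simp only:) (rule mult_left_mono, auto)
    then show "(\<Sum>i\<in>F. h x * indicator A x * indicator (ball (c i) (a * \<rho>)) x)
        \<le> ennreal (C\<^sup>2 * ((a + 1) / \<epsilon>) powr Q) * (h x * indicator A x)"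
      by (simp only: mult.commute[of "ennreal (C\<^sup>2 * ((a + 1) / \<epsilon>) powr Q)"])
  qed
  also have "\<dots> = ennreal (C\<^sup>2 * ((a + 1) / \<epsilon>) powr Q) * (\<integral>\<^sup>+x\<in>A. h x \<partial>completion \<mu>)"
    by (rule nn_integral_cmult[OF h])
  finally show ?thesis .
qed

text \<open>Compactness gives \<open>\<delta>\<close> such that the \<open>\<delta>\<close>-balls around points of \<open>K\<close> lie in \<open>\<Omega>\<close>. If \<open>4 r \<le> \<delta>\<close>, then so do
the tripled balls of a family at scale below \<open>r\<close>, and the Morrey estimates can be summed.\<close>
lemma compactly_holder_le_hajlasz:
  assumes p: "Q < p" and eps: "0 < \<epsilon>" "\<epsilon> \<le> 1" and K: "compact K" and \<Omega>: "open \<Omega>" "K \<subseteq> \<Omega>"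
  shows "\<exists>D>0. \<forall>f :: 'a \<Rightarrow> 'b::real_normed_vector. continuous_on UNIV f \<longrightarrow>
           compactly_holder_seminorm p (1 - Q / p) \<epsilon> f K \<le> ennreal D * hajlasz_seminorm (completion \<mu>) p f \<Omega>"
proof -
  obtain \<delta> where \<delta>: "0 < \<delta>" "(\<Union>x\<in>K. ball x \<delta>) \<subseteq> \<Omega>"
    using compact_subset_open_imp_ball_epsilon_subset[OF K \<Omega>] by blast
  define r where "r = min (1 / 2) (min (R / 4) (\<delta> / 4))"
  have r: "0 < r" "r < 1" "4 * r \<le> R" "4 * r \<le> \<delta>" using \<delta> R_pos unfolding r_def by auto
  have p0: "0 < p" using p Q_ge by simp
  define A1 where "A1 = (16 / (1 - 2 powr (Q / p - 1)) + 6) powr p * C"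
  define A2 where "A2 = C\<^sup>2 * ((3 + 1) / \<epsilon>) powr Q"
  have "Q / p < 1" using p p0 Q_ge by auto
  then have "(2::real) powr (Q / p - 1) < 1" by (simp add: powr_less_one)
  then have "0 < 16 / (1 - 2 powr (Q / p - 1)) + (6::real)" by (simp add: add_pos_pos)
  then have A: "0 < A1" "0 < A2" using C_ge eps unfolding A1_def A2_def by simp_all
  define D where "D = (A1 * A2) powr (1 / p)"
  have D0: "0 < D" using A unfolding D_def by simp
  have "compactly_holder_seminorm p (1 - Q / p) \<epsilon> f K \<le> ennreal D * hajlasz_seminorm (completion \<mu>) p f \<Omega>"
    if cont: "continuous_on UNIV f" for f :: "'a \<Rightarrow> 'b"
  proof -
    have main: "compactly_holder_seminorm p (1 - Q / p) \<epsilon> f K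
        \<le> ennreal D * epowr (\<integral>\<^sup>+x\<in>\<Omega>. epowr (g x) p \<partial>completion \<mu>) (1 / p)"
      if g: "hajlasz_gradient (completion \<mu>) f \<Omega> g" for g
    proof -
      define J where "J = (\<integral>\<^sup>+x\<in>\<Omega>. epowr (g x) p \<partial>completion \<mu>)"
      have "\<Omega> \<in> sets (completion \<mu>)" using \<Omega> by simp
      then have "(\<lambda>x. g x * indicator \<Omega> x) \<in> borel_measurable (completion \<mu>)"
        using g unfolding hajlasz_gradient_def by (subst (asm) borel_measurable_restrict_space_iff_ennreal) auto
      from measurable_compose[OF this epowr_measurable]
      have "(\<lambda>x. epowr (g x * indicator \<Omega> x) p * indicator \<Omega> x) \<in> borel_measurable (completion \<mu>)"
        using \<open>\<Omega> \<in> sets (completion \<mu>)\<close>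
        by (intro borel_measurable_times_ennreal borel_measurable_indicator)
      also have "(\<lambda>x. epowr (g x * indicator \<Omega> x) p * indicator \<Omega> x) = (\<lambda>x. epowr (g x) p * indicator \<Omega> x)"
        by (auto simp: indicator_def)
      finally have gm: "(\<lambda>x. epowr (g x) p * indicator \<Omega> x) \<in> borel_measurable (completion \<mu>)" .
      obtain E where E: "E \<in> null_sets (completion \<mu>)" and
        gE: "\<And>x y. x \<in> \<Omega> - E \<Longrightarrow> y \<in> \<Omega> - E \<Longrightarrow> ennreal (norm (f x - f y)) \<le> ennreal (dist x y) * (g x + g y)"
        using g unfolding hajlasz_gradient_def by blast
      have fam: "(\<Sum>\<^sub>\<infinity>i\<in>I. epowr (holder_seminorm (1 - Q / p) f (ball (c i) \<rho>)) p) \<le> ennreal (A1 * A2) * J"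
        if adm: "(I, c, \<rho>) \<in> admissible_families \<epsilon> K r" for I c \<rho>
      proof (rule infsum_le_finite_sums)
        show "(\<lambda>i. epowr (holder_seminorm (1 - Q / p) f (ball (c i) \<rho>)) p) summable_on I"
          by (intro nonneg_summable_on_complete) auto
        fix F assume F: "finite F" "F \<subseteq> I"
        have \<rho>: "0 < \<rho>" "\<rho> < r" using adm unfolding admissible_families_def by auto
        have sub: "ball (c i) (3 * \<rho>) \<subseteq> \<Omega>" if "i \<in> F" for i
        proof -
          have "ball (c i) \<rho> \<inter> K \<noteq> {}"
            using adm F(2) that unfolding admissible_families_def by blast
          then obtain k where k: "k \<in> K" "dist (c i) k < \<rho>" by auto
          have "ball (c i) (3 * \<rho>) \<subseteq> ball k \<delta>"
          proof
            fix w assume w: "w \<in> ball (c i) (3 * \<rho>)"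
            have "dist k w \<le> dist (c i) k + dist (c i) w" by (metis dist_commute dist_triangle)
            then show "w \<in> ball k \<delta>" using w k \<rho> r by simp
          qed
          then show ?thesis using \<delta> k by blast
        qed
        have gB: "ennreal (norm (f x - f y)) \<le> ennreal (dist x y) * (g x + g y)"
          if "i \<in> F" "x \<in> ball (c i) (3 * \<rho>) - E" "y \<in> ball (c i) (3 * \<rho>) - E" for i x y
          using that sub[of i] by (intro gE) blast+
        have disj: "ball (c i) (\<epsilon> * \<rho>) \<inter> ball (c j) (\<epsilon> * \<rho>) = {}" if "i \<in> F" "j \<in> F" "i \<noteq> j" for i j
          using adm F(2) that unfolding admissible_families_def by blast
        have "(\<Sum>i\<in>F. epowr (holder_seminorm (1 - Q / p) f (ball (c i) \<rho>)) p)
            \<le> (\<Sum>i\<in>F. ennreal A1 * (\<integral>\<^sup>+x\<in>ball (c i) (3 * \<rho>). epowr (g x) p \<partial>completion \<mu>))"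
          unfolding A1_def using \<rho> r
          by (intro sum_mono holder_le_gradient_integral[OF cont p _ _ E] gB) auto
        also have "\<dots> = ennreal A1 * (\<Sum>i\<in>F. \<integral>\<^sup>+x\<in>ball (c i) (3 * \<rho>). epowr (g x) p \<partial>completion \<mu>)"
          by (simp add: sum_distrib_left)
        also have "\<dots> \<le> ennreal A1 * (ennreal A2 * J)"
          unfolding A2_def J_def
          using eps \<rho> r by (intro mult_left_mono sum_overlapping_integrals_le[OF F(1)] gm sub disj) auto
        finally show "(\<Sum>i\<in>F. epowr (holder_seminorm (1 - Q / p) f (ball (c i) \<rho>)) p) \<le> ennreal (A1 * A2) * J"
          using A by (simp add: ennreal_mult mult.assoc)
      qed
      have "compactly_holder_seminorm p (1 - Q / p) \<epsilon> f K \<le> epowr (ennreal (A1 * A2) * J) (1 / p)"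
        unfolding compactly_holder_seminorm_def
      proof (intro epowr_mono INF_lower2[of r])
        show "r \<in> {0<..<1}" using r by simp
        show "(SUP (I, c, \<rho>)\<in>admissible_families \<epsilon> K r.
            \<Sum>\<^sub>\<infinity>i\<in>I. epowr (holder_seminorm (1 - Q / p) f (ball (c i) \<rho>)) p) \<le> ennreal (A1 * A2) * J"
          by (rule SUP_least) (use fam in \<open>simp only: split_paired_all case_prod_conv\<close>)
      qed (use p0 in simp)
      then show ?thesis unfolding J_def D_def using A p0 by (simp add: epowr_mult)
    qed
    have "ennreal (1 / D) * compactly_holder_seminorm p (1 - Q / p) \<epsilon> f K
        \<le> hajlasz_seminorm (completion \<mu>) p f \<Omega>"
      unfolding hajlasz_seminorm_def
    proof (rule INF_greatest)
      fix g assume "g \<in> {g. hajlasz_gradient (completion \<mu>) f \<Omega> g}"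
      from main[OF this[unfolded mem_Collect_eq]]
      have "ennreal (1 / D) * compactly_holder_seminorm p (1 - Q / p) \<epsilon> f K
         \<le> ennreal (1 / D) * (ennreal D * epowr (\<integral>\<^sup>+x\<in>\<Omega>. epowr (g x) p \<partial>completion \<mu>) (1 / p))"
        by (intro mult_left_mono) auto
      also have "\<dots> = epowr (\<integral>\<^sup>+x\<in>\<Omega>. epowr (g x) p \<partial>completion \<mu>) (1 / p)"
        using D0 by (simp add: mult.assoc[symmetric] ennreal_mult[symmetric])
      finally show "ennreal (1 / D) * compactly_holder_seminorm p (1 - Q / p) \<epsilon> f K
         \<le> epowr (\<integral>\<^sup>+x\<in>\<Omega>. epowr (g x) p \<partial>completion \<mu>) (1 / p)" .
    qed
    then have "ennreal D * (ennreal (1 / D) * compactly_holder_seminorm p (1 - Q / p) \<epsilon> f K)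
        \<le> ennreal D * hajlasz_seminorm (completion \<mu>) p f \<Omega>"
      by (intro mult_left_mono) auto
    then show ?thesis using D0 by (simp add: mult.assoc[symmetric] ennreal_mult[symmetric])
  qed
  then show ?thesis using D0 by blast
qed

end

section \<open>A maximal function over finitely many balls\<close>

text \<open>Greedy selection: take a ball of largest radius, discard the balls that meet it (they lie in its
triple), and continue with the rest.\<close>
lemma finite_vitali_covering:
  fixes c :: "'i \<Rightarrow> 'a::metric_space"
  assumes "finite F" "\<And>i. i \<in> F \<Longrightarrow> 0 < r i"
  shows "\<exists>D\<subseteq>F. (\<forall>i\<in>D. \<forall>j\<in>D. i \<noteq> j \<longrightarrow> ball (c i) (r i) \<inter> ball (c j) (r j) = {}) \<and>
           (\<forall>i\<in>F. \<exists>j\<in>D. ball (c i) (r i) \<subseteq> ball (c j) (3 * r j))"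
  using assms
proof (induction F rule: finite_psubset_induct)
  case (psubset F)
  show ?case
  proof (cases "F = {}")
    case False
    then have "Max (r ` F) \<in> r ` F" using psubset.hyps by (intro Max_in) auto
    then obtain m where m: "m \<in> F" "r m = Max (r ` F)" by auto
    then have m: "m \<in> F" "\<And>i. i \<in> F \<Longrightarrow> r i \<le> r m"
      using psubset.hyps by auto
    define F' where "F' = {i\<in>F. ball (c i) (r i) \<inter> ball (c m) (r m) = {}}"
    have "m \<notin> F'" using psubset.prems[OF m(1)] unfolding F'_def by auto
    then have "F' \<subset> F" using m(1) unfolding F'_def by blast
    from psubset.IH[OF this] psubset.prems obtain D where D: "D \<subseteq> F'"
      "\<And>i j. i \<in> D \<Longrightarrow> j \<in> D \<Longrightarrow> i \<noteq> j \<Longrightarrow> ball (c i) (r i) \<inter> ball (c j) (r j) = {}"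
      "\<And>i. i \<in> F' \<Longrightarrow> \<exists>j\<in>D. ball (c i) (r i) \<subseteq> ball (c j) (3 * r j)"
      unfolding F'_def by (metis (no_types, lifting) mem_Collect_eq)
    show ?thesis
    proof (intro exI[of _ "insert m D"] conjI ballI impI)
      show "insert m D \<subseteq> F" using m(1) D(1) \<open>F' \<subset> F\<close> by blast
      fix i j assume "i \<in> insert m D" "j \<in> insert m D" "i \<noteq> j"
      then show "ball (c i) (r i) \<inter> ball (c j) (r j) = {}"
        using D(1,2) unfolding F'_def by blast
    next
      fix i assume i: "i \<in> F"
      show "\<exists>j\<in>insert m D. ball (c i) (r i) \<subseteq> ball (c j) (3 * r j)"
      proof (cases "i \<in> F'")
        case True
        then show ?thesis using D(3) by blast
      next
        case False
        then obtain w where w: "dist (c i) w < r i" "dist (c m) w < r m"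
          using i unfolding F'_def by auto
        have "ball (c i) (r i) \<subseteq> ball (c m) (3 * r m)"
        proof
          fix y assume y: "y \<in> ball (c i) (r i)"
          have "dist (c m) y \<le> dist (c m) w + dist (c i) w + dist (c i) y"
            using dist_triangle[of "c m" y w] dist_triangle[of w y "c i"] by (simp add: dist_commute)
          then show "y \<in> ball (c m) (3 * r m)" using w y m(2)[OF i] by simp
        qed
        then show ?thesis by blast
      qed
    qed
  qed auto
qed

text \<open>A finite-difference form of \<open>d(t\<^sup>q) / t = q / (q - 1) \<cdot> d(t\<^bsup>q-1\<^esup>)\<close>; it is Young's inequality for
\<open>u\<^bsup>q-1\<^esup> \<cdot> t\<close>.\<close>
lemma powr_diff_quotient_le:
  fixes t u q :: real
  assumes "1 < q" "0 < t" "0 \<le> u"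
  shows "(t powr q - u powr q) / t \<le> q / (q - 1) * (t powr (q - 1) - u powr (q - 1))"
proof -
  have "u powr (q - 1) * t \<le> (u powr (q - 1)) powr (q / (q - 1)) / (q / (q - 1)) + t powr q / q"
    using assms by (intro Youngs_inequality) (auto simp: field_simps)
  also have "(u powr (q - 1)) powr (q / (q - 1)) = u powr q"
    using assms by (simp add: powr_powr)
  finally have "q * (u powr (q - 1) * t) \<le> (q - 1) * u powr q + t powr q"
    using assms by (simp add: field_simps)
  moreover have t: "t powr q = t * t powr (q - 1)" using assms by (simp add: powr_diff)
  ultimately have "(t powr q - u powr q) * (q - 1) \<le> q * (t powr (q - 1) - u powr (q - 1)) * t"
    by (simp add: algebra_simps)
  then have "t powr q - u powr q \<le> q * (t powr (q - 1) - u powr (q - 1)) * t / (q - 1)"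
    using assms by (subst pos_le_divide_eq) auto
  also have "\<dots> = (q / (q - 1) * (t powr (q - 1) - u powr (q - 1))) * t" by simp
  finally show ?thesis using assms(2) by (simp only: pos_divide_le_eq)
qed

text \<open>A discrete layer-cake formula for a function with values in the finite set \<open>T\<close>. The weights are the
increments of \<open>t\<^sup>q\<close> between neighbouring values. Dividing them by \<open>t\<close>, as a weak-type inequality
does, costs one power of \<open>m\<close> and a factor \<open>q / (q - 1)\<close>.\<close>
lemma abel_weights:
  fixes T :: "real set"
  assumes "finite T" "\<And>t. t \<in> T \<Longrightarrow> 0 < t" and q: "1 < q"
  shows "\<exists>w. (\<forall>t\<in>T. 0 \<le> w t) \<and> (\<forall>m\<in>T. (\<Sum>t\<in>{t\<in>T. t \<le> m}. w t) = m powr q \<and>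
           (\<Sum>t\<in>{t\<in>T. t \<le> m}. w t / t) \<le> q / (q - 1) * m powr (q - 1))"
  using assms(1,2)
proof (induction T rule: finite_linorder_max_induct)
  case (insert b A)
  have "\<exists>w. (\<forall>t\<in>A. 0 \<le> w t) \<and> (\<forall>m\<in>A. (\<Sum>t\<in>{t\<in>A. t \<le> m}. w t) = m powr q \<and>
           (\<Sum>t\<in>{t\<in>A. t \<le> m}. w t / t) \<le> q / (q - 1) * m powr (q - 1))"
    by (rule insert.IH) (use insert.prems in simp)
  then obtain w where w0: "\<forall>t\<in>A. 0 \<le> w t"
      "\<forall>m\<in>A. (\<Sum>t\<in>{t\<in>A. t \<le> m}. w t) = m powr q \<and>
         (\<Sum>t\<in>{t\<in>A. t \<le> m}. w t / t) \<le> q / (q - 1) * m powr (q - 1)"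
    by blast
  have w: "\<And>t. t \<in> A \<Longrightarrow> 0 \<le> w t"
      "\<And>m. m \<in> A \<Longrightarrow> (\<Sum>t\<in>{t\<in>A. t \<le> m}. w t) = m powr q"
      "\<And>m. m \<in> A \<Longrightarrow> (\<Sum>t\<in>{t\<in>A. t \<le> m}. w t / t) \<le> q / (q - 1) * m powr (q - 1)"
    using w0 by simp_all
  define u where "u = (if A = {} then 0 else Max A)"
  have u: "0 \<le> u" "u \<le> b"
    using insert.hyps insert.prems unfolding u_def by (auto simp: less_imp_le intro!: order.strict_implies_order)
  have allA: "(\<Sum>t\<in>A. w t) = u powr q \<and> (\<Sum>t\<in>A. w t / t) \<le> q / (q - 1) * u powr (q - 1)"
  proof (cases "A = {}")
    case False
    then have "{t\<in>A. t \<le> Max A} = A" "Max A \<in> A" using insert.hyps(1) by auto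
    then show ?thesis using w(2,3)[of "Max A"] False unfolding u_def by simp
  qed (use q in \<open>simp add: u_def\<close>)
  define w' where "w' = w(b := b powr q - u powr q)"
  have b: "b \<notin> A" "0 < b" using insert.hyps insert.prems by auto
  have eqA: "w' t = w t" if "t \<in> A" for t using that b unfolding w'_def by auto
  have sets: "{t \<in> insert b A. t \<le> m} = {t\<in>A. t \<le> m}" if "m \<in> A" for m
    using that insert.hyps by force
  have setb: "{t \<in> insert b A. t \<le> b} = insert b A" using insert.hyps by auto
  show ?case
  proof (intro exI[of _ w'] conjI ballI)
    fix t assume "t \<in> insert b A"
    then show "0 \<le> w' t" using w(1) u q b unfolding w'_def by (auto intro!: powr_mono2)
  next
    fix m assume m: "m \<in> insert b A"
    show "(\<Sum>t\<in>{t \<in> insert b A. t \<le> m}. w' t) = m powr q"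
    proof (cases "m = b")
      case True
      have "(\<Sum>t\<in>A. w' t) = u powr q" using allA eqA by simp
      then show ?thesis using True setb b insert.hyps(1) by (simp add: w'_def)
    next
      case False
      then show ?thesis using m w(2)[of m] sets[of m] eqA by auto
    qed
    show "(\<Sum>t\<in>{t \<in> insert b A. t \<le> m}. w' t / t) \<le> q / (q - 1) * m powr (q - 1)"
    proof (cases "m = b")
      case True
      have "(\<Sum>t\<in>A. w' t / t) \<le> q / (q - 1) * u powr (q - 1)" using allA eqA by simp
      moreover have "w' b / b \<le> q / (q - 1) * (b powr (q - 1) - u powr (q - 1))"
        using powr_diff_quotient_le[OF q b(2) u(1)] by (simp add: w'_def)
      ultimately have "w' b / b + (\<Sum>t\<in>A. w' t / t) \<le> q / (q - 1) * b powr (q - 1)"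
        by (simp add: right_diff_distrib)
      then show ?thesis using True setb b insert.hyps(1) by simp
    next
      case False
      then show ?thesis using m w(3)[of m] sets[of m] eqA by auto
    qed
  qed
qed auto

text \<open>Splits the integrand that the layer-cake formula produces, so that half of the maximal function's
norm can be absorbed into the left-hand side.\<close>
lemma young_absorb:
  fixes g m q :: real
  assumes "1 < q" "0 \<le> g" "0 \<le> m" "0 \<le> b"
  shows "b * (g * m powr (q - 1)) \<le> m powr q / 2 + (2 * b) powr q * g powr q / 2"
proof (cases "2 * b * g \<le> m")
  case True
  have "(2 * b * g) * m powr (q - 1) \<le> m * m powr (q - 1)"
    using True by (intro mult_right_mono) auto
  also have "\<dots> = m powr q" using assms by (cases "m = 0") (auto simp: powr_diff)
  finally have "b * (g * m powr (q - 1)) \<le> m powr q / 2" by simp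
  moreover have "0 \<le> (2 * b) powr q * g powr q / 2" by simp
  ultimately show ?thesis by linarith
next
  case False
  then have "0 < 2 * b * g" using assms by linarith
  have "(2 * b * g) * m powr (q - 1) \<le> (2 * b * g) * (2 * b * g) powr (q - 1)"
    using False assms by (intro mult_left_mono powr_mono2) auto
  also have "\<dots> = (2 * b * g) powr q" using \<open>0 < 2 * b * g\<close> by (simp add: powr_diff)
  also have "\<dots> = (2 * b) powr q * g powr q" using assms by (simp add: powr_mult)
  finally have "b * (g * m powr (q - 1)) \<le> (2 * b) powr q * g powr q / 2" by simp
  moreover have "0 \<le> m powr q / 2" by simp
  ultimately show ?thesis by linarith
qed

text \<open>The uncentred maximal function over a finite family of balls, with the mean over the \<open>i\<close>-th ball
replaced by an arbitrary number \<open>a i\<close>; the value is \<open>0\<close> outside all balls. Its superlevel sets are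
finite unions of balls.\<close>
definition max_over_balls :: "'i set \<Rightarrow> ('i \<Rightarrow> 'a::metric_space) \<Rightarrow> ('i \<Rightarrow> real) \<Rightarrow> ('i \<Rightarrow> real) \<Rightarrow> 'a \<Rightarrow> real" where
  "max_over_balls F c r a x = Max (insert 0 (a ` {i\<in>F. x \<in> ball (c i) (r i)}))"

lemma max_over_balls_nonneg: "finite F \<Longrightarrow> 0 \<le> max_over_balls F c r a x"
  unfolding max_over_balls_def by simp

lemma le_max_over_balls: "finite F \<Longrightarrow> i \<in> F \<Longrightarrow> x \<in> ball (c i) (r i) \<Longrightarrow> a i \<le> max_over_balls F c r a x"
  unfolding max_over_balls_def by (intro Max_ge) auto

lemma superlevel_max_over_balls:
  "finite F \<Longrightarrow> 0 < t \<Longrightarrow> {x. t \<le> max_over_balls F c r a x} = (\<Union>i\<in>{i\<in>F. t \<le> a i}. ball (c i) (r i))"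
  unfolding max_over_balls_def by (auto simp: Max_ge_iff)

lemma max_over_balls_in: "finite F \<Longrightarrow> max_over_balls F c r a x \<in> insert 0 (a ` F)"
proof -
  assume "finite F"
  then have "max_over_balls F c r a x \<in> insert 0 (a ` {i\<in>F. x \<in> ball (c i) (r i)})"
    unfolding max_over_balls_def by (intro Max_in) auto
  then show ?thesis by auto
qed

context regular_measure
begin

lemma max_over_balls_measurable:
  assumes "finite F"
  shows "max_over_balls F c r a \<in> borel_measurable \<mu>"
  unfolding borel_measurable_iff_ge
proof
  fix t
  show "{x \<in> space \<mu>. t \<le> max_over_balls F c r a x} \<in> sets \<mu>"
  proof (cases "0 < t")
    case True
    then show ?thesis using superlevel_max_over_balls[OF assms True, of c r a] assms
      by (auto intro!: sets.finite_UN)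
  next
    case False
    then have "{x \<in> space \<mu>. t \<le> max_over_balls F c r a x} = UNIV"
      using max_over_balls_nonneg[OF assms, of c r a] by (auto intro: order_trans[of t 0])
    then show ?thesis by simp
  qed
qed

text \<open>Since the family is finite, the superlevel set \<open>A\<close> is covered by the triples of finitely many disjoint
balls of the family with mean at least \<open>t\<close>. These balls lie in \<open>A\<close>, so the integral on the right is
taken over \<open>A\<close> itself, which is what makes the passage to the strong inequality short.\<close>
lemma weak_type:
  fixes c :: "'i \<Rightarrow> 'a"
  assumes fin: "finite F" and r: "\<And>i. i \<in> F \<Longrightarrow> 0 < r i" "\<And>i. i \<in> F \<Longrightarrow> 3 * r i \<le> R"
    and G: "integrable \<mu> G" "\<And>x. 0 \<le> G x"
    and a: "\<And>i. i \<in> F \<Longrightarrow> a i = (LINT x|\<mu>. indicator (ball (c i) (r i)) x * G x) / measure \<mu> (ball (c i) (r i))"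
    and t: "0 < t"
  defines "A \<equiv> {x. t \<le> max_over_balls F c r a x}"
  shows "A \<in> fmeasurable \<mu>" and "t * measure \<mu> A \<le> C\<^sup>2 * 3 powr Q * (LINT x|\<mu>. indicator A x * G x)"
proof -
  define F' where "F' = {i\<in>F. t \<le> a i}"
  have A: "A = (\<Union>i\<in>F'. ball (c i) (r i))"
    unfolding A_def F'_def by (rule superlevel_max_over_balls[OF fin t])
  have finF': "finite F'" using fin unfolding F'_def by simp
  have r': "0 < r i" if "i \<in> F'" for i using that r(1) unfolding F'_def by simp
  show Af: "A \<in> fmeasurable \<mu>" unfolding A using finF' by (intro fmeasurable.finite_UN) auto
  have "\<exists>D\<subseteq>F'. (\<forall>i\<in>D. \<forall>j\<in>D. i \<noteq> j \<longrightarrow> ball (c i) (r i) \<inter> ball (c j) (r j) = {}) \<and>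
      (\<forall>i\<in>F'. \<exists>j\<in>D. ball (c i) (r i) \<subseteq> ball (c j) (3 * r j))"
    by (rule finite_vitali_covering[OF finF' r'])
  then obtain D where D: "D \<subseteq> F'"
    "\<And>i j. i \<in> D \<Longrightarrow> j \<in> D \<Longrightarrow> i \<noteq> j \<Longrightarrow> ball (c i) (r i) \<inter> ball (c j) (r j) = {}"
    "\<And>i. i \<in> F' \<Longrightarrow> \<exists>j\<in>D. ball (c i) (r i) \<subseteq> ball (c j) (3 * r j)"
    by metis
  have finD: "finite D" using D(1) finF' finite_subset by blast
  have DF: "i \<in> F" "t \<le> a i" if "i \<in> D" for i using D(1) that unfolding F'_def by auto
  have int: "integrable \<mu> (\<lambda>x. indicator B x * G x)" if "B \<in> sets \<mu>" for B
    using integrable_mult_indicator[OF that G(1)] by simp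
  have "A \<subseteq> (\<Union>j\<in>D. ball (c j) (3 * r j))" unfolding A using D(3) by blast
  then have "measure \<mu> A \<le> measure \<mu> (\<Union>j\<in>D. ball (c j) (3 * r j))"
    using Af finD by (intro measure_mono_fmeasurable fmeasurable.finite_UN) (auto dest: fmeasurableD)
  also have "\<dots> \<le> (\<Sum>j\<in>D. measure \<mu> (ball (c j) (3 * r j)))"
    using finD by (intro measure_UNION_le) auto
  finally have "t * measure \<mu> A \<le> t * (\<Sum>j\<in>D. measure \<mu> (ball (c j) (3 * r j)))"
    using t by (intro mult_left_mono) auto
  also have "\<dots> = (\<Sum>j\<in>D. t * measure \<mu> (ball (c j) (3 * r j)))" by (simp add: sum_distrib_left)
  also have "\<dots> \<le> (\<Sum>j\<in>D. C\<^sup>2 * 3 powr Q * (LINT x|\<mu>. indicator (ball (c j) (r j)) x * G x))"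
  proof (rule sum_mono)
    fix j assume j: "j \<in> D"
    have rj: "0 < r j" "3 * r j \<le> R" using r DF(1)[OF j] by auto
    have "t * measure \<mu> (ball (c j) (r j)) \<le> a j * measure \<mu> (ball (c j) (r j))"
      using DF(2)[OF j] by (intro mult_right_mono) auto
    also have "\<dots> = (LINT x|\<mu>. indicator (ball (c j) (r j)) x * G x)"
      using a[OF DF(1)[OF j]] measure_ball_pos[OF rj(1), of "c j"] by simp
    finally have 1: "t * measure \<mu> (ball (c j) (r j)) \<le> (LINT x|\<mu>. indicator (ball (c j) (r j)) x * G x)" .
    have "measure \<mu> (ball (c j) (3 * r j)) \<le> C * (3 * r j) powr Q"
      using rj by (intro upper) auto
    also have "\<dots> = C\<^sup>2 * 3 powr Q * (r j powr Q / C)"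
      using rj C_ge by (simp add: powr_mult power2_eq_square)
    also have "\<dots> \<le> C\<^sup>2 * 3 powr Q * measure \<mu> (ball (c j) (r j))"
      using lower[of "r j" "c j"] rj by (intro mult_left_mono) auto
    finally have "t * measure \<mu> (ball (c j) (3 * r j)) \<le> t * (C\<^sup>2 * 3 powr Q * measure \<mu> (ball (c j) (r j)))"
      using t by (intro mult_left_mono) auto
    also have "\<dots> = C\<^sup>2 * 3 powr Q * (t * measure \<mu> (ball (c j) (r j)))" by simp
    also have "\<dots> \<le> C\<^sup>2 * 3 powr Q * (LINT x|\<mu>. indicator (ball (c j) (r j)) x * G x)"
      by (intro mult_left_mono 1) auto
    finally show "t * measure \<mu> (ball (c j) (3 * r j))
      \<le> C\<^sup>2 * 3 powr Q * (LINT x|\<mu>. indicator (ball (c j) (r j)) x * G x)" .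
  qed
  also have "\<dots> = C\<^sup>2 * 3 powr Q * (LINT x|\<mu>. (\<Sum>j\<in>D. indicator (ball (c j) (r j)) x * G x))"
    using int by (subst Bochner_Integration.integral_sum) (auto simp: sum_distrib_left)
  also have "\<dots> \<le> C\<^sup>2 * 3 powr Q * (LINT x|\<mu>. indicator A x * G x)"
  proof (intro mult_left_mono integral_mono Bochner_Integration.integrable_sum int)
    fix x
    have "disjoint_family_on (\<lambda>j. ball (c j) (r j)) D"
      using D(2) unfolding disjoint_family_on_def by blast
    then have "(\<Sum>j\<in>D. indicator (ball (c j) (r j)) x :: real) = indicator (\<Union>j\<in>D. ball (c j) (r j)) x"
      using finD by (simp add: indicator_UN_disjoint)
    also have "\<dots> \<le> indicator A x"
      unfolding A using D(1) by (auto simp: indicator_def)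
    finally show "(\<Sum>j\<in>D. indicator (ball (c j) (r j)) x * G x) \<le> indicator A x * G x"
      using G(2)[of x] by (simp add: sum_distrib_right[symmetric] mult_right_mono)
  qed (use Af in auto)
  finally show "t * measure \<mu> A \<le> C\<^sup>2 * 3 powr Q * (LINT x|\<mu>. indicator A x * G x)" .
qed

text \<open>The maximal theorem by Doob's argument: insert the weak-type inequality into the layer-cake formula,
exchange sum and integral, and absorb half of the integral of \<open>M\<^sup>q\<close>, which is finite because \<open>M\<close> is a
simple function supported on finitely many balls.\<close>
lemma strong_type:
  fixes c :: "'i \<Rightarrow> 'a"
  assumes fin: "finite F" and r: "\<And>i. i \<in> F \<Longrightarrow> 0 < r i" "\<And>i. i \<in> F \<Longrightarrow> 3 * r i \<le> R"
    and G: "integrable \<mu> G" "\<And>x. 0 \<le> G x" "integrable \<mu> (\<lambda>x. G x powr q)" and q: "1 < q"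
    and a: "\<And>i. i \<in> F \<Longrightarrow> a i = (LINT x|\<mu>. indicator (ball (c i) (r i)) x * G x) / measure \<mu> (ball (c i) (r i))"
  defines "M \<equiv> max_over_balls F c r a"
  shows "integrable \<mu> (\<lambda>x. M x powr q)"
    and "(LINT x|\<mu>. M x powr q) \<le> (2 * (C\<^sup>2 * 3 powr Q * (q / (q - 1)))) powr q * (LINT x|\<mu>. G x powr q)"
proof -
  define C1 where "C1 = C\<^sup>2 * 3 powr Q"
  define q' where "q' = q / (q - 1)"
  have C1: "0 \<le> C1" unfolding C1_def by simp
  have q': "0 \<le> q'" using q unfolding q'_def by simp
  define T where "T = {t \<in> a ` F. 0 < t}"
  have finT: "finite T" and Tpos: "\<And>t. t \<in> T \<Longrightarrow> 0 < t" using fin unfolding T_def by auto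
  obtain w where w: "\<And>t. t \<in> T \<Longrightarrow> 0 \<le> w t"
      "\<And>m. m \<in> T \<Longrightarrow> (\<Sum>t\<in>{t\<in>T. t \<le> m}. w t) = m powr q"
      "\<And>m. m \<in> T \<Longrightarrow> (\<Sum>t\<in>{t\<in>T. t \<le> m}. w t / t) \<le> q' * m powr (q - 1)"
    using abel_weights[OF finT Tpos q] unfolding q'_def by blast
  define A where "A t = {x. t \<le> M x}" for t
  have A: "A t \<in> fmeasurable \<mu>" "t * measure \<mu> (A t) \<le> C1 * (LINT x|\<mu>. indicator (A t) x * G x)" if "t \<in> T" for t
    using weak_type[OF fin r G(1,2) a Tpos[OF that]] unfolding A_def M_def C1_def by auto
  have M0: "0 \<le> M x" for x unfolding M_def by (rule max_over_balls_nonneg[OF fin])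
  have MT: "M x = 0 \<or> M x \<in> T" for x
    using max_over_balls_in[OF fin, of c r a x] M0[of x] unfolding M_def T_def by auto
  have repr: "(\<Sum>t\<in>T. v t * indicator (A t) x) = (\<Sum>t\<in>{t\<in>T. t \<le> M x}. v t)" for v :: "real \<Rightarrow> real" and x
    using finT unfolding A_def by (simp add: indicator_def sum.If_cases Int_def)
  have low: "{t\<in>T. t \<le> M x} = {}" if "M x = 0" for x using Tpos that by fastforce
  have Mq: "M x powr q = (\<Sum>t\<in>T. w t * indicator (A t) x)" for x
    unfolding repr using MT[of x] w(2)[of "M x"] low[of x] by (cases "M x = 0") (simp_all del: Collect_empty_eq)
  have Mq': "(\<Sum>t\<in>T. w t / t * indicator (A t) x) \<le> q' * M x powr (q - 1)" for x
    unfolding repr using MT[of x] w(3)[of "M x"] low[of x] by (cases "M x = 0") (simp_all del: Collect_empty_eq)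
  have intA: "integrable \<mu> (indicator (A t) :: _ \<Rightarrow> real)" if "t \<in> T" for t
    using A(1)[OF that] by (auto simp: fmeasurable_def)
  show intM: "integrable \<mu> (\<lambda>x. M x powr q)"
    unfolding Mq using intA by auto
  have intAG: "integrable \<mu> (\<lambda>x. indicator (A t) x * G x)" if "t \<in> T" for t
    using integrable_mult_indicator[OF fmeasurableD[OF A(1)[OF that]] G(1)] by simp
  have "(LINT x|\<mu>. M x powr q) = (\<Sum>t\<in>T. w t * measure \<mu> (A t))"
    unfolding Mq using intA by (subst Bochner_Integration.integral_sum) (auto simp: A)
  also have "\<dots> \<le> (\<Sum>t\<in>T. w t / t * (C1 * (LINT x|\<mu>. indicator (A t) x * G x)))"
  proof (rule sum_mono)
    fix t assume t: "t \<in> T"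
    have "w t / t * (t * measure \<mu> (A t)) \<le> w t / t * (C1 * (LINT x|\<mu>. indicator (A t) x * G x))"
      using w(1)[OF t] Tpos[OF t] by (intro mult_left_mono A(2)[OF t]) auto
    then show "w t * measure \<mu> (A t) \<le> w t / t * (C1 * (LINT x|\<mu>. indicator (A t) x * G x))"
      using Tpos[OF t] by simp
  qed
  also have "\<dots> = (LINT x|\<mu>. (\<Sum>t\<in>T. (w t / t * C1) * (indicator (A t) x * G x)))"
    using intAG by (subst Bochner_Integration.integral_sum) (auto simp: mult.assoc)
  also have "\<dots> \<le> (LINT x|\<mu>. M x powr q / 2 + (2 * (C1 * q')) powr q * G x powr q / 2)"
  proof (rule integral_mono)
    show "integrable \<mu> (\<lambda>x. \<Sum>t\<in>T. (w t / t * C1) * (indicator (A t) x * G x))"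
      using intAG by (intro Bochner_Integration.integrable_sum integrable_mult_right) auto
    show "integrable \<mu> (\<lambda>x. M x powr q / 2 + (2 * (C1 * q')) powr q * G x powr q / 2)"
      using intM G(3) by (intro Bochner_Integration.integrable_add integrable_divide integrable_mult_right) auto
    fix x
    have "(\<Sum>t\<in>T. (w t / t * C1) * (indicator (A t) x * G x)) = C1 * G x * (\<Sum>t\<in>T. w t / t * indicator (A t) x)"
      by (simp add: sum_distrib_left mult_ac)
    also have "\<dots> \<le> C1 * G x * (q' * M x powr (q - 1))"
      using C1 G(2) by (intro mult_left_mono Mq') auto
    also have "\<dots> = C1 * q' * (G x * M x powr (q - 1))" by simp
    also have "\<dots> \<le> M x powr q / 2 + (2 * (C1 * q')) powr q * G x powr q / 2"
      using q C1 q' G(2) M0 by (intro young_absorb) auto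
    finally show "(\<Sum>t\<in>T. (w t / t * C1) * (indicator (A t) x * G x))
      \<le> M x powr q / 2 + (2 * (C1 * q')) powr q * G x powr q / 2" .
  qed
  also have "\<dots> = (LINT x|\<mu>. M x powr q) / 2 + (2 * (C1 * q')) powr q * (LINT x|\<mu>. G x powr q) / 2"
    using intM G(3) by simp
  finally have "(LINT x|\<mu>. M x powr q) \<le> (2 * (C1 * q')) powr q * (LINT x|\<mu>. G x powr q)" by simp
  then show "(LINT x|\<mu>. M x powr q) \<le> (2 * (C\<^sup>2 * 3 powr Q * (q / (q - 1)))) powr q * (LINT x|\<mu>. G x powr q)"
    unfolding C1_def q'_def .
qed

text \<open>A ball of radius \<open>t \<ge> \<rho>\<close> around a point of \<open>K\<close> lies in a ball of comparable radius \<open>2 ^ k * \<rho>\<close> around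
one of the given centres. So the finitely many balls with these centres and dyadic radii control all means
at scales from \<open>\<rho>\<close> up to \<open>R / 12\<close>, with constants independent of \<open>\<rho>\<close>. The factor \<open>12\<close> comes from
\<open>2 ^ k * \<rho> < 4 * t\<close> and the tripling in the covering lemma.\<close>
lemma maximal_function_above_scale:
  fixes c :: "'i \<Rightarrow> 'a"
  assumes fin: "finite I" and \<rho>: "0 < \<rho>" and cover: "K \<subseteq> (\<Union>i\<in>I. ball (c i) \<rho>)"
    and G: "integrable \<mu> G" "\<And>x. 0 \<le> G x" "integrable \<mu> (\<lambda>x. G x powr q)" and q: "1 < q"
  obtains M where "M \<in> borel_measurable \<mu>" "\<And>x. 0 \<le> M x" "integrable \<mu> (\<lambda>x. M x powr q)"
    "(LINT x|\<mu>. M x powr q) \<le> (2 * (C\<^sup>2 * 3 powr Q * (q / (q - 1)))) powr q * (LINT x|\<mu>. G x powr q)"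
    "\<And>x t. x \<in> K \<Longrightarrow> \<rho> \<le> t \<Longrightarrow> 12 * t \<le> R \<Longrightarrow>
       (LINT y|\<mu>. indicator (ball x t) y * G y) \<le> C * 4 powr Q * t powr Q * M x"
proof -
  obtain n where n: "R / \<rho> < 2 ^ n" using real_arch_pow[of 2 "R / \<rho>"] by auto
  define F where "F = {(i, k). i \<in> I \<and> k \<le> n \<and> 3 * (2 ^ k * \<rho>) \<le> R}"
  have finF: "finite F"
    by (rule finite_subset[of _ "I \<times> {..n}"]) (use fin in \<open>auto simp: F_def\<close>)
  define c' where "c' j = c (fst j)" for j :: "'i \<times> nat"
  define r where "r j = 2 ^ snd j * \<rho>" for j :: "'i \<times> nat"
  define a where "a j = (LINT x|\<mu>. indicator (ball (c' j) (r j)) x * G x) / measure \<mu> (ball (c' j) (r j))" for j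
  have r: "0 < r j" "3 * r j \<le> R" if "j \<in> F" for j
    using that \<rho> unfolding r_def F_def by auto
  have int: "integrable \<mu> (\<lambda>x. indicator B x * G x)" if "B \<in> sets \<mu>" for B
    using integrable_mult_indicator[OF that G(1)] by simp
  show ?thesis
  proof (rule that[of "max_over_balls F c' r a"])
    show "max_over_balls F c' r a \<in> borel_measurable \<mu>" by (rule max_over_balls_measurable[OF finF])
    show "0 \<le> max_over_balls F c' r a x" for x by (rule max_over_balls_nonneg[OF finF])
    show "integrable \<mu> (\<lambda>x. max_over_balls F c' r a x powr q)"
      "(LINT x|\<mu>. max_over_balls F c' r a x powr q)
         \<le> (2 * (C\<^sup>2 * 3 powr Q * (q / (q - 1)))) powr q * (LINT x|\<mu>. G x powr q)"
      by (rule strong_type[OF finF r G q]; simp add: a_def)+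
    fix x t assume x: "x \<in> K" and t: "\<rho> \<le> t" "12 * t \<le> R"
    obtain i where i: "i \<in> I" "dist (c i) x < \<rho>" using cover x by auto
    have ex: "\<exists>k. 2 * t \<le> 2 ^ k * \<rho>"
      using real_arch_pow[of 2 "2 * t / \<rho>"] \<rho> by (auto simp: pos_divide_less_eq intro: less_imp_le)
    define k where "k = (LEAST k. 2 * t \<le> 2 ^ k * \<rho>)"
    have k: "2 * t \<le> 2 ^ k * \<rho>" unfolding k_def by (rule LeastI_ex[OF ex])
    have k0: "k \<noteq> 0" using k t \<rho> by (cases k) auto
    then obtain k' where k': "k = Suc k'" by (cases k) auto
    have "\<not> 2 * t \<le> 2 ^ k' * \<rho>" using not_less_Least[of k' "\<lambda>k. 2 * t \<le> 2 ^ k * \<rho>"] k' unfolding k_def by auto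
    then have k4: "2 ^ k * \<rho> < 4 * t" unfolding k' by (simp add: not_le mult.commute)
    have "R < 2 ^ n * \<rho>" using n \<rho> by (simp add: pos_divide_less_eq)
    then have "2 ^ k * \<rho> < 2 ^ n * \<rho>" using k4 t \<rho> by linarith
    then have "k \<le> n" using \<rho> by simp
    then have ik: "(i, k) \<in> F" using i k4 t unfolding F_def by auto
    have rj: "r (i, k) = 2 ^ k * \<rho>" "c' (i, k) = c i" unfolding r_def c'_def by auto
    have sub: "ball x t \<subseteq> ball (c' (i, k)) (r (i, k))"
    proof
      fix y assume "y \<in> ball x t"
      then show "y \<in> ball (c' (i, k)) (r (i, k))"
        using dist_triangle[of "c i" y x] i(2) k t(1) unfolding rj by simp
    qed
    have "(LINT y|\<mu>. indicator (ball x t) y * G y) \<le> (LINT y|\<mu>. indicator (ball (c' (i, k)) (r (i, k))) y * G y)"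
      using sub G(2) by (intro integral_mono int) (auto simp: indicator_def)
    also have "\<dots> = a (i, k) * measure \<mu> (ball (c' (i, k)) (r (i, k)))"
      using measure_ball_pos[OF r(1)[OF ik], of "c' (i, k)"] unfolding a_def by simp
    also have "\<dots> \<le> max_over_balls F c' r a x * (C * (4 * t) powr Q)"
    proof (intro mult_mono)
      have "x \<in> ball x t" using t \<rho> by simp
      then have "x \<in> ball (c' (i, k)) (r (i, k))" using sub by blast
      then show "a (i, k) \<le> max_over_balls F c' r a x" by (rule le_max_over_balls[OF finF ik])
      have "measure \<mu> (ball (c' (i, k)) (r (i, k))) \<le> C * r (i, k) powr Q"
        using r[OF ik] by (intro upper) auto
      also have "\<dots> \<le> C * (4 * t) powr Q"
        using C_ge r(1)[OF ik] k4 Q_ge unfolding rj by (intro mult_left_mono powr_mono2) auto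
      finally show "measure \<mu> (ball (c' (i, k)) (r (i, k))) \<le> C * (4 * t) powr Q" .
    qed (auto intro: max_over_balls_nonneg[OF finF])
    also have "\<dots> = C * 4 powr Q * t powr Q * max_over_balls F c' r a x"
      by (simp add: powr_mult)
    finally show "(LINT y|\<mu>. indicator (ball x t) y * G y) \<le> C * 4 powr Q * t powr Q * max_over_balls F c' r a x" .
  qed
qed

end

section \<open>Almost everywhere limits from midpoint convexity\<close>

text \<open>The logarithm turns convergence of \<open>exp (- h n / 2)\<close> into convergence of \<open>h n\<close>; the limit \<open>0\<close>
corresponds to \<open>\<infinity>\<close>.\<close>
lemma ennreal_limit_from_exp:
  fixes h :: "nat \<Rightarrow> real"
  assumes "convergent (\<lambda>n. exp (- h n / 2))"
  shows "(\<lambda>n. ennreal (h n)) \<longlonglongrightarrow> liminf (\<lambda>n. ennreal (h n))"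
proof -
  obtain \<psi> where \<psi>: "(\<lambda>n. exp (- h n / 2)) \<longlonglongrightarrow> \<psi>"
    using assms by (auto simp: convergent_def)
  have "0 \<le> \<psi>" by (rule LIMSEQ_le_const[OF \<psi>]) auto
  have "\<exists>l. (\<lambda>n. ennreal (h n)) \<longlonglongrightarrow> l"
  proof (cases "\<psi> = 0")
    case True
    have "filterlim h at_top sequentially"
      unfolding filterlim_at_top
    proof
      fix Z
      have "\<forall>\<^sub>F n in sequentially. exp (- h n / 2) < exp (- Z / 2)"
        using \<psi> True by (intro order_tendstoD(2)) auto
      then show "\<forall>\<^sub>F n in sequentially. Z \<le> h n" by eventually_elim simp
    qed
    then have "(\<lambda>n. ennreal (h n)) \<longlonglongrightarrow> top" by (simp add: ennreal_tendsto_top_eq_at_top)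
    then show ?thesis ..
  next
    case False
    then have "(\<lambda>n. - 2 * ln (exp (- h n / 2))) \<longlonglongrightarrow> - 2 * ln \<psi>"
      by (intro tendsto_intros \<psi>)
    then have "h \<longlonglongrightarrow> - 2 * ln \<psi>" by simp
    then show ?thesis by (blast intro: tendsto_ennrealI)
  qed
  then show ?thesis using lim_imp_Liminf[OF sequentially_bot] by metis
qed

text \<open>On a finite measure space geometric decay of the squared \<open>L\<^sup>2\<close> norms of the increments makes their \<open>L\<^sup>1\<close>
norms summable, so almost every series of increments converges absolutely.\<close>
lemma (in finite_measure) AE_convergent_of_summable_L2_increments:
  fixes \<psi> :: "nat \<Rightarrow> 'a \<Rightarrow> real"
  assumes m: "\<And>n. \<psi> n \<in> borel_measurable M" and b: "\<And>n x. \<bar>\<psi> n x\<bar> \<le> 1"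
    and d: "\<And>n. (LINT x|M. (\<psi> n x - \<psi> (Suc n) x)\<^sup>2) \<le> D / 4 ^ n"
  shows "AE x in M. convergent (\<lambda>n. \<psi> n x)"
proof -
  define d where "d n x = \<bar>\<psi> n x - \<psi> (Suc n) x\<bar>" for n x
  have dm [measurable]: "d n \<in> borel_measurable M" for n
    using m unfolding d_def by measurable
  have db: "\<bar>d n x\<bar> \<le> 2" for n x
    using b[of n x] b[of "Suc n" x] unfolding d_def by linarith
  have id: "integrable M (d n)" for n
    by (rule integrable_const_bound[of _ 2]) (use db in auto)
  have id2: "integrable M (\<lambda>x. (d n x)\<^sup>2)" for n
  proof (rule integrable_const_bound[of _ 4])
    have "(d n x)\<^sup>2 \<le> 2\<^sup>2" for x using db[of n x] by (intro power2_le_iff_abs_le[THEN iffD2]) auto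
    then show "AE x in M. norm ((d n x)\<^sup>2) \<le> 4" by simp
  qed simp
  define D' where "D' = (D + measure M (space M)) / 2"
  have L1: "(LINT x|M. d n x) \<le> D' * (1 / 2) ^ n" for n
  proof -
    have "(LINT x|M. d n x) \<le> (LINT x|M. 2 ^ n / 2 * (d n x)\<^sup>2 + (1 / 2) ^ n / 2)"
    proof (intro integral_mono)
      fix x
      \<comment> \<open>The weight \<open>2 ^ n\<close> balances the two terms, so that both contribute a multiple of \<open>(1 / 2) ^ n\<close>.\<close>
      have "0 \<le> (2 ^ n * d n x - 1)\<^sup>2 / (2 * 2 ^ n)" by simp
      also have "\<dots> = 2 ^ n / 2 * (d n x)\<^sup>2 + (1 / 2) ^ n / 2 - d n x"
        by (simp add: power2_diff power_mult_distrib power2_eq_square field_simps)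
      finally show "d n x \<le> 2 ^ n / 2 * (d n x)\<^sup>2 + (1 / 2) ^ n / 2" by simp
    qed (use id id2 in auto)
    also have "\<dots> = 2 ^ n / 2 * (LINT x|M. (d n x)\<^sup>2) + (1 / 2) ^ n / 2 * measure M (space M)"
      using id2 by simp
    also have "\<dots> \<le> 2 ^ n / 2 * (D / 4 ^ n) + (1 / 2) ^ n / 2 * measure M (space M)"
      using assms(3)[of n] unfolding d_def by (intro add_right_mono mult_left_mono) auto
    also have "\<dots> = D' * (1 / 2) ^ n"
    proof -
      have "(4::real) ^ n = 2 ^ n * 2 ^ n" by (simp add: power_mult_distrib[symmetric])
      then show ?thesis unfolding D'_def by (simp add: field_simps)
    qed
    finally show ?thesis .
  qed
  have "0 \<le> (LINT x|M. d 0 x)" by (intro integral_nonneg_AE) (simp add: d_def)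
  then have D'0: "0 \<le> D'" using L1[of 0] by simp
  have "(\<integral>\<^sup>+x. (\<Sum>n. ennreal (d n x)) \<partial>M) = (\<Sum>n. \<integral>\<^sup>+x. ennreal (d n x) \<partial>M)"
    by (intro nn_integral_suminf) measurable
  also have "\<dots> \<le> (\<Sum>n. ennreal (D' * (1 / 2) ^ n))"
  proof (intro suminf_le summableI allI)
    fix n
    have "(\<integral>\<^sup>+x. ennreal (d n x) \<partial>M) = ennreal (LINT x|M. d n x)"
      by (intro nn_integral_eq_integral id) (simp add: d_def)
    also have "\<dots> \<le> ennreal (D' * (1 / 2) ^ n)" by (intro ennreal_leI L1)
    finally show "(\<integral>\<^sup>+x. ennreal (d n x) \<partial>M) \<le> ennreal (D' * (1 / 2) ^ n)" .
  qed
  also have "\<dots> = ennreal (\<Sum>n. D' * (1 / 2) ^ n)"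
    using D'0 by (intro suminf_ennreal2) (auto intro!: summable_mult summable_geometric)
  also have "\<dots> < \<infinity>" by simp
  finally have "AE x in M. (\<Sum>n. ennreal (d n x)) \<noteq> \<infinity>"
    by (intro nn_integral_PInf_AE) (auto simp: less_top)
  then show ?thesis
  proof eventually_elim
    case (elim x)
    then have "summable (\<lambda>n. d n x)"
      by (intro summable_suminf_not_top) (auto simp: d_def)
    then have "summable (\<lambda>n. \<bar>\<psi> (Suc n) x - \<psi> n x\<bar>)"
      unfolding d_def by (simp add: abs_minus_commute)
    then have "summable (\<lambda>n. \<psi> (Suc n) x - \<psi> n x)" by (rule summable_rabs_cancel)
    then have "convergent (\<lambda>n. \<Sum>k<n. \<psi> (Suc k) x - \<psi> k x)" by (simp add: summable_iff_convergent)
    then have "convergent (\<lambda>n. \<psi> n x - \<psi> 0 x)" by (simp only: sum_lessThan_telescope[of "\<lambda>n. \<psi> n x"])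
    then have "convergent (\<lambda>n. (\<psi> n x - \<psi> 0 x) + \<psi> 0 x)" by (intro convergent_add convergent_const)
    then show ?case by simp
  qed
qed

text \<open>A substitute for weak compactness that yields almost everywhere convergence. Choose almost minimisers
of \<open>\<Phi> h = \<integral> exp (- h)\<close> over \<open>S n\<close>. The midpoint of two of them is again a competitor, and the identity
\<open>e\<^bsup>-a\<^esup> + e\<^bsup>-b\<^esup> - 2 e\<^bsup>-(a+b)/2\<^esup> = (e\<^bsup>-a/2\<^esup> - e\<^bsup>-b/2\<^esup>)\<^sup>2\<close> then shows that the functions \<open>exp (- h n / 2)\<close>
have small \<open>L\<^sup>2\<close> increments. The exponential keeps all integrals finite without any bound on \<open>h\<close>.\<close>
lemma (in finite_measure) AE_limit_from_decreasing_midpoint_convex: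
  fixes S :: "nat \<Rightarrow> ('a \<Rightarrow> real) set"
  assumes ne: "\<And>n. S n \<noteq> {}" and dec: "\<And>n. S (Suc n) \<subseteq> S n"
    and mid: "\<And>n a b. a \<in> S n \<Longrightarrow> b \<in> S n \<Longrightarrow> (\<lambda>x. (a x + b x) / 2) \<in> S n"
    and meas: "\<And>n h. h \<in> S n \<Longrightarrow> h \<in> borel_measurable M" and nonneg: "\<And>n h x. h \<in> S n \<Longrightarrow> 0 \<le> h x"
  obtains h where "\<And>n. h n \<in> S n"
    "AE x in M. (\<lambda>n. ennreal (h n x)) \<longlonglongrightarrow> liminf (\<lambda>n. ennreal (h n x))"
proof -
  have anti: "S n \<subseteq> S m" if "m \<le> n" for m n
    using that dec by (rule lift_Suc_antimono_le[rotated])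
  define \<Phi> where "\<Phi> h = (LINT x|M. exp (- h x))" for h :: "'a \<Rightarrow> real"
  have int: "integrable M (\<lambda>x. exp (- h x))" if "h \<in> S n" for h n
    by (rule integrable_const_bound[of _ 1]) (use nonneg[OF that] meas[OF that] in auto)
  have \<Phi>0: "0 \<le> \<Phi> h" for h unfolding \<Phi>_def by (intro integral_nonneg_AE) simp
  have \<Phi>1: "\<Phi> h \<le> measure M (space M)" if "h \<in> S n" for h n
  proof -
    have "\<Phi> h \<le> (LINT x|M. 1)" unfolding \<Phi>_def
      using int[OF that] nonneg[OF that] by (intro integral_mono) auto
    then show ?thesis by simp
  qed
  define J where "J n = Inf (\<Phi> ` S n)" for n
  have bdd: "bdd_below (\<Phi> ` S n)" for n using \<Phi>0 by (intro bdd_belowI[of _ 0]) auto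
  have Jle: "J n \<le> \<Phi> h" if "h \<in> S n" for n h
    unfolding J_def using that bdd by (intro cINF_lower) auto
  have Jmono: "J m \<le> J n" if "m \<le> n" for m n
    unfolding J_def using anti[OF that] ne bdd by (intro cINF_superset_mono) auto
  have Jb: "J n \<le> measure M (space M)" for n
    using ne[of n] Jle \<Phi>1 by (meson ex_in_conv order_trans)
  define L where "L = (SUP n. J n)"
  have bddJ: "bdd_above (range J)" using Jb by (intro bdd_aboveI2)
  have JL: "J n \<le> L" for n unfolding L_def by (intro cSUP_upper bddJ) simp
  have "\<exists>n\<ge>k. L - 1 / 4 ^ k < J n" for k :: nat
  proof -
    have "L - 1 / 4 ^ k < (SUP n. J n)" unfolding L_def by simp
    then have "\<exists>n. L - 1 / 4 ^ k < J n" using bddJ by (subst (asm) less_cSUP_iff) auto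
    then obtain n where "L - 1 / 4 ^ k < J n" ..
    then have "L - 1 / 4 ^ k < J (max k n)" using Jmono[of n "max k n"] by simp
    then show ?thesis by (meson max.cobounded1)
  qed
  \<comment> \<open>The infima \<open>J n\<close> increase to \<open>L\<close>. Passing to indices where they are within \<open>1 / 4 ^ k\<close> of \<open>L\<close> makes
    the increments below decay geometrically.\<close>
  then obtain N where N: "\<And>k. k \<le> N k" "\<And>k. L - 1 / 4 ^ k < J (N k)" by metis
  have "\<exists>h\<in>S (N k). \<Phi> h < L + 1 / 4 ^ k" for k :: nat
  proof -
    have "J (N k) < L + 1 / 4 ^ k" using JL[of "N k"] by (simp add: add_strict_increasing2 le_less_trans)
    then show ?thesis unfolding J_def using ne bdd by (subst (asm) cINF_less_iff) auto
  qed
  then obtain h where h: "\<And>k. h k \<in> S (N k)" "\<And>k. \<Phi> (h k) < L + 1 / 4 ^ k" by metis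
  have hk: "h k \<in> S k" for k using h(1) anti[OF N(1)] by blast
  have "AE x in M. convergent (\<lambda>k. exp (- h k x / 2))"
  proof (rule AE_convergent_of_summable_L2_increments[where D=4])
    show "(\<lambda>x. exp (- h n x / 2)) \<in> borel_measurable M" for n using meas[OF hk[of n]] by measurable
    show "\<bar>exp (- h n x / 2)\<bar> \<le> 1" for n x using nonneg[OF hk[of n]] by simp
    fix k
    define m where "m = min (N k) (N (Suc k))"
    have hm: "h k \<in> S m" "h (Suc k) \<in> S m"
      using h(1) anti unfolding m_def by (meson in_mono min.cobounded1 min.cobounded2)+
    have "L - 1 / 4 ^ k < J m"
    proof -
      have "(1::real) / 4 ^ Suc k \<le> 1 / 4 ^ k" by (simp add: divide_simps)
      then show ?thesis using N(2)[of k] N(2)[of "Suc k"] unfolding m_def by (auto simp: min_def)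
    qed
    also have "J m \<le> \<Phi> (\<lambda>x. (h k x + h (Suc k) x) / 2)" by (intro Jle mid hm)
    finally have low: "L - 1 / 4 ^ k < \<Phi> (\<lambda>x. (h k x + h (Suc k) x) / 2)" .
    have sq: "(exp (- h k x / 2) - exp (- h (Suc k) x / 2))\<^sup>2
        = exp (- h k x) + exp (- h (Suc k) x) - 2 * exp (- ((h k x + h (Suc k) x) / 2))" for x
    proof -
      have e: "exp (- h k x) = exp (- h k x / 2) * exp (- h k x / 2)"
          "exp (- h (Suc k) x) = exp (- h (Suc k) x / 2) * exp (- h (Suc k) x / 2)"
          "exp (- ((h k x + h (Suc k) x) / 2)) = exp (- h k x / 2) * exp (- h (Suc k) x / 2)"
        by (simp_all add: mult_exp_exp add_divide_distrib)
      show ?thesis unfolding e by (simp add: power2_eq_square algebra_simps)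
    qed
    have "(LINT x|M. (exp (- h k x / 2) - exp (- h (Suc k) x / 2))\<^sup>2)
        = \<Phi> (h k) + \<Phi> (h (Suc k)) - 2 * \<Phi> (\<lambda>x. (h k x + h (Suc k) x) / 2)"
      unfolding sq \<Phi>_def using int[OF hm(1)] int[OF hm(2)] int[OF mid[OF hm]] by simp
    also have "\<dots> \<le> 4 / 4 ^ k"
    proof -
      have "(1::real) / 4 ^ Suc k \<le> 1 / 4 ^ k" by (simp add: divide_simps)
      then show ?thesis using low h(2)[of k] h(2)[of "Suc k"] by simp
    qed
    finally show "(LINT x|M. (exp (- h k x / 2) - exp (- h (Suc k) x / 2))\<^sup>2) \<le> 4 / 4 ^ k" .
  qed
  then have "AE x in M. (\<lambda>n. ennreal (h n x)) \<longlonglongrightarrow> liminf (\<lambda>n. ennreal (h n x))"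
    by eventually_elim (rule ennreal_limit_from_exp)
  then show ?thesis using that hk by blast
qed

section \<open>Lipschitz approximation at a fixed scale\<close>

text \<open>A bump supported in the ball of radius \<open>3 \<rho> / 4\<close>. This is less than \<open>\<rho>\<close>, so that near a point \<open>x\<close> only
balls of radius \<open>\<rho>\<close> containing \<open>x\<close> itself are active, and more than \<open>\<rho> / 2\<close>, so that on a set
covered by the half balls the bumps add up to at least \<open>\<rho> / 4\<close>.\<close>
definition bump :: "real \<Rightarrow> 'a::metric_space \<Rightarrow> 'a \<Rightarrow> real" where
  "bump \<rho> z x = max 0 (3 / 4 * \<rho> - dist z x)"

text \<open>The average of the values \<open>v i\<close> with respect to the partition of unity given by the bumps. The lower
bound \<open>\<rho> / 4\<close> in the denominator is inactive on the set covered by the half balls; elsewhere it makes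
the function globally Lipschitz, as the Poincare inequality requires.\<close>
definition blend :: "'i set \<Rightarrow> ('i \<Rightarrow> 'a::metric_space) \<Rightarrow> real \<Rightarrow> ('i \<Rightarrow> real) \<Rightarrow> 'a \<Rightarrow> real" where
  "blend I c \<rho> v x = (\<Sum>i\<in>I. v i * bump \<rho> (c i) x) / max (\<Sum>i\<in>I. bump \<rho> (c i) x) (\<rho> / 4)"

lemma bump_nonneg: "0 \<le> bump \<rho> z x"
  unfolding bump_def by simp

lemma bump_le: "0 < \<rho> \<Longrightarrow> bump \<rho> z x \<le> \<rho>"
  unfolding bump_def by (rule max.boundedI) (use zero_le_dist[of z x] in linarith)+

lemma bump_lipschitz: "\<bar>bump \<rho> z x - bump \<rho> z y\<bar> \<le> dist x y"
proof -
  have "\<bar>dist z x - dist z y\<bar> \<le> dist x y"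
    using dist_triangle[of z x y] dist_triangle[of z y x] by (simp add: dist_commute)
  then show ?thesis unfolding bump_def by linarith
qed

lemma quotient_difference_le:
  fixes Nx Ny Dx Dy W A B :: real
  assumes D: "0 < k" "k \<le> Dx" "0 < Dy" and N: "\<bar>Nx - Ny\<bar> \<le> A" "\<bar>Ny\<bar> \<le> W * Dy" "\<bar>Dx - Dy\<bar> \<le> B" and W: "0 \<le> W"
  shows "\<bar>Nx / Dx - Ny / Dy\<bar> \<le> (A + W * B) / k"
proof -
  have "Nx / Dx - Ny / Dy = ((Nx - Ny) - (Ny / Dy) * (Dx - Dy)) / Dx"
    using D by (simp add: field_simps)
  also have "\<bar>\<dots>\<bar> = \<bar>(Nx - Ny) - (Ny / Dy) * (Dx - Dy)\<bar> / Dx" using D by (simp add: abs_divide)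
  also have "\<dots> \<le> (A + W * B) / Dx"
  proof (rule divide_right_mono)
    have "\<bar>Ny / Dy\<bar> \<le> W" using D N(2) by (simp add: abs_divide pos_divide_le_eq)
    then have "\<bar>(Ny / Dy) * (Dx - Dy)\<bar> \<le> W * B"
      unfolding abs_mult using N(3) W by (intro mult_mono) auto
    then show "\<bar>(Nx - Ny) - (Ny / Dy) * (Dx - Dy)\<bar> \<le> A + W * B" using N(1) by linarith
  qed (use D in simp)
  also have "\<dots> \<le> (A + W * B) / k"
    using D N W by (intro divide_left_mono) (auto intro!: add_nonneg_nonneg mult_nonneg_nonneg order_trans[OF abs_ge_zero])
  finally show ?thesis .
qed

lemma blend_lipschitz:
  assumes "finite I" and \<rho>: "0 < \<rho>"
  shows "\<exists>L. L-lipschitz_on UNIV (blend I c \<rho> v)"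
proof -
  define V where "V = (\<Sum>i\<in>I. \<bar>v i\<bar>)"
  have V: "0 \<le> V" unfolding V_def by (simp add: sum_nonneg)
  define L where "L = (V + 4 * V * real (card I)) / (\<rho> / 4)"
  have L: "0 \<le> L" unfolding L_def using V \<rho> by (intro divide_nonneg_nonneg add_nonneg_nonneg mult_nonneg_nonneg) auto
  have "\<bar>blend I c \<rho> v x - blend I c \<rho> v y\<bar> \<le> L * dist x y" for x y
  proof -
    have 1: "\<bar>(\<Sum>i\<in>I. v i * bump \<rho> (c i) x) - (\<Sum>i\<in>I. v i * bump \<rho> (c i) y)\<bar> \<le> V * dist x y"
    proof -
      have "\<bar>(\<Sum>i\<in>I. v i * bump \<rho> (c i) x) - (\<Sum>i\<in>I. v i * bump \<rho> (c i) y)\<bar>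
          = \<bar>\<Sum>i\<in>I. v i * (bump \<rho> (c i) x - bump \<rho> (c i) y)\<bar>"
        by (simp add: sum_subtractf right_diff_distrib)
      also have "\<dots> \<le> (\<Sum>i\<in>I. \<bar>v i\<bar> * dist x y)"
        by (rule order_trans[OF sum_abs]) (auto intro!: sum_mono mult_left_mono bump_lipschitz simp: abs_mult)
      finally show ?thesis by (simp add: V_def sum_distrib_right)
    qed
    have 2: "\<bar>\<Sum>i\<in>I. v i * bump \<rho> (c i) y\<bar> \<le> V * \<rho>"
    proof -
      have "\<bar>\<Sum>i\<in>I. v i * bump \<rho> (c i) y\<bar> \<le> (\<Sum>i\<in>I. \<bar>v i\<bar> * \<rho>)"
        by (rule order_trans[OF sum_abs])
          (auto intro!: sum_mono mult_left_mono bump_le[OF \<rho>] simp: abs_mult bump_nonneg)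
      then show ?thesis by (simp add: V_def sum_distrib_right)
    qed
    have 3: "\<bar>(\<Sum>i\<in>I. bump \<rho> (c i) x) - (\<Sum>i\<in>I. bump \<rho> (c i) y)\<bar> \<le> real (card I) * dist x y"
    proof -
      have "\<bar>(\<Sum>i\<in>I. bump \<rho> (c i) x) - (\<Sum>i\<in>I. bump \<rho> (c i) y)\<bar> \<le> (\<Sum>i\<in>I. dist x y)"
        unfolding sum_subtractf[symmetric]
        by (rule order_trans[OF sum_abs]) (rule sum_mono, rule bump_lipschitz)
      then show ?thesis by simp
    qed
    have "\<bar>blend I c \<rho> v x - blend I c \<rho> v y\<bar>
        \<le> (V * dist x y + 4 * V * (real (card I) * dist x y)) / (\<rho> / 4)"
      unfolding blend_def
    proof (rule quotient_difference_le)
      show "\<bar>\<Sum>i\<in>I. v i * bump \<rho> (c i) y\<bar> \<le> 4 * V * max (\<Sum>i\<in>I. bump \<rho> (c i) y) (\<rho> / 4)"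
      proof -
        have "V * \<rho> = 4 * V * (\<rho> / 4)" by simp
        also have "\<dots> \<le> 4 * V * max (\<Sum>i\<in>I. bump \<rho> (c i) y) (\<rho> / 4)"
          using V by (intro mult_left_mono) auto
        finally show ?thesis using 2 by linarith
      qed
      show "\<bar>max (\<Sum>i\<in>I. bump \<rho> (c i) x) (\<rho> / 4) - max (\<Sum>i\<in>I. bump \<rho> (c i) y) (\<rho> / 4)\<bar>
          \<le> real (card I) * dist x y" using 3 by linarith
    qed (use 1 \<rho> V in auto)
    also have "\<dots> = L * dist x y" unfolding L_def by (simp add: field_simps)
    finally show ?thesis .
  qed
  then have "L-lipschitz_on UNIV (blend I c \<rho> v)"
    using L by (intro lipschitz_onI) (auto simp: dist_real_def)
  then show ?thesis ..
qed

text \<open>Subtracting the constant \<open>a\<close> changes the blend by \<open>a\<close>, since the weights add up to \<open>1\<close> on \<open>K\<close>; what is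
averaged then are the small differences \<open>v i - a\<close> over the few balls that contain \<open>x\<close>.\<close>
lemma blend_local_estimates:
  fixes c :: "'i \<Rightarrow> 'a::metric_space"
  assumes fin: "finite I" and \<rho>: "0 < \<rho>" and cover: "K \<subseteq> (\<Union>i\<in>I. ball (c i) (\<rho> / 2))" and x: "x \<in> K"
    and W: "0 \<le> W" "\<And>i. i \<in> I \<Longrightarrow> x \<in> ball (c i) \<rho> \<Longrightarrow> \<bar>v i - a\<bar> \<le> W"
  shows "\<bar>blend I c \<rho> v x - a\<bar> \<le> W"
    and "y \<in> K \<Longrightarrow> dist x y < \<rho> / 4 \<Longrightarrow>
      \<bar>blend I c \<rho> v x - blend I c \<rho> v y\<bar> \<le> 8 * real (card {i\<in>I. x \<in> ball (c i) \<rho>}) * (W / \<rho>) * dist x y"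
proof -
  define J where "J = {i\<in>I. x \<in> ball (c i) \<rho>}"
  have finJ: "finite J" using fin unfolding J_def by simp
  have near: "bump \<rho> (c i) z = 0" if "i \<in> I - J" "dist x z < \<rho> / 4" for i z
  proof -
    have "\<rho> \<le> dist (c i) x" using that(1) unfolding J_def by auto
    then have "3 / 4 * \<rho> \<le> dist (c i) z"
      using dist_triangle[of "c i" x z] dist_commute[of x z] that(2) by linarith
    then show ?thesis unfolding bump_def by (simp add: max_def)
  qed
  have restr: "(\<Sum>i\<in>I. w i * bump \<rho> (c i) z) = (\<Sum>i\<in>J. w i * bump \<rho> (c i) z)"
    if "dist x z < \<rho> / 4" for w :: "'i \<Rightarrow> real" and z
    using fin near[OF _ that] by (intro sum.mono_neutral_right) (auto simp: J_def)
  define S where "S z = (\<Sum>i\<in>J. bump \<rho> (c i) z)" for z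
  define N where "N z = (\<Sum>i\<in>J. (v i - a) * bump \<rho> (c i) z)" for z
  have SI: "(\<Sum>i\<in>I. bump \<rho> (c i) z) = S z" if "dist x z < \<rho> / 4" for z
    using restr[OF that, of "\<lambda>_. 1"] unfolding S_def by simp
  have Sge: "\<rho> / 4 \<le> S z" if "z \<in> K" "dist x z < \<rho> / 4" for z
  proof -
    have "z \<in> (\<Union>i\<in>I. ball (c i) (\<rho> / 2))" using cover that(1) by blast
    then obtain i where i: "i \<in> I" "dist (c i) z < \<rho> / 2" by auto
    have "\<rho> / 4 \<le> bump \<rho> (c i) z" using i(2) unfolding bump_def by linarith
    also have "\<dots> \<le> (\<Sum>i\<in>I. bump \<rho> (c i) z)" using i(1) fin by (intro member_le_sum bump_nonneg) auto
    finally show ?thesis using SI[OF that(2)] by simp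
  qed
  have bl: "blend I c \<rho> v z - a = N z / S z" if "z \<in> K" "dist x z < \<rho> / 4" for z
  proof -
    have "blend I c \<rho> v z = (\<Sum>i\<in>J. v i * bump \<rho> (c i) z) / S z"
      unfolding blend_def restr[OF that(2)] SI[OF that(2)] using Sge[OF that] by (simp add: max_absorb1)
    moreover have "N z = (\<Sum>i\<in>J. v i * bump \<rho> (c i) z) - a * S z"
      unfolding N_def S_def by (simp add: left_diff_distrib sum_subtractf sum_distrib_left)
    moreover have "S z \<noteq> 0" using Sge[OF that] \<rho> by linarith
    ultimately show ?thesis by (simp add: diff_divide_distrib)
  qed
  have WJ: "\<bar>v i - a\<bar> \<le> W" if "i \<in> J" for i using W(2) that unfolding J_def by simp
  have NW: "\<bar>N z\<bar> \<le> W * S z" for z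
    unfolding N_def S_def sum_distrib_left
    by (rule order_trans[OF sum_abs]) (auto intro!: sum_mono mult_right_mono WJ simp: abs_mult bump_nonneg)
  have d0: "dist x x < \<rho> / 4" using \<rho> by simp
  have Sx: "0 < S x" using Sge[OF x d0] \<rho> by linarith
  show "\<bar>blend I c \<rho> v x - a\<bar> \<le> W"
    unfolding bl[OF x d0] using NW[of x] Sx by (simp add: abs_divide pos_divide_le_eq)
  assume y: "y \<in> K" "dist x y < \<rho> / 4"
  have "\<bar>N x / S x - N y / S y\<bar> \<le> (real (card J) * (W * dist x y) + W * (real (card J) * dist x y)) / (\<rho> / 4)"
  proof (rule quotient_difference_le)
    show "\<rho> / 4 \<le> S x" by (rule Sge[OF x d0])
    show "0 < S y" using Sge[OF y] \<rho> by linarith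
    have "\<bar>N x - N y\<bar> \<le> (\<Sum>i\<in>J. W * dist x y)"
      unfolding N_def sum_subtractf[symmetric] right_diff_distrib[symmetric]
      by (rule order_trans[OF sum_abs], unfold abs_mult, rule sum_mono)
        (intro mult_mono WJ bump_lipschitz W(1) abs_ge_zero)
    then show "\<bar>N x - N y\<bar> \<le> real (card J) * (W * dist x y)" by simp
    have "\<bar>S x - S y\<bar> \<le> (\<Sum>i\<in>J. dist x y)"
      unfolding S_def sum_subtractf[symmetric]
      by (rule order_trans[OF sum_abs]) (rule sum_mono, rule bump_lipschitz)
    then show "\<bar>S x - S y\<bar> \<le> real (card J) * dist x y" by simp
  qed (use \<rho> NW W in auto)
  also have "\<dots> = 8 * real (card J) * (W / \<rho>) * dist x y" using \<rho> by (simp add: field_simps)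
  finally show "\<bar>blend I c \<rho> v x - blend I c \<rho> v y\<bar> \<le> 8 * real (card {i\<in>I. x \<in> ball (c i) \<rho>}) * (W / \<rho>) * dist x y"
    using bl[OF x d0] bl[OF y] unfolding J_def by simp
qed

lemma Lip_le:
  assumes "0 < \<eta>" "0 \<le> B" and b: "\<And>y. dist x y < \<eta> \<Longrightarrow> \<bar>u x - u y\<bar> \<le> B * dist x y"
  shows "Lip u x \<le> ennreal B"
  unfolding Lip_def
proof (rule Limsup_bounded)
  show "\<forall>\<^sub>F r in at_right 0. (SUP y\<in>ball x r. ennreal (\<bar>u x - u y\<bar> / r)) \<le> ennreal B"
    using eventually_at_right_real[OF assms(1)]
  proof eventually_elim
    case (elim r)
    show ?case
    proof (intro SUP_least ennreal_leI)
      fix y assume y: "y \<in> ball x r"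
      have "\<bar>u x - u y\<bar> \<le> B * dist x y" using y elim by (intro b) auto
      also have "\<dots> \<le> B * r" using y assms(2) by (intro mult_left_mono) auto
      finally show "\<bar>u x - u y\<bar> / r \<le> B" using elim by (simp add: pos_divide_le_eq)
    qed
  qed
qed

context regular_measure
begin

lemma lipschitz_set_integrable_ball:
  fixes u :: "'a \<Rightarrow> real"
  assumes "L-lipschitz_on UNIV u"
  shows "set_integrable \<mu> (ball x t) u"
proof -
  have "continuous_on UNIV u" by (rule lipschitz_on_continuous_on[OF assms])
  then have um: "u \<in> borel_measurable \<mu>"
    by (simp add: borel_measurable_continuous_onI cong: measurable_cong_sets)
  show ?thesis unfolding set_integrable_def
  proof (rule Bochner_Integration.integrable_bound)
    show "integrable \<mu> (\<lambda>y. (\<bar>u x\<bar> + L * t) * indicator (ball x t) y)"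
      using finite_ball[of x t] by (intro integrable_mult_right) (simp add: less_top)
    show "AE y in \<mu>. norm (indicator (ball x t) y *\<^sub>R u y) \<le> norm ((\<bar>u x\<bar> + L * t) * indicator (ball x t) y)"
    proof (rule AE_I2)
      fix y
      show "norm (indicator (ball x t) y *\<^sub>R u y) \<le> norm ((\<bar>u x\<bar> + L * t) * indicator (ball x t) y :: real)"
      proof (cases "y \<in> ball x t")
        case True
        have "\<bar>u x - u y\<bar> \<le> L * dist x y"
          using lipschitz_onD[OF assms, of x y] by (simp add: dist_real_def)
        also have "\<dots> \<le> L * t" using True lipschitz_on_nonneg[OF assms] by (intro mult_left_mono) auto
        finally show ?thesis using True by simp
      qed simp
    qed
    show "(\<lambda>y. indicator (ball x t) y *\<^sub>R u y) \<in> borel_measurable \<mu>"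
      using um by measurable
  qed
qed

lemma avg_diff_le:
  fixes u :: "'a \<Rightarrow> real"
  assumes u: "set_integrable \<mu> (ball y t) u" and t: "0 < t"
  shows "\<bar>avg \<mu> (ball y t) u - a\<bar> \<le> (LINT z:ball y t|\<mu>. \<bar>u z - a\<bar>) / measure \<mu> (ball y t)"
proof -
  let ?m = "measure \<mu> (ball y t)"
  have m: "0 < ?m" by (rule measure_ball_pos[OF t])
  have c: "set_integrable \<mu> (ball y t) (\<lambda>_. a)"
    unfolding set_integrable_def using finite_ball[of y t] by (simp add: less_top)
  have "(LINT z:ball y t|\<mu>. u z - a) = (LINT z:ball y t|\<mu>. u z) - a * ?m"
    using set_integral_diff(2)[OF u c] finite_ball[of y t] by (simp add: set_lebesgue_integral_def mult.commute)
  then have "avg \<mu> (ball y t) u - a = (LINT z:ball y t|\<mu>. u z - a) / ?m"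
    using m unfolding avg_def by (simp add: field_simps)
  moreover have "\<bar>LINT z:ball y t|\<mu>. u z - a\<bar> \<le> (LINT z:ball y t|\<mu>. \<bar>u z - a\<bar>)"
    using set_integral_norm_bound[OF set_integral_diff(1)[OF u c]] by simp
  ultimately show ?thesis using m by (simp add: abs_divide divide_right_mono)
qed

lemma avg_sub_ball_le:
  fixes u :: "'a \<Rightarrow> real"
  assumes u: "L-lipschitz_on UNIV u" and sub: "ball y t' \<subseteq> ball x t" and t: "0 < t'" "t' \<le> t" "t \<le> R" "t \<le> k * t'"
  shows "\<bar>avg \<mu> (ball y t') u - avg \<mu> (ball x t) u\<bar>
    \<le> C\<^sup>2 * k powr Q * avg \<mu> (ball x t) (\<lambda>z. \<bar>u z - avg \<mu> (ball x t) u\<bar>)"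
proof -
  define a where "a = avg \<mu> (ball x t) u"
  have c: "set_integrable \<mu> (ball w r) (\<lambda>_. a)" for w r
    unfolding set_integrable_def using finite_ball[of w r] by (simp add: less_top)
  have i: "set_integrable \<mu> (ball w r) (\<lambda>z. \<bar>u z - a\<bar>)" for w r
    using set_integrable_norm[OF set_integral_diff(1)[OF lipschitz_set_integrable_ball[OF u] c], of w r] by simp
  have k: "0 < k" using t by (metis less_le_trans mult_pos_neg not_le order_less_le_trans zero_less_mult_pos2)
  have m: "measure \<mu> (ball x t) \<le> C\<^sup>2 * k powr Q * measure \<mu> (ball y t')"
  proof -
    have "measure \<mu> (ball x t) \<le> C * t powr Q" using t by (intro upper) auto
    also have "\<dots> \<le> C * (k * t') powr Q" using t C_ge Q_ge by (intro mult_left_mono powr_mono2) auto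
    also have "\<dots> = C\<^sup>2 * k powr Q * (t' powr Q / C)"
      using C_ge k t by (simp add: powr_mult power2_eq_square)
    also have "\<dots> \<le> C\<^sup>2 * k powr Q * measure \<mu> (ball y t')"
      using lower[of t' y] t by (intro mult_left_mono) auto
    finally show ?thesis .
  qed
  have my: "0 < measure \<mu> (ball y t')" and mx: "0 < measure \<mu> (ball x t)"
    using t by (auto intro: measure_ball_pos)
  have "\<bar>avg \<mu> (ball y t') u - a\<bar> \<le> (LINT z:ball y t'|\<mu>. \<bar>u z - a\<bar>) / measure \<mu> (ball y t')"
    using t by (intro avg_diff_le lipschitz_set_integrable_ball[OF u]) auto
  also have "\<dots> \<le> (LINT z:ball x t|\<mu>. \<bar>u z - a\<bar>) / measure \<mu> (ball y t')"
  proof (rule divide_right_mono)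
    show "(LINT z:ball y t'|\<mu>. \<bar>u z - a\<bar>) \<le> (LINT z:ball x t|\<mu>. \<bar>u z - a\<bar>)"
      unfolding set_lebesgue_integral_def
      using i[of y t'] i[of x t] sub
      by (intro integral_mono) (auto simp: set_integrable_def indicator_def)
  qed simp
  also have "\<dots> \<le> (LINT z:ball x t|\<mu>. \<bar>u z - a\<bar>) * (C\<^sup>2 * k powr Q / measure \<mu> (ball x t))"
  proof -
    have "1 / measure \<mu> (ball y t') \<le> C\<^sup>2 * k powr Q / measure \<mu> (ball x t)"
      using m my mx by (simp add: field_simps)
    moreover have "0 \<le> (LINT z:ball x t|\<mu>. \<bar>u z - a\<bar>)"
      unfolding set_lebesgue_integral_def by (intro integral_nonneg_AE) simp
    ultimately have "(LINT z:ball x t|\<mu>. \<bar>u z - a\<bar>) * (1 / measure \<mu> (ball y t'))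
      \<le> (LINT z:ball x t|\<mu>. \<bar>u z - a\<bar>) * (C\<^sup>2 * k powr Q / measure \<mu> (ball x t))"
      by (intro mult_left_mono)
    then show ?thesis by simp
  qed
  also have "\<dots> = C\<^sup>2 * k powr Q * avg \<mu> (ball x t) (\<lambda>z. \<bar>u z - a\<bar>)"
    unfolding avg_def by simp
  finally show ?thesis unfolding a_def .
qed

text \<open>The Poincare inequality with its right-hand mean replaced by a bound \<open>m\<close> of the kind that a maximal
function of \<open>g\<^sup>s\<close> provides.\<close>
lemma poincare_oscillation_le:
  fixes u :: "'a \<Rightarrow> real" and g :: "'a \<Rightarrow> real"
  assumes poin: "poincare_inequality_with \<mu> s C\<^sub>P lam" and s: "1 \<le> s"
    and u: "L-lipschitz_on UNIV u" and t: "0 < t" "lam * t \<le> R"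
    and B: "0 < B" and g: "\<And>y. 0 \<le> g y" "integrable \<mu> (\<lambda>y. g y powr s)"
    and lip: "\<And>y. y \<in> ball x (lam * t) \<Longrightarrow> Lip u y \<le> ennreal (B * g y)"
    and m: "0 \<le> m" "(LINT y|\<mu>. indicator (ball x (lam * t)) y * g y powr s) \<le> C * 4 powr Q * (lam * t) powr Q * m"
  shows "avg \<mu> (ball x t) (\<lambda>y. \<bar>u y - avg \<mu> (ball x t) u\<bar>)
    \<le> C\<^sub>P * B * (C\<^sup>2 * 4 powr Q) powr (1 / s) * t * m powr (1 / s)"
proof -
  have CP: "0 < C\<^sub>P" "1 \<le> lam" using poin unfolding poincare_inequality_with_def by auto
  have lt: "0 < lam * t" using CP t by simp
  have int: "integrable \<mu> (\<lambda>y. indicator (ball x (lam * t)) y * g y powr s)"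
    using integrable_mult_indicator[OF _ g(2), of "ball x (lam * t)"] by simp
  have "(\<integral>\<^sup>+y\<in>ball x (lam * t). epowr (Lip u y) s \<partial>\<mu>)
      \<le> (\<integral>\<^sup>+y. ennreal (B powr s * (indicator (ball x (lam * t)) y * g y powr s)) \<partial>\<mu>)"
  proof (rule nn_integral_mono)
    fix y
    show "epowr (Lip u y) s * indicator (ball x (lam * t)) y
      \<le> ennreal (B powr s * (indicator (ball x (lam * t)) y * g y powr s))"
    proof (cases "y \<in> ball x (lam * t)")
      case True
      have "epowr (Lip u y) s \<le> epowr (ennreal (B * g y)) s" using s by (intro epowr_mono lip True) auto
      also have "\<dots> = ennreal (B powr s * g y powr s)" using B g(1) by (simp add: epowr_ennreal powr_mult)
      finally show ?thesis using True by simp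
    qed simp
  qed
  also have "\<dots> = ennreal (LINT y|\<mu>. B powr s * (indicator (ball x (lam * t)) y * g y powr s))"
    using int by (intro nn_integral_eq_integral) (auto simp: g)
  also have "\<dots> = ennreal (B powr s * (LINT y|\<mu>. indicator (ball x (lam * t)) y * g y powr s))"
    by simp
  also have "\<dots> \<le> ennreal (B powr s * (C * 4 powr Q * (lam * t) powr Q * m))"
    by (intro ennreal_leI mult_left_mono m) auto
  finally have I: "(\<integral>\<^sup>+y\<in>ball x (lam * t). epowr (Lip u y) s \<partial>\<mu>)
    \<le> ennreal (B powr s * (C * 4 powr Q * (lam * t) powr Q * m))" .
  have "(\<integral>\<^sup>+y\<in>ball x (lam * t). epowr (Lip u y) s \<partial>\<mu>) / emeasure \<mu> (ball x (lam * t))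
      \<le> ennreal (B powr s * (C * 4 powr Q * (lam * t) powr Q * m)) / ennreal (measure \<mu> (ball x (lam * t)))"
    unfolding emeasure_ball by (rule divide_right_mono_ennreal[OF I])
  also have "\<dots> = ennreal (B powr s * (C * 4 powr Q * (lam * t) powr Q * m) / measure \<mu> (ball x (lam * t)))"
    using measure_ball_pos[OF lt] C_ge m(1) by (intro divide_ennreal) auto
  also have "\<dots> \<le> ennreal (B powr s * (C * 4 powr Q * (lam * t) powr Q * m) / ((lam * t) powr Q / C))"
  proof (intro ennreal_leI divide_left_mono mult_pos_pos)
    show "(lam * t) powr Q / C \<le> measure \<mu> (ball x (lam * t))" by (rule lower[OF lt t(2)])
    show "0 < (lam * t) powr Q / C"
      by (intro divide_pos_pos powr_gt_zero[THEN iffD2]) (use lt C_ge in linarith)+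
  qed (use measure_ball_pos[OF lt, of x] C_ge m(1) in auto)
  also have "B powr s * (C * 4 powr Q * (lam * t) powr Q * m) / ((lam * t) powr Q / C) = B powr s * (C\<^sup>2 * 4 powr Q) * m"
  proof -
    have *: "b * (C * k * l * m) / (l / C) = b * (C\<^sup>2 * k) * m" if "0 < l" for b k l :: real
      using that C_ge by (simp add: power2_eq_square)
    show ?thesis by (rule *) (use lt in \<open>simp only: powr_gt_zero less_imp_neq[symmetric] not_False_eq_True\<close>)
  qed
  finally have J: "epowr ((\<integral>\<^sup>+y\<in>ball x (lam * t). epowr (Lip u y) s \<partial>\<mu>) / emeasure \<mu> (ball x (lam * t))) (1 / s)
     \<le> epowr (ennreal (B powr s * (C\<^sup>2 * 4 powr Q) * m)) (1 / s)"
    using s by (intro epowr_mono) auto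
  also have "\<dots> = ennreal (B * (C\<^sup>2 * 4 powr Q) powr (1 / s) * m powr (1 / s))"
    using B m(1) s by (simp add: epowr_ennreal powr_mult powr_powr)
  finally have J: "epowr ((\<integral>\<^sup>+y\<in>ball x (lam * t). epowr (Lip u y) s \<partial>\<mu>) / emeasure \<mu> (ball x (lam * t))) (1 / s)
     \<le> ennreal (B * (C\<^sup>2 * 4 powr Q) powr (1 / s) * m powr (1 / s))" .
  have "ennreal (avg \<mu> (ball x t) (\<lambda>y. \<bar>u y - avg \<mu> (ball x t) u\<bar>))
      \<le> ennreal (C\<^sub>P * t) * epowr ((\<integral>\<^sup>+y\<in>ball x (lam * t). epowr (Lip u y) s \<partial>\<mu>) / emeasure \<mu> (ball x (lam * t))) (1 / s)"
    using poin u t unfolding poincare_inequality_with_def by blast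
  also have "\<dots> \<le> ennreal (C\<^sub>P * t) * ennreal (B * (C\<^sup>2 * 4 powr Q) powr (1 / s) * m powr (1 / s))"
    by (intro mult_left_mono J) auto
  also have "\<dots> = ennreal (C\<^sub>P * B * (C\<^sup>2 * 4 powr Q) powr (1 / s) * t * m powr (1 / s))"
    using CP B t by (subst ennreal_mult[symmetric]) (auto simp: mult_ac)
  finally show ?thesis
    using CP B t by (subst (asm) ennreal_le_iff) auto
qed

end

section \<open>Gradients above a fixed scale from the Poincare inequality\<close>

context regular_measure
begin

text \<open>Telescoping of means over \<open>t\<^sub>0, t\<^sub>0/2, t\<^sub>0/4, \<dots>\<close> down to a radius between \<open>\<rho>\<close> and \<open>2 \<rho>\<close>, where the
remaining oscillation is the error \<open>e\<close>.\<close>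
lemma mean_oscillation_chain:
  fixes u :: "'a \<Rightarrow> real"
  assumes u: "L-lipschitz_on UNIV u" and \<rho>: "0 < \<rho>" "\<rho> \<le> t\<^sub>0" and tR: "t\<^sub>0 \<le> R" and A: "0 \<le> A"
    and osc: "\<And>t. \<rho> \<le> t \<Longrightarrow> t \<le> t\<^sub>0 \<Longrightarrow> avg \<mu> (ball x t) (\<lambda>y. \<bar>u y - avg \<mu> (ball x t) u\<bar>) \<le> A * t"
    and e: "\<And>z. z \<in> ball x t\<^sub>0 \<Longrightarrow> dist x z < 2 * \<rho> \<Longrightarrow> \<bar>u z - u x\<bar> \<le> e"
  shows "\<bar>u x - avg \<mu> (ball x t\<^sub>0) u\<bar> \<le> 2 * (C\<^sup>2 * 2 powr Q * A) * t\<^sub>0 + e"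
proof -
  define t where "t k = t\<^sub>0 / 2 ^ k" for k :: nat
  have t0: "0 < t\<^sub>0" using \<rho> by simp
  have t: "0 < t k" "t k \<le> t\<^sub>0" "t (Suc k) = t k / 2" for k
    using t0 by (auto simp: t_def divide_le_eq mult_le_cancel_left1)
  have tmono: "t n \<le> t k" if "k \<le> n" for k n
    unfolding t_def using that t0 by (intro divide_left_mono power_increasing) auto
  have ex: "\<exists>k. t k < 2 * \<rho>"
  proof -
    obtain n where "t\<^sub>0 / \<rho> < 2 ^ n" using real_arch_pow[of 2 "t\<^sub>0 / \<rho>"] by auto
    then have "t\<^sub>0 < 2 ^ n * \<rho>" using \<rho> by (simp add: pos_divide_less_eq)
    moreover have "2 * \<rho> * 2 ^ n = 2 * (2 ^ n * \<rho>)" by simp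
    ultimately have "t\<^sub>0 < 2 * \<rho> * 2 ^ n" using t0 by linarith
    then show ?thesis unfolding t_def by (intro exI[of _ n]) (simp add: pos_divide_less_eq)
  qed
  define n where "n = (LEAST k. t k < 2 * \<rho>)"
  have n: "t n < 2 * \<rho>" unfolding n_def by (rule LeastI_ex[OF ex])
  have below: "\<rho> \<le> t k" if "k \<le> n" for k
  proof -
    have "\<rho> \<le> t n"
    proof (cases n)
      case 0
      then show ?thesis using \<rho>(2) by (simp add: t_def)
    next
      case (Suc n')
      then have "\<not> t n' < 2 * \<rho>" using not_less_Least[of n' "\<lambda>k. t k < 2 * \<rho>"] unfolding n_def by simp
      then show ?thesis using t(3)[of n'] Suc by simp
    qed
    then show ?thesis using tmono[OF that] by linarith
  qed
  define A' where "A' = C\<^sup>2 * 2 powr Q * A"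
  have A': "0 \<le> A'" unfolding A'_def using A by simp
  have step: "\<bar>avg \<mu> (ball x (t (Suc k))) u - avg \<mu> (ball x (t k)) u\<bar> \<le> A' * t k" if "k < n" for k
  proof -
    have "\<bar>avg \<mu> (ball x (t (Suc k))) u - avg \<mu> (ball x (t k)) u\<bar>
      \<le> C\<^sup>2 * 2 powr Q * avg \<mu> (ball x (t k)) (\<lambda>z. \<bar>u z - avg \<mu> (ball x (t k)) u\<bar>)"
      using t(1)[of k] t(2)[of k] t(3)[of k] tR by (intro avg_sub_ball_le[OF u]) auto
    also have "\<dots> \<le> C\<^sup>2 * 2 powr Q * (A * t k)"
      using below[of k] that t(2)[of k] by (intro mult_left_mono osc) auto
    finally show ?thesis unfolding A'_def by (simp add: mult.assoc)
  qed
  have sum: "\<bar>avg \<mu> (ball x (t k)) u - avg \<mu> (ball x (t 0)) u\<bar> \<le> A' * (2 * t\<^sub>0 - 2 * t k)" if "k \<le> n" for k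
    using that
  proof (induction k)
    case 0
    then show ?case by (simp add: t_def)
  next
    case (Suc k)
    then have "\<bar>avg \<mu> (ball x (t k)) u - avg \<mu> (ball x (t 0)) u\<bar> \<le> A' * (2 * t\<^sub>0 - 2 * t k)" by simp
    moreover have "A' * (2 * t\<^sub>0 - 2 * t (Suc k)) = A' * (2 * t\<^sub>0 - 2 * t k) + A' * t k"
      unfolding t(3) by (simp add: algebra_simps)
    ultimately show ?case using step[of k] Suc.prems by linarith
  qed
  have last: "\<bar>avg \<mu> (ball x (t n)) u - u x\<bar> \<le> e"
  proof -
    have e0: "0 \<le> e" using e[of x] \<rho> t0 by simp
    have "\<bar>avg \<mu> (ball x (t n)) u - u x\<bar> \<le> (LINT z:ball x (t n)|\<mu>. \<bar>u z - u x\<bar>) / measure \<mu> (ball x (t n))"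
      by (intro avg_diff_le lipschitz_set_integrable_ball[OF u] t)
    also have "\<dots> \<le> e"
    proof -
      have c: "set_integrable \<mu> (ball x (t n)) (\<lambda>_. b)" for b :: real
        unfolding set_integrable_def using finite_ball[of x "t n"] by (simp add: less_top)
      have i: "set_integrable \<mu> (ball x (t n)) (\<lambda>z. \<bar>u z - u x\<bar>)"
        using set_integrable_norm[OF set_integral_diff(1)[OF lipschitz_set_integrable_ball[OF u] c]] by simp
      have "(LINT z:ball x (t n)|\<mu>. \<bar>u z - u x\<bar>) \<le> (LINT z:ball x (t n)|\<mu>. e)"
      proof (rule set_integral_mono[OF i c])
        fix z assume z: "z \<in> ball x (t n)"
        then show "\<bar>u z - u x\<bar> \<le> e" using n t(2)[of n] by (intro e) auto
      qed
      also have "\<dots> = e * measure \<mu> (ball x (t n))"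
        using finite_ball[of x "t n"] by (simp add: set_lebesgue_integral_def mult.commute)
      finally show ?thesis using measure_ball_pos[OF t(1)[of n], of x] by (simp add: pos_divide_le_eq)
    qed
    finally show ?thesis .
  qed
  have "A' * (2 * t\<^sub>0 - 2 * t n) \<le> A' * (2 * t\<^sub>0)"
    using A' t(1)[of n] by (intro mult_left_mono) auto
  then have "\<bar>u x - avg \<mu> (ball x (t 0)) u\<bar> \<le> A' * (2 * t\<^sub>0) + e"
    using sum[of n] last by linarith
  then show ?thesis unfolding A'_def t_def by (simp add: mult_ac)
qed

end

text \<open>The geometric situation of the lower bound. The number \<open>\<eta>\<close> measures the room between
\<open>\<lambda> diam U\<close> and the distance from \<open>U\<close> to the complement of \<open>K\<close>; all dilated balls on which the
Poincare inequality is used lie in \<open>K\<close>, where \<open>f\<close> is controlled.\<close>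
locale poincare_domain = regular_measure \<mu> Q C R for \<mu> :: "'a::metric_space measure" and Q C R +
  fixes p s C\<^sub>P lam \<epsilon> \<eta> :: real and K U :: "'a set"
  assumes p_gt: "Q < p" and s_ge: "1 \<le> s" and s_less: "s < p"
    and poincare: "poincare_inequality_with \<mu> s C\<^sub>P lam"
    and eps: "0 < \<epsilon>" "\<epsilon> \<le> 1" and eta: "0 < \<eta>" "\<eta> \<le> 1"
    and compact_K: "compact K" and U_K: "U \<subseteq> K"
    and ball_K: "x \<in> U \<Longrightarrow> y \<in> U \<Longrightarrow> ball x (lam * ((1 + \<eta>) * dist x y)) \<subseteq> K"
    and dist_R: "x \<in> U \<Longrightarrow> y \<in> U \<Longrightarrow> 12 * (lam * ((1 + \<eta>) * dist x y)) \<le> R"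
begin

lemma CP_pos: "0 < C\<^sub>P" and lam_ge: "1 \<le> lam"
  using poincare unfolding poincare_inequality_with_def by auto

lemma p_pos: "0 < p" using p_gt Q_ge by simp

definition overlap :: real where "overlap = C\<^sup>2 * (2 / \<epsilon>) powr Q"

lemma overlap_pos: "0 < overlap"
  unfolding overlap_def using C_ge eps by simp

text \<open>This constant and those below depend only on the parameters of the locale, neither on the function nor
on the scale.\<close>
definition osc_const :: real where
  "osc_const = C\<^sub>P * (8 * overlap) * (C\<^sup>2 * 4 powr Q) powr (1 / s)"

lemma osc_const_pos: "0 < osc_const"
  unfolding osc_const_def using CP_pos overlap_pos C_ge by simp

definition chain_const :: real where
  "chain_const = osc_const * (2 * (C\<^sup>2 * 2 powr Q) + C\<^sup>2 * ((1 + \<eta>) / \<eta>) powr Q) * (1 + \<eta>)"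

lemma chain_const_pos: "0 < chain_const"
  unfolding chain_const_def using osc_const_pos C_ge eta by (intro mult_pos_pos add_pos_pos) auto

text \<open>Pass from \<open>u x\<close> to the mean over the ball of radius \<open>(1 + \<eta>) d\<close> around \<open>x\<close>, from there to the mean over
the ball of radius \<open>\<eta> d\<close> around \<open>y\<close>, which it contains, and on to \<open>u y\<close>.\<close>
lemma two_point_estimate:
  fixes u :: "'a \<Rightarrow> real" and h :: "'a \<Rightarrow> real"
  assumes u: "L-lipschitz_on UNIV u" and \<rho>: "0 < \<rho>" and xy: "x \<in> U" "y \<in> U" and far: "\<rho> \<le> \<eta> * dist x y"
    and h: "\<And>z. 0 \<le> h z"
    and osc: "\<And>z t. z \<in> {x, y} \<Longrightarrow> \<rho> \<le> t \<Longrightarrow> t \<le> (1 + \<eta>) * dist x y \<Longrightarrow>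
        avg \<mu> (ball z t) (\<lambda>w. \<bar>u w - avg \<mu> (ball z t) u\<bar>) \<le> osc_const * h z * t"
    and e: "\<And>z w. z \<in> K \<Longrightarrow> w \<in> K \<Longrightarrow> dist z w < 2 * \<rho> \<Longrightarrow> \<bar>u w - u z\<bar> \<le> e"
  shows "\<bar>u x - u y\<bar> \<le> chain_const * dist x y * (h x + h y) + 2 * e"
proof -
  define d where "d = dist x y"
  have d: "0 < d" using far \<rho> eta unfolding d_def by (metis less_le_trans zero_less_mult_pos)
  define tx where "tx = (1 + \<eta>) * d"
  define ty where "ty = \<eta> * d"
  have t: "0 < ty" "ty \<le> tx" "\<rho> \<le> ty" "0 < tx"
    using d eta far unfolding tx_def ty_def d_def[symmetric]
    by (auto intro: mult_pos_pos mult_right_mono)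
  have lamx: "tx \<le> lam * tx" using lam_ge t by (simp add: mult_le_cancel_right1)
  have tR: "tx \<le> R" using dist_R[OF xy] lamx t unfolding tx_def d_def by linarith
  have subx: "ball x tx \<subseteq> K" using ball_K[OF xy] subset_ball[OF lamx] unfolding tx_def d_def by blast
  have suby: "ball y ty \<subseteq> K"
    using ball_K[OF xy(2,1)] subset_ball[OF lamx, of y] subset_ball[OF t(2), of y] unfolding tx_def d_def
    by (auto simp: dist_commute)
  have xK: "x \<in> K" "y \<in> K" using xy U_K by auto
  define E where "E = C\<^sup>2 * 2 powr Q"
  define E' where "E' = C\<^sup>2 * ((1 + \<eta>) / \<eta>) powr Q"
  have E: "0 \<le> E" "0 \<le> E'" unfolding E_def E'_def by auto
  have oc: "0 \<le> osc_const" using osc_const_pos by simp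
  have 1: "\<bar>u x - avg \<mu> (ball x tx) u\<bar> \<le> 2 * (E * (osc_const * h x)) * tx + e"
    unfolding E_def using t tR osc e xK subx oc h[of x]
    by (intro mean_oscillation_chain[OF u \<rho>]) (auto simp: tx_def d_def)
  have 2: "\<bar>u y - avg \<mu> (ball y ty) u\<bar> \<le> 2 * (E * (osc_const * h y)) * ty + e"
    unfolding E_def
  proof (rule mean_oscillation_chain[OF u \<rho> t(3)])
    show "ty \<le> R" using t tR by simp
    show "0 \<le> osc_const * h y" using oc h by simp
    show "avg \<mu> (ball y t) (\<lambda>w. \<bar>u w - avg \<mu> (ball y t) u\<bar>) \<le> osc_const * h y * t" if "\<rho> \<le> t" "t \<le> ty" for t
      using that t(2) unfolding tx_def d_def by (intro osc) auto
    show "\<bar>u z - u y\<bar> \<le> e" if "z \<in> ball y ty" "dist y z < 2 * \<rho>" for z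
      using that suby xK by (intro e) auto
  qed
  have 3: "\<bar>avg \<mu> (ball y ty) u - avg \<mu> (ball x tx) u\<bar> \<le> E' * (osc_const * h x * tx)"
  proof -
    have sub: "ball y ty \<subseteq> ball x tx"
    proof
      fix z assume "z \<in> ball y ty"
      then show "z \<in> ball x tx"
        using dist_triangle[of x z y] unfolding tx_def ty_def d_def by (simp add: algebra_simps)
    qed
    have "\<bar>avg \<mu> (ball y ty) u - avg \<mu> (ball x tx) u\<bar>
      \<le> E' * avg \<mu> (ball x tx) (\<lambda>z. \<bar>u z - avg \<mu> (ball x tx) u\<bar>)"
      unfolding E'_def using t tR eta by (intro avg_sub_ball_le[OF u sub]) (auto simp: tx_def ty_def)
    also have "\<dots> \<le> E' * (osc_const * h x * tx)"
      using E t by (intro mult_left_mono osc) (auto simp: tx_def d_def)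
    finally show ?thesis .
  qed
  have 4: "2 * (E * (osc_const * h y)) * ty \<le> 2 * (E * (osc_const * h y)) * tx"
    using E oc h[of y] t by (intro mult_left_mono) auto
  have 5: "0 \<le> E' * (osc_const * h y * tx)"
    using E oc h[of y] t by (intro mult_nonneg_nonneg) auto
  have "\<bar>u x - u y\<bar> \<le> 2 * (E * (osc_const * h x)) * tx + E' * (osc_const * h x * tx)
     + 2 * (E * (osc_const * h y)) * tx + E' * (osc_const * h y * tx) + 2 * e"
    using 1 2 3 4 5 by linarith
  also have "\<dots> = chain_const * d * (h x + h y) + 2 * e"
    unfolding chain_const_def E_def[symmetric] E'_def[symmetric] tx_def by (simp add: algebra_simps)
  finally show ?thesis unfolding d_def .
qed

definition max_const :: real where
  "max_const = (2 * (C\<^sup>2 * 3 powr Q * (p / s / (p / s - 1)))) powr (p / s)"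

definition norm_const :: real where
  "norm_const = chain_const powr p * (max_const * (overlap powr p * C))"

lemma norm_const_pos: "0 < norm_const"
proof -
  have "1 < p / s" using s_less s_ge by simp
  then have "0 < max_const" unfolding max_const_def using C_ge s_ge p_pos by simp
  then show ?thesis unfolding norm_const_def using chain_const_pos overlap_pos C_ge by simp
qed

text \<open>The main estimate at a fixed scale. The number \<open>b i\<close> bounds the oscillation of \<open>f\<close> on the \<open>i\<close>-th ball
around its centre, so \<open>b i / \<rho>\<close> is the discrete gradient there. Distances below \<open>\<rho> / \<eta>\<close>, for which
there is no room between the scale and the two points, are covered by the modulus of continuity.\<close>
lemma gradient_above_scale:
  fixes f :: "'a \<Rightarrow> 'b::real_normed_vector" and c :: "'i \<Rightarrow> 'a"
  assumes fin: "finite I" and \<rho>: "0 < \<rho>" "2 * \<rho> \<le> R"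
    and cover: "K \<subseteq> (\<Union>i\<in>I. ball (c i) (\<rho> / 2))"
    and disj: "\<And>i j. i \<in> I \<Longrightarrow> j \<in> I \<Longrightarrow> i \<noteq> j \<Longrightarrow> ball (c i) (\<epsilon> * \<rho>) \<inter> ball (c j) (\<epsilon> * \<rho>) = {}"
    and b: "\<And>i. i \<in> I \<Longrightarrow> 0 \<le> b i" "\<And>i. i \<in> I \<Longrightarrow> b i \<le> \<delta>"
       "\<And>i x. i \<in> I \<Longrightarrow> x \<in> ball (c i) \<rho> \<Longrightarrow> norm (f (c i) - f x) \<le> b i"
    and \<delta>: "0 \<le> \<delta>" "\<And>x y. x \<in> K \<Longrightarrow> y \<in> K \<Longrightarrow> dist x y < 2 * \<rho> / \<eta> \<Longrightarrow> norm (f x - f y) \<le> \<delta>"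
  obtains H where "H \<in> borel_measurable \<mu>" "\<And>x. 0 \<le> H x" "integrable \<mu> (\<lambda>x. H x powr p)"
    "(LINT x|\<mu>. H x powr p) \<le> norm_const * (\<Sum>i\<in>I. (b i / \<rho>) powr p * \<rho> powr Q)"
    "\<And>x y. x \<in> U \<Longrightarrow> y \<in> U \<Longrightarrow> norm (f x - f y) \<le> dist x y * (H x + H y) + 8 * \<delta>"
proof -
  define J where "J x = {i\<in>I. x \<in> ball (c i) \<rho>}" for x
  have finJ: "finite (J x)" for x using fin unfolding J_def by simp
  have cardJ: "real (card (J x)) \<le> overlap" for x
    using finite_overlap(2)[OF eps \<rho>(1), of 1 I c x] \<rho> disj unfolding overlap_def J_def by simp
  define g where "g x = (\<Sum>i\<in>I. b i / \<rho> * indicator (ball (c i) \<rho>) x)" for x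
  have gJ: "g x = (\<Sum>i\<in>J x. b i / \<rho>)" for x
    unfolding g_def J_def sum.inter_filter[OF fin] by (intro sum.cong) auto
  have g0: "0 \<le> g x" for x unfolding gJ using b(1) \<rho> by (intro sum_nonneg) (auto simp: J_def)
  have bg: "b i \<le> \<rho> * g x" if "i \<in> J x" for i x
  proof -
    have "b i / \<rho> \<le> g x" unfolding gJ
      using b(1) \<rho> that by (intro member_le_sum[OF that _ finJ]) (auto simp: J_def)
    then show ?thesis using \<rho>(1) by (simp add: pos_divide_le_eq mult.commute)
  qed
  have gm: "g \<in> borel_measurable \<mu>" unfolding g_def by measurable
  have gpow: "g x powr r \<le> overlap powr r * (\<Sum>i\<in>I. (b i / \<rho>) powr r * indicator (ball (c i) \<rho>) x)"
    if r: "0 < r" for x r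
  proof (cases "J x = {}")
    case True
    then have "g x = 0" unfolding gJ by simp
    then show ?thesis by (auto intro!: mult_nonneg_nonneg sum_nonneg)
  next
    case False
    then have "Max ((\<lambda>i. b i / \<rho>) ` J x) \<in> (\<lambda>i. b i / \<rho>) ` J x" using finJ by (intro Max_in) auto
    then obtain k where k: "k \<in> J x" "b k / \<rho> = Max ((\<lambda>i. b i / \<rho>) ` J x)" by auto
    have kmax: "b i / \<rho> \<le> b k / \<rho>" if "i \<in> J x" for i
      unfolding k(2) by (rule Max_ge) (use that finJ in auto)
    have kI: "k \<in> I" "x \<in> ball (c k) \<rho>" using k unfolding J_def by auto
    have bk: "0 \<le> b k / \<rho>" using b(1)[OF kI(1)] \<rho> by simp
    have "g x \<le> (\<Sum>i\<in>J x. b k / \<rho>)" unfolding gJ by (intro sum_mono kmax)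
    also have "\<dots> \<le> overlap * (b k / \<rho>)" using mult_right_mono[OF cardJ bk] by simp
    finally have "g x powr r \<le> (overlap * (b k / \<rho>)) powr r" using r g0 by (intro powr_mono2) auto
    also have "\<dots> = overlap powr r * ((b k / \<rho>) powr r * indicator (ball (c k) \<rho>) x)"
      using overlap_pos bk kI(2) by (subst powr_mult) auto
    also have "\<dots> \<le> overlap powr r * (\<Sum>i\<in>I. (b i / \<rho>) powr r * indicator (ball (c i) \<rho>) x)"
      by (intro mult_left_mono member_le_sum[of k I "\<lambda>i. (b i / \<rho>) powr r * indicator (ball (c i) \<rho>) x"])
         (use kI fin in auto)
    finally show ?thesis .
  qed
  have intind: "integrable \<mu> (\<lambda>x. k * indicator (ball z \<rho>) x)" for k :: real and z
    using finite_ball[of z \<rho>] by (intro integrable_mult_right) (simp add: less_top)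
  have intg: "integrable \<mu> (\<lambda>x. g x powr r)" if r: "0 < r" for r
  proof (rule Bochner_Integration.integrable_bound)
    show "integrable \<mu> (\<lambda>x. overlap powr r * (\<Sum>i\<in>I. (b i / \<rho>) powr r * indicator (ball (c i) \<rho>) x))"
      by (intro integrable_mult_right Bochner_Integration.integrable_sum intind)
    show "(\<lambda>x. g x powr r) \<in> borel_measurable \<mu>" using gm by measurable
    show "AE x in \<mu>. norm (g x powr r) \<le> norm (overlap powr r * (\<Sum>i\<in>I. (b i / \<rho>) powr r * indicator (ball (c i) \<rho>) x))"
      using gpow[OF r] by (intro AE_I2) (auto intro: order_trans[OF _ abs_ge_self])
  qed
  have s0: "0 < s" and q: "1 < p / s" using s_ge s_less by auto
  have gsq: "(g x powr s) powr (p / s) = g x powr p" for x using s0 by (simp add: powr_powr)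
  obtain M where M: "M \<in> borel_measurable \<mu>" "\<And>x. 0 \<le> M x" "integrable \<mu> (\<lambda>x. M x powr (p / s))"
    "(LINT x|\<mu>. M x powr (p / s)) \<le> max_const * (LINT x|\<mu>. g x powr p)"
    "\<And>x t. x \<in> K \<Longrightarrow> \<rho> \<le> t \<Longrightarrow> 12 * t \<le> R \<Longrightarrow>
       (LINT y|\<mu>. indicator (ball x t) y * g y powr s) \<le> C * 4 powr Q * t powr Q * M x"
  proof (rule maximal_function_above_scale[OF fin \<rho>(1), of K c "\<lambda>x. g x powr s" "p / s"])
    show "K \<subseteq> (\<Union>i\<in>I. ball (c i) \<rho>)"
      using cover subset_ball[of "\<rho> / 2" \<rho>] \<rho> by (fastforce simp: subset_iff)
    show "integrable \<mu> (\<lambda>x. g x powr s)" by (rule intg[OF s0])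
    show "integrable \<mu> (\<lambda>x. (g x powr s) powr (p / s))" unfolding gsq by (rule intg[OF p_pos])
  qed (use q in \<open>auto simp: gsq max_const_def\<close>)
  define h where "h x = M x powr (1 / s)" for x
  have h0: "0 \<le> h x" for x unfolding h_def by simp
  define H where "H x = chain_const * h x" for x
  have hp: "h x powr p = M x powr (p / s)" for x unfolding h_def by (simp add: powr_powr)
  have Hp: "H x powr p = chain_const powr p * M x powr (p / s)" for x
    unfolding H_def using chain_const_pos h0 by (simp add: powr_mult hp)
  show ?thesis
  proof (rule that[of H])
    show "H \<in> borel_measurable \<mu>" unfolding H_def h_def using M(1) by measurable
    show "0 \<le> H x" for x unfolding H_def using chain_const_pos h0 by simp
    show "integrable \<mu> (\<lambda>x. H x powr p)" unfolding Hp by (intro integrable_mult_right M)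
    have "(LINT x|\<mu>. g x powr p) \<le> (LINT x|\<mu>. overlap powr p * (\<Sum>i\<in>I. (b i / \<rho>) powr p * indicator (ball (c i) \<rho>) x))"
      by (intro integral_mono intg p_pos gpow integrable_mult_right Bochner_Integration.integrable_sum intind)
    also have "\<dots> = overlap powr p * (\<Sum>i\<in>I. (b i / \<rho>) powr p * measure \<mu> (ball (c i) \<rho>))"
      using intind finite_ball by (subst integral_mult_right_zero, subst Bochner_Integration.integral_sum) (auto simp: less_top)
    also have "\<dots> \<le> overlap powr p * (\<Sum>i\<in>I. (b i / \<rho>) powr p * (C * \<rho> powr Q))"
      using \<rho> by (intro mult_left_mono sum_mono upper) auto
    also have "\<dots> = overlap powr p * C * (\<Sum>i\<in>I. (b i / \<rho>) powr p * \<rho> powr Q)"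
      by (simp add: sum_distrib_left mult_ac)
    finally have G: "(LINT x|\<mu>. g x powr p) \<le> overlap powr p * C * (\<Sum>i\<in>I. (b i / \<rho>) powr p * \<rho> powr Q)" .
    have "(LINT x|\<mu>. H x powr p) = chain_const powr p * (LINT x|\<mu>. M x powr (p / s))" unfolding Hp by simp
    also have "\<dots> \<le> chain_const powr p * (max_const * (overlap powr p * C * (\<Sum>i\<in>I. (b i / \<rho>) powr p * \<rho> powr Q)))"
      by (intro mult_left_mono order_trans[OF M(4)] G) (auto simp: max_const_def)
    finally show "(LINT x|\<mu>. H x powr p) \<le> norm_const * (\<Sum>i\<in>I. (b i / \<rho>) powr p * \<rho> powr Q)"
      unfolding norm_const_def by (simp add: mult_ac)
  next
    fix x y assume xy: "x \<in> U" "y \<in> U"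
    show "norm (f x - f y) \<le> dist x y * (H x + H y) + 8 * \<delta>"
    proof (cases "\<rho> \<le> \<eta> * dist x y")
      case False
      then have "dist x y < 2 * \<rho> / \<eta>" using eta \<rho> by (simp add: pos_less_divide_eq mult.commute)
      then have "norm (f x - f y) \<le> \<delta>" using xy U_K by (intro \<delta>) auto
      moreover have "0 \<le> dist x y * (H x + H y)"
        using chain_const_pos h0 unfolding H_def by (intro mult_nonneg_nonneg add_nonneg_nonneg) auto
      ultimately show ?thesis using \<delta>(1) by linarith
    next
      case True
      \<comment> \<open>This choice makes the difference \<open>v y - v x\<close> equal to the norm of \<open>f x - f y\<close>. The
        bound \<open>h\<close> on the gradient depends on \<open>f\<close> only, so \<open>v\<close> may change with the point \<open>x\<close>.\<close>
      define v where "v z = norm (f z - f x)" for z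
      have vl: "\<bar>v z - v w\<bar> \<le> norm (f z - f w)" for z w
        unfolding v_def using norm_triangle_ineq3[of "f z - f x" "f w - f x"] by simp
      define u where "u = blend I c \<rho> (\<lambda>i. v (c i))"
      obtain L where u: "L-lipschitz_on UNIV u"
        using blend_lipschitz[OF fin \<rho>(1)] unfolding u_def by blast
      have uv: "\<bar>u z - v z\<bar> \<le> \<delta>" if "z \<in> K" for z
        unfolding u_def
      proof (rule blend_local_estimates(1)[OF fin \<rho>(1) cover that \<delta>(1)])
        fix i assume "i \<in> I" "z \<in> ball (c i) \<rho>"
        then show "\<bar>v (c i) - v z\<bar> \<le> \<delta>" using vl[of "c i" z] b(2,3)[of i] by fastforce
      qed
      have lipu: "Lip u z \<le> ennreal (8 * overlap * g z)" if z: "ball z r \<subseteq> K" "0 < r" for z r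
      proof (rule Lip_le[of "min r (\<rho> / 4)"])
        have zK: "z \<in> K" using z by auto
        fix w assume w: "dist z w < min r (\<rho> / 4)"
        then have wK: "w \<in> K" "dist z w < \<rho> / 4" using z by auto
        have "\<bar>u z - u w\<bar> \<le> 8 * real (card {i\<in>I. z \<in> ball (c i) \<rho>}) * (\<rho> * g z / \<rho>) * dist z w"
          unfolding u_def
        proof (rule blend_local_estimates(2)[OF fin \<rho>(1) cover zK _ _ wK, where a="v z"])
          show "0 \<le> \<rho> * g z" using \<rho> g0 by simp
          fix i assume "i \<in> I" "z \<in> ball (c i) \<rho>"
          then show "\<bar>v (c i) - v z\<bar> \<le> \<rho> * g z"
            using vl[of "c i" z] b(3)[of i z] bg[of i z] unfolding J_def by simp
        qed
        also have "\<dots> \<le> 8 * overlap * g z * dist z w"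
          using cardJ[of z] g0[of z] \<rho> unfolding J_def[symmetric] by (auto intro!: mult_right_mono)
        finally show "\<bar>u z - u w\<bar> \<le> 8 * overlap * g z * dist z w" .
      qed (use z \<rho> overlap_pos g0 in auto)
      have "\<bar>u x - u y\<bar> \<le> chain_const * dist x y * (h x + h y) + 2 * (3 * \<delta>)"
      proof (rule two_point_estimate[OF u \<rho>(1) xy True h0])
        fix z t assume z: "z \<in> {x, y}" and t: "\<rho> \<le> t" "t \<le> (1 + \<eta>) * dist x y"
        have lt: "lam * t \<le> lam * ((1 + \<eta>) * dist x y)" using t lam_ge by (intro mult_left_mono) auto
        have R12: "12 * (lam * t) \<le> R" using dist_R[OF xy] lt by linarith
        have t0: "0 < t" "t \<le> lam * t" using t \<rho> lam_ge by (auto simp: mult_le_cancel_right1)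
        have zK: "ball z (lam * ((1 + \<eta>) * dist x y)) \<subseteq> K" "z \<in> K"
          using z ball_K[OF xy] ball_K[OF xy(2,1)] xy U_K by (auto simp: dist_commute)
        have "avg \<mu> (ball z t) (\<lambda>w. \<bar>u w - avg \<mu> (ball z t) u\<bar>)
          \<le> C\<^sub>P * (8 * overlap) * (C\<^sup>2 * 4 powr Q) powr (1 / s) * t * M z powr (1 / s)"
        proof (rule poincare_oscillation_le[OF poincare s_ge u t0(1) _ _ g0 intg[OF s0]])
          show "lam * t \<le> R" using R12 t0 by linarith
          show "0 < 8 * overlap" using overlap_pos by simp
          show "0 \<le> M z" by (rule M)
          show "(LINT y|\<mu>. indicator (ball z (lam * t)) y * g y powr s) \<le> C * 4 powr Q * (lam * t) powr Q * M z"
            by (rule M(5)[OF zK(2) order_trans[OF t(1) t0(2)] R12])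
          fix w assume w: "w \<in> ball z (lam * t)"
          have "ball w (lam * t - dist z w) \<subseteq> ball z (lam * t)"
          proof
            fix a assume "a \<in> ball w (lam * t - dist z w)"
            then show "a \<in> ball z (lam * t)" using dist_triangle[of z a w] by simp
          qed
          also have "\<dots> \<subseteq> K" using zK(1) subset_ball[OF lt] by blast
          finally show "Lip u w \<le> ennreal (8 * overlap * g w)" using w by (intro lipu[of w]) auto
        qed
        then show "avg \<mu> (ball z t) (\<lambda>w. \<bar>u w - avg \<mu> (ball z t) u\<bar>) \<le> osc_const * h z * t"
          unfolding osc_const_def h_def by (simp add: mult_ac)
      next
        fix z w assume zw: "z \<in> K" "w \<in> K" "dist z w < 2 * \<rho>"
        have "2 * \<rho> \<le> 2 * \<rho> / \<eta>" using eta \<rho> by (simp add: pos_le_divide_eq mult_le_cancel_left2)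
        then have "norm (f w - f z) \<le> \<delta>" using zw by (intro \<delta>(2)) (auto simp: dist_commute)
        then show "\<bar>u w - u z\<bar> \<le> 3 * \<delta>" using uv[OF zw(1)] uv[OF zw(2)] vl[of w z] by linarith
      qed
      moreover have "x \<in> K" "y \<in> K" using xy U_K by auto
      moreover have "v x = 0" "v y = norm (f x - f y)" unfolding v_def by (auto simp: norm_minus_commute)
      ultimately have "norm (f x - f y) \<le> chain_const * dist x y * (h x + h y) + 8 * \<delta>"
        using uv[of x] uv[of y] by linarith
      then show ?thesis unfolding H_def by (simp add: algebra_simps)
    qed
  qed
qed

end

section \<open>From gradients at all scales to a Hajlasz gradient\<close>

text \<open>A separated subset of \<open>K\<close> has at most as many points as a cover of \<open>K\<close> by balls of half the radius,
so one of maximal cardinality exists; maximality makes it a net.\<close>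
lemma finite_separated_net:
  fixes K :: "'a::metric_space set"
  assumes K: "compact K" and r: "0 < r"
  obtains n :: nat and c where "\<forall>i<n. c i \<in> K" "K \<subseteq> (\<Union>i<n. ball (c i) r)"
    "\<forall>i<n. \<forall>j<n. i \<noteq> j \<longrightarrow> r \<le> dist (c i) (c j)"
proof -
  obtain k where k: "finite k" "K \<subseteq> (\<Union>x\<in>k. ball x (r / 2))"
    using compactE_image[OF K, of K "\<lambda>x. ball x (r / 2)"] r
    by (metis (no_types, lifting) UN_iff centre_in_ball half_gt_zero open_ball subsetI)
  define P where "P A \<longleftrightarrow> A \<subseteq> K \<and> finite A \<and> (\<forall>x\<in>A. \<forall>y\<in>A. x \<noteq> y \<longrightarrow> r \<le> dist x y)" for A
  have bound: "card A \<le> card k" if A: "P A" for A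
  proof -
    have "\<forall>x\<in>A. \<exists>z\<in>k. dist z x < r / 2" using A k(2) unfolding P_def by (force simp: subset_iff)
    then obtain \<phi> where \<phi>: "\<And>x. x \<in> A \<Longrightarrow> \<phi> x \<in> k" "\<And>x. x \<in> A \<Longrightarrow> dist (\<phi> x) x < r / 2" by metis
    have "inj_on \<phi> A"
    proof (rule inj_onI, rule ccontr)
      fix x y assume xy: "x \<in> A" "y \<in> A" "\<phi> x = \<phi> y" "x \<noteq> y"
      have "dist x y \<le> dist (\<phi> x) x + dist (\<phi> x) y" by (metis dist_commute dist_triangle)
      then have "dist x y < r" using \<phi>(2)[OF xy(1)] \<phi>(2)[OF xy(2)] xy(3) by simp
      then show False using A xy unfolding P_def by force
    qed
    then show ?thesis using \<phi>(1) k(1) by (intro card_inj_on_le[of \<phi>]) auto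
  qed
  have "P {}" unfolding P_def by simp
  then obtain A where A: "P A" "\<And>B. P B \<Longrightarrow> card B \<le> card A"
    using ex_has_greatest_nat[of P "{}" card "Suc (card k)"] bound by (auto simp: less_Suc_eq_le)
  have finA: "finite A" using A(1) unfolding P_def by simp
  have cover: "\<exists>y\<in>A. dist y x < r" if "x \<in> K" for x
  proof (rule ccontr)
    assume no: "\<not> (\<exists>y\<in>A. dist y x < r)"
    then have "x \<notin> A" using r by auto
    moreover have "P (insert x A)"
      using A(1) that no unfolding P_def by (auto simp: dist_commute not_less)
    then have "card (insert x A) \<le> card A" by (rule A(2))
    ultimately show False using finA by simp
  qed
  obtain c where c: "bij_betw c {0..<card A} A" using ex_bij_betw_nat_finite[OF finA] by blast
  show ?thesis
  proof (rule that[of "card A" c])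
    show "\<forall>i<card A. c i \<in> K"
      using bij_betwE[OF c] A(1) unfolding P_def by auto
    show "K \<subseteq> (\<Union>i<card A. ball (c i) r)"
    proof
      fix x assume "x \<in> K"
      then obtain y where y: "y \<in> A" "dist y x < r" using cover by blast
      moreover have "y \<in> c ` {0..<card A}" using y(1) bij_betw_imp_surj_on[OF c] by simp
      ultimately obtain i where "i < card A" "c i = y" by auto
      then show "x \<in> (\<Union>i<card A. ball (c i) r)" using y by auto
    qed
    show "\<forall>i<card A. \<forall>j<card A. i \<noteq> j \<longrightarrow> r \<le> dist (c i) (c j)"
    proof (intro allI impI)
      fix i j assume that: "i < card A" "j < card A" "i \<noteq> j"
      have "c i \<noteq> c j" using bij_betw_imp_inj_on[OF c] that by (auto simp: inj_on_def)
      moreover have "c i \<in> A" "c j \<in> A" using that bij_betwE[OF c] by auto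
      ultimately show "r \<le> dist (c i) (c j)" using A(1) unfolding P_def by blast
    qed
  qed
qed

text \<open>Convexity on the positive numbers extends to arguments that may vanish because \<open>2 \<le> 2 powr p\<close>.\<close>
lemma powr_midpoint_le:
  fixes a b p :: real
  assumes "1 \<le> p" "0 \<le> a" "0 \<le> b"
  shows "((a + b) / 2) powr p \<le> (a powr p + b powr p) / 2"
proof -
  have z: "(t / 2) powr p \<le> t powr p / 2" if "0 \<le> t" for t :: real
  proof -
    have "2 \<le> (2::real) powr p" using assms(1) powr_mono[of 1 p "2::real"] by simp
    then have "t powr p / 2 powr p \<le> t powr p / 2" by (intro divide_left_mono) auto
    then show ?thesis using that by (simp add: powr_divide)
  qed
  consider "a = 0" | "b = 0" | "0 < a" "0 < b" using assms by linarith
  then show ?thesis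
  proof cases
    case 3
    then have "((1 - 1 / 2) *\<^sub>R a + (1 / 2) *\<^sub>R b) powr p \<le> (1 - 1 / 2) * a powr p + 1 / 2 * b powr p"
      by (intro convex_onD[OF powr_convex[OF assms(1)]]) auto
    then show ?thesis by (simp add: add_divide_distrib)
  qed (use z[of a] z[of b] assms in auto)
qed

lemma ennreal_le_of_real_bounds:
  fixes X Y :: ennreal
  assumes k: "0 < k" and b: "\<And>T. 0 \<le> T \<Longrightarrow> Y < ennreal T \<Longrightarrow> X \<le> ennreal (k * T)"
  shows "X \<le> ennreal k * Y"
proof (cases Y)
  case top
  have "ennreal k \<noteq> 0" using k by (simp only: ennreal_eq_0_iff not_le)
  then show ?thesis using top by (simp only: ennreal_mult_top) simp
next
  case (real y)
  show ?thesis
  proof (rule ennreal_le_epsilon)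
    fix e :: real assume e: "0 < e"
    have "X \<le> ennreal (k * (y + e / k))" using real e k by (intro b) (auto simp: ennreal_less_iff)
    also have "k * (y + e / k) = k * y + e" using k by (simp add: field_simps)
    also have "ennreal (k * y + e) = ennreal k * Y + ennreal e"
      using real e k by (simp add: ennreal_mult)
    finally show "X \<le> ennreal k * Y + ennreal e" .
  qed
qed

context poincare_domain
begin

lemma finite_emeasure_K: "emeasure \<mu> K < \<infinity>"
proof -
  obtain x r where "K \<subseteq> ball x r" using compact_imp_bounded[OF compact_K] by (metis bounded_subset_ballD)
  then have "emeasure \<mu> K \<le> emeasure \<mu> (ball x r)" by (intro emeasure_mono) auto
  then show ?thesis using finite_ball[of x r] by (simp add: le_less_trans)
qed

lemma K_sets: "K \<in> sets \<mu>" using compact_imp_closed[OF compact_K] by simp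

text \<open>Applies the estimate at a fixed scale to a net at a scale \<open>\<rho>\<close> so small that all oscillations are below
\<open>\<delta>\<close>. The balls of radius \<open>\<rho>\<close> around a \<open>\<rho>/2\<close>-net form an admissible family because
\<open>2 \<epsilon> \<rho> \<le> \<rho> / 2\<close>.\<close>
lemma approximate_gradient:
  fixes f :: "'a \<Rightarrow> 'b::real_normed_vector"
  assumes eps4: "\<epsilon> \<le> 1 / 4" and cont: "continuous_on K f" and r0: "0 < r\<^sub>0" and T: "0 \<le> T"
    and sup: "(SUP (I, c, \<rho>)\<in>admissible_families \<epsilon> K r\<^sub>0.
       \<Sum>\<^sub>\<infinity>i\<in>I. epowr (holder_seminorm (1 - Q / p) f (ball (c i) \<rho>)) p) \<le> ennreal T"
    and \<delta>: "0 < \<delta>"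
  obtains H where "H \<in> borel_measurable \<mu>" "\<And>x. 0 \<le> H x" "integrable \<mu> (\<lambda>x. H x powr p)"
    "(LINT x|\<mu>. H x powr p) \<le> norm_const * T"
    "\<And>x y. x \<in> U \<Longrightarrow> y \<in> U \<Longrightarrow> norm (f x - f y) \<le> dist x y * (H x + H y) + 8 * \<delta>"
proof -
  define \<alpha> where "\<alpha> = 1 - Q / p"
  have \<alpha>: "0 < \<alpha>" using p_gt p_pos unfolding \<alpha>_def by simp
  obtain e where e: "0 < e" "\<And>x y. x \<in> K \<Longrightarrow> y \<in> K \<Longrightarrow> dist x y < e \<Longrightarrow> norm (f x - f y) < \<delta>"
    using compact_uniformly_continuous[OF cont compact_K] \<delta> unfolding uniformly_continuous_on_def
    by (metis dist_norm dist_commute)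
  \<comment> \<open>Since each \<open>L i\<close> below is at most \<open>(T + 1) powr (1 / p)\<close>, this threshold makes the oscillations
    \<open>L i * \<rho> powr \<alpha>\<close> at most \<open>\<delta>\<close>; the summand \<open>1\<close> avoids division by zero.\<close>
  define w where "w = (\<delta> / (T + 1) powr (1 / p)) powr (1 / \<alpha>)"
  have w: "0 < w" unfolding w_def using \<delta> T by simp
  define \<rho> where "\<rho> = min (min (r\<^sub>0 / 2) (R / 2)) (min (\<eta> * e / 2) w)"
  have \<rho>: "0 < \<rho>" "\<rho> < r\<^sub>0" "2 * \<rho> \<le> R" "\<rho> \<le> \<eta> * e / 2" "\<rho> \<le> w"
    using r0 R_pos eta e(1) w unfolding \<rho>_def by auto
  have \<rho>\<alpha>: "(T + 1) powr (1 / p) * \<rho> powr \<alpha> \<le> \<delta>"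
  proof -
    have "\<rho> powr \<alpha> \<le> w powr \<alpha>" using \<rho> \<alpha> by (intro powr_mono2) auto
    also have "\<dots> = \<delta> / (T + 1) powr (1 / p)" unfolding w_def using \<alpha> \<delta> T by (simp add: powr_powr)
    finally show ?thesis using T by (simp add: pos_le_divide_eq mult.commute)
  qed
  have h2: "0 < \<rho> / 2" using \<rho> by simp
  obtain n :: nat and c where net: "\<forall>i<n. c i \<in> K" "K \<subseteq> (\<Union>i<n. ball (c i) (\<rho> / 2))"
    "\<forall>i<n. \<forall>j<n. i \<noteq> j \<longrightarrow> \<rho> / 2 \<le> dist (c i) (c j)"
    by (rule finite_separated_net[OF compact_K h2])
  have c: "\<And>i. i < n \<Longrightarrow> c i \<in> K" "K \<subseteq> (\<Union>i<n. ball (c i) (\<rho> / 2))"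
    "\<And>i j. i < n \<Longrightarrow> j < n \<Longrightarrow> i \<noteq> j \<Longrightarrow> \<rho> / 2 \<le> dist (c i) (c j)"
    using net by simp_all
  have disj: "ball (c i) (\<epsilon> * \<rho>) \<inter> ball (c j) (\<epsilon> * \<rho>) = {}" if "i < n" "j < n" "i \<noteq> j" for i j
  proof -
    have "\<epsilon> * \<rho> \<le> 1 / 4 * \<rho>" using eps4 \<rho> by (intro mult_right_mono) auto
    then show ?thesis using c(3)[OF that] by (intro disjoint_ballI) simp
  qed
  have adm: "({..<n}, c, \<rho>) \<in> admissible_families \<epsilon> K r\<^sub>0"
  proof -
    have "K \<subseteq> (\<Union>i\<in>{..<n}. ball (c i) \<rho>)"
      using c(2) subset_ball[of "\<rho> / 2" \<rho>] \<rho>(1) by (fastforce simp: subset_iff)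
    moreover have "ball (c i) \<rho> \<inter> K \<noteq> {}" if "i < n" for i
      using c(1)[OF that] \<rho>(1) by (metis Int_iff centre_in_ball empty_iff)
    ultimately show ?thesis using \<rho> disj unfolding admissible_families_def by auto
  qed
  define l where "l i = holder_seminorm \<alpha> f (ball (c i) \<rho>)" for i
  have "(\<Sum>\<^sub>\<infinity>i\<in>{..<n}. epowr (l i) p) \<le> ennreal T"
    using SUP_upper[OF adm, of "\<lambda>(I, c, \<rho>). \<Sum>\<^sub>\<infinity>i\<in>I. epowr (holder_seminorm (1 - Q / p) f (ball (c i) \<rho>)) p"] sup
    unfolding l_def \<alpha>_def by simp
  then have lsum: "(\<Sum>i<n. epowr (l i) p) \<le> ennreal T" by simp
  have l1: "epowr (l i) p \<le> ennreal T" if "i < n" for i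
    by (rule order_trans[OF _ lsum]) (use that in \<open>auto intro!: member_le_sum\<close>)
  have lfin: "l i < \<infinity>" if "i < n" for i
    using l1[OF that] by (cases "l i") (auto simp: top_unique)
  define L where "L i = enn2real (l i)" for i
  have L0: "0 \<le> L i" for i unfolding L_def by simp
  have lL: "l i = ennreal (L i)" if "i < n" for i
    using lfin[OF that] unfolding L_def by (simp add: less_top)
  have "ennreal (\<Sum>i<n. L i powr p) = (\<Sum>i<n. epowr (l i) p)"
    by (subst sum_ennreal[symmetric]) (auto intro!: sum.cong simp: lL epowr_ennreal L0)
  with lsum have "ennreal (\<Sum>i<n. L i powr p) \<le> ennreal T" by (simp only:)
  then have Lsum: "(\<Sum>i<n. L i powr p) \<le> T" by (subst (asm) ennreal_le_iff[OF T])
  have LT: "L i \<le> (T + 1) powr (1 / p)" if "i < n" for i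
  proof -
    have "L i powr p \<le> T"
      using order_trans[OF member_le_sum[of i "{..<n}" "\<lambda>i. L i powr p"] Lsum] that by simp
    then have "(L i powr p) powr (1 / p) \<le> (T + 1) powr (1 / p)" using p_pos by (intro powr_mono2) auto
    then show ?thesis using p_pos L0[of i] by (simp add: powr_powr)
  qed
  define b where "b i = L i * \<rho> powr \<alpha>" for i
  have hold: "norm (f (c i) - f x) \<le> b i" if i: "i < n" and x: "x \<in> ball (c i) \<rho>" for i x
  proof (cases "x = c i")
    case True
    then show ?thesis unfolding b_def using L0 by simp
  next
    case False
    have "ennreal (norm (f (c i) - f x) / dist (c i) x powr \<alpha>) \<le> l i"
      unfolding l_def holder_seminorm_def
      using False x \<rho>(1) by (intro SUP_upper2[of "(c i, x)"]) auto
    then have "norm (f (c i) - f x) / dist (c i) x powr \<alpha> \<le> L i"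
      unfolding lL[OF i] by (simp add: ennreal_le_iff L0)
    then have "norm (f (c i) - f x) \<le> L i * dist (c i) x powr \<alpha>"
      using False by (simp add: pos_divide_le_eq)
    also have "\<dots> \<le> L i * \<rho> powr \<alpha>" using x L0 \<alpha> by (intro mult_left_mono powr_mono2) auto
    finally show ?thesis unfolding b_def .
  qed
  have b0: "0 \<le> b i" for i unfolding b_def using L0 by simp
  have b\<delta>: "b i \<le> \<delta>" if "i < n" for i
    unfolding b_def using mult_right_mono[OF LT[OF that], of "\<rho> powr \<alpha>"] \<rho>\<alpha> by simp
  have bL: "(b i / \<rho>) powr p * \<rho> powr Q = L i powr p" for i
  proof -
    have "b i / \<rho> = L i * \<rho> powr (\<alpha> - 1)" unfolding b_def using \<rho>(1) by (simp add: powr_diff)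
    then have "(b i / \<rho>) powr p * \<rho> powr Q = L i powr p * \<rho> powr ((\<alpha> - 1) * p + Q)"
      using L0 \<rho>(1) by (simp add: powr_mult powr_powr powr_add)
    also have "(\<alpha> - 1) * p + Q = 0" unfolding \<alpha>_def using p_pos by simp
    finally show ?thesis using \<rho>(1) by simp
  qed
  have uc: "norm (f x - f y) \<le> \<delta>" if "x \<in> K" "y \<in> K" "dist x y < 2 * \<rho> / \<eta>" for x y
  proof -
    have "2 * \<rho> / \<eta> \<le> e" using \<rho>(4) eta(1) by (simp add: pos_divide_le_eq mult.commute)
    then show ?thesis using e(2)[OF that(1,2)] that(3) by simp
  qed
  obtain H where H: "H \<in> borel_measurable \<mu>" "\<And>x. 0 \<le> H x" "integrable \<mu> (\<lambda>x. H x powr p)"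
    "(LINT x|\<mu>. H x powr p) \<le> norm_const * (\<Sum>i\<in>{..<n}. (b i / \<rho>) powr p * \<rho> powr Q)"
    "\<And>x y. x \<in> U \<Longrightarrow> y \<in> U \<Longrightarrow> norm (f x - f y) \<le> dist x y * (H x + H y) + 8 * \<delta>"
  proof (rule gradient_above_scale[of "{..<n}" \<rho> c b \<delta> f])
    show "finite {..<n}" "0 < \<rho>" "2 * \<rho> \<le> R" "K \<subseteq> (\<Union>i\<in>{..<n}. ball (c i) (\<rho> / 2))" "0 \<le> \<delta>"
      using \<rho> c(2) \<delta> by auto
  qed (use disj b0 b\<delta> hold uc in auto)
  have "norm_const * (\<Sum>i<n. L i powr p) \<le> norm_const * T"
    using norm_const_pos by (intro mult_left_mono Lsum) simp
  with H(4) have "(LINT x|\<mu>. H x powr p) \<le> norm_const * T" unfolding bL by (rule order_trans)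
  then show ?thesis using that H by blast
qed

text \<open>The approximate gradients with error \<open>8 / (n + 1)\<close> and fixed norm bound form a decreasing sequence of
sets closed under midpoints, by the convexity of the \<open>p\<close>-th power. An almost everywhere limit
of their elements is a Hajlasz gradient.\<close>
lemma hajlasz_le_compactly_holder:
  fixes f :: "'a \<Rightarrow> 'b::real_normed_vector"
  assumes eps4: "\<epsilon> \<le> 1 / 4" and cont: "continuous_on K f"
  shows "hajlasz_seminorm (completion \<mu>) p f U
    \<le> ennreal (norm_const powr (1 / p)) * compactly_holder_seminorm p (1 - Q / p) \<epsilon> f K"
proof -
  define X where "X = (INF r\<in>{0<..<1}. SUP (I, c, \<rho>)\<in>admissible_families \<epsilon> K r.
              \<Sum>\<^sub>\<infinity>i\<in>I. epowr (holder_seminorm (1 - Q / p) f (ball (c i) \<rho>)) p)"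
  have main: "epowr (hajlasz_seminorm (completion \<mu>) p f U) p \<le> ennreal (norm_const * T)"
    if T: "0 \<le> T" "X < ennreal T" for T
  proof -
    obtain r where r: "r \<in> {0<..<1}" "(SUP (I, c, \<rho>)\<in>admissible_families \<epsilon> K r.
       \<Sum>\<^sub>\<infinity>i\<in>I. epowr (holder_seminorm (1 - Q / p) f (ball (c i) \<rho>)) p) < ennreal T"
      using T(2) unfolding X_def INF_less_iff by blast
    define N where "N = restrict_space \<mu> K"
    have spN: "space N = K" unfolding N_def by (simp add: space_restrict_space)
    interpret N: finite_measure N
      by (rule finite_measureI) (use finite_emeasure_K K_sets in \<open>simp add: N_def emeasure_restrict_space space_restrict_space less_top\<close>)
    define B where "B = norm_const * T"
    define S where "S n = {h. h \<in> borel_measurable N \<and> (\<forall>x. 0 \<le> h x) \<and>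
        (\<integral>\<^sup>+x. ennreal (h x powr p) \<partial>N) \<le> ennreal B \<and>
        (\<forall>x\<in>U. \<forall>y\<in>U. norm (f x - f y) \<le> dist x y * (h x + h y) + 8 * (1 / real (Suc n)))}" for n
    have ne: "S n \<noteq> {}" for n
    proof -
      have "0 < r" "0 < 1 / real (Suc n)" using r(1) by auto
      from approximate_gradient[OF eps4 cont this(1) T(1) less_imp_le[OF r(2)] this(2)]
      obtain H where H: "H \<in> borel_measurable \<mu>" "\<And>x. 0 \<le> H x" "integrable \<mu> (\<lambda>x. H x powr p)"
        "(LINT x|\<mu>. H x powr p) \<le> norm_const * T"
        "\<And>x y. x \<in> U \<Longrightarrow> y \<in> U \<Longrightarrow> norm (f x - f y) \<le> dist x y * (H x + H y) + 8 * (1 / real (Suc n))"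
        by blast
      have "(\<integral>\<^sup>+x. ennreal (H x powr p) \<partial>N) = (\<integral>\<^sup>+x\<in>K. ennreal (H x powr p) \<partial>\<mu>)"
        unfolding N_def using K_sets by (intro nn_integral_restrict_space) simp
      also have "\<dots> \<le> (\<integral>\<^sup>+x. ennreal (H x powr p) \<partial>\<mu>)"
        by (intro nn_integral_mono) (auto simp: indicator_def)
      also have "\<dots> = ennreal (LINT x|\<mu>. H x powr p)" by (intro nn_integral_eq_integral H(3)) simp
      also have "\<dots> \<le> ennreal B" unfolding B_def by (intro ennreal_leI H(4))
      finally have "H \<in> S n"
        using H(2,5) measurable_restrict_space1[OF H(1)] unfolding S_def N_def by blast
      then show ?thesis by blast
    qed
    have dec: "S (Suc n) \<subseteq> S n" for n
    proof
      fix h assume h: "h \<in> S (Suc n)"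
      have le: "8 * (1 / real (Suc (Suc n))) \<le> 8 * (1 / real (Suc n))" by (simp add: divide_simps)
      have "norm (f x - f y) \<le> dist x y * (h x + h y) + 8 * (1 / real (Suc n))" if "x \<in> U" "y \<in> U" for x y
      proof -
        have "norm (f x - f y) \<le> dist x y * (h x + h y) + 8 * (1 / real (Suc (Suc n)))"
          using h that unfolding S_def by blast
        then show ?thesis using le by linarith
      qed
      then show "h \<in> S n" using h unfolding S_def by blast
    qed
    have mid: "(\<lambda>x. (a x + b x) / 2) \<in> S n" if ab: "a \<in> S n" "b \<in> S n" for n a b
    proof -
      have am: "a \<in> borel_measurable N" "b \<in> borel_measurable N" using ab unfolding S_def by auto
      have a0: "0 \<le> a x" "0 \<le> b x" for x using ab unfolding S_def by auto
      have "(\<integral>\<^sup>+x. ennreal (((a x + b x) / 2) powr p) \<partial>N)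
        \<le> (\<integral>\<^sup>+x. ennreal (1 / 2) * (ennreal (a x powr p) + ennreal (b x powr p)) \<partial>N)"
      proof (rule nn_integral_mono)
        fix x
        have "((a x + b x) / 2) powr p \<le> 1 / 2 * (a x powr p + b x powr p)"
          using powr_midpoint_le[of p "a x" "b x"] a0[of x] p_gt Q_ge by simp
        then have "ennreal (((a x + b x) / 2) powr p) \<le> ennreal (1 / 2 * (a x powr p + b x powr p))"
          by (rule ennreal_leI)
        also have "\<dots> = ennreal (1 / 2) * (ennreal (a x powr p) + ennreal (b x powr p))"
          by (subst ennreal_mult) (auto simp: ennreal_plus)
        finally show "ennreal (((a x + b x) / 2) powr p) \<le> ennreal (1 / 2) * (ennreal (a x powr p) + ennreal (b x powr p))" .
      qed
      also have "\<dots> = ennreal (1 / 2) * ((\<integral>\<^sup>+x. ennreal (a x powr p) \<partial>N) + (\<integral>\<^sup>+x. ennreal (b x powr p) \<partial>N))"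
        using am by (subst nn_integral_cmult, measurable) (subst nn_integral_add, auto)
      also have "\<dots> \<le> ennreal (1 / 2) * (ennreal B + ennreal B)"
        using ab unfolding S_def by (intro mult_left_mono add_mono) auto
      also have "\<dots> = ennreal B"
      proof -
        have "0 \<le> B" unfolding B_def using norm_const_pos T by simp
        then have "ennreal B + ennreal B = ennreal (B + B)"
            "ennreal (1 / 2) * ennreal (B + B) = ennreal (1 / 2 * (B + B))"
          by (intro ennreal_plus[symmetric] ennreal_mult[symmetric]; simp)+
        moreover have "1 / 2 * (B + B) = B" by simp
        ultimately show ?thesis by (simp only:)
      qed
      finally have I: "(\<integral>\<^sup>+x. ennreal (((a x + b x) / 2) powr p) \<partial>N) \<le> ennreal B" .
      have "norm (f x - f y) \<le> dist x y * ((a x + b x) / 2 + (a y + b y) / 2) + 8 * (1 / real (Suc n))"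
        if "x \<in> U" "y \<in> U" for x y
      proof -
        have "norm (f x - f y) \<le> dist x y * (a x + a y) + 8 * (1 / real (Suc n))"
          "norm (f x - f y) \<le> dist x y * (b x + b y) + 8 * (1 / real (Suc n))"
          using ab that unfolding S_def by auto
        moreover have "dist x y * ((a x + b x) / 2 + (a y + b y) / 2)
          = (dist x y * (a x + a y) + dist x y * (b x + b y)) / 2" by (simp add: algebra_simps add_divide_distrib)
        moreover have "t \<le> m + e" if "t \<le> k + e" "t \<le> l + e" "m = (k + l) / 2" for t k l m e :: real
          using that by simp
        ultimately show ?thesis by blast
      qed
      then show ?thesis using am a0 I unfolding S_def by auto
    qed
    obtain h where h: "\<And>n. h n \<in> S n"
      "AE x in N. (\<lambda>n. ennreal (h n x)) \<longlonglongrightarrow> liminf (\<lambda>n. ennreal (h n x))"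
      using N.AE_limit_from_decreasing_midpoint_convex[of S, OF ne dec mid] unfolding S_def by blast
    have hm: "h n \<in> borel_measurable N" and h0: "0 \<le> h n x"
      and hI: "(\<integral>\<^sup>+x. ennreal (h n x powr p) \<partial>N) \<le> ennreal B"
      and hU: "\<And>x y. x \<in> U \<Longrightarrow> y \<in> U \<Longrightarrow> norm (f x - f y) \<le> dist x y * (h n x + h n y) + 8 * (1 / real (Suc n))" for n x
      using h(1)[of n] unfolding S_def by auto
    define g where "g x = liminf (\<lambda>n. ennreal (h n x)) * indicator K x" for x
    have gm: "g \<in> borel_measurable \<mu>"
    proof -
      have "(\<lambda>x. liminf (\<lambda>n. ennreal (h n x))) \<in> borel_measurable N" using hm by measurable
      then show ?thesis unfolding g_def N_def
        using K_sets by (subst (asm) borel_measurable_restrict_space_iff_ennreal) auto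
    qed
    have gK: "g x = liminf (\<lambda>n. ennreal (h n x))" if "x \<in> K" for x using that unfolding g_def by simp
    have "AE x in \<mu>. x \<in> K \<longrightarrow> (\<lambda>n. ennreal (h n x)) \<longlonglongrightarrow> g x"
      using h(2) K_sets unfolding N_def by (subst (asm) AE_restrict_space_iff) (auto simp: gK)
    then obtain E where E: "E \<in> null_sets \<mu>"
      "{x \<in> space \<mu>. \<not> (x \<in> K \<longrightarrow> (\<lambda>n. ennreal (h n x)) \<longlonglongrightarrow> g x)} \<subseteq> E"
      unfolding eventually_ae_filter by blast
    have lim: "(\<lambda>n. ennreal (h n x)) \<longlonglongrightarrow> g x" if "x \<in> K" "x \<notin> E" for x
      using E(2) that by auto
    have grad: "hajlasz_gradient (completion \<mu>) f U g"
      unfolding hajlasz_gradient_def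
    proof (intro conjI bexI[of _ E] ballI)
      show "g \<in> borel_measurable (restrict_space (completion \<mu>) U)"
        by (intro measurable_restrict_space1 measurable_completion gm)
      show "E \<in> null_sets (completion \<mu>)" by (rule null_sets_completionI[OF E(1)])
      fix x y assume x: "x \<in> U - E" and y: "y \<in> U - E"
      have le: "ennreal (norm (f x - f y))
          \<le> ennreal (dist x y) * (ennreal (h n x) + ennreal (h n y)) + ennreal (8 * (1 / real (Suc n)))" for n
      proof -
        have "ennreal (norm (f x - f y)) \<le> ennreal (dist x y * (h n x + h n y) + 8 * (1 / real (Suc n)))"
          using x y by (intro ennreal_leI hU) auto
        also have "\<dots> = ennreal (dist x y * (h n x + h n y)) + ennreal (8 * (1 / real (Suc n)))"
          using h0[of n x] h0[of n y] by (intro ennreal_plus) auto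
        also have "ennreal (dist x y * (h n x + h n y)) = ennreal (dist x y) * (ennreal (h n x) + ennreal (h n y))"
          using h0[of n x] h0[of n y] by (simp add: ennreal_mult ennreal_plus)
        finally show ?thesis .
      qed
      have "(\<lambda>n. ennreal (8 * (1 / real (Suc n)))) \<longlonglongrightarrow> ennreal (8 * 0)"
        by (intro tendsto_intros LIMSEQ_Suc[OF lim_1_over_n])
      moreover have "(\<lambda>n. ennreal (dist x y) * (ennreal (h n x) + ennreal (h n y))) \<longlonglongrightarrow> ennreal (dist x y) * (g x + g y)"
        using x y U_K by (intro ennreal_tendsto_cmult tendsto_add lim) auto
      ultimately have "(\<lambda>n. ennreal (dist x y) * (ennreal (h n x) + ennreal (h n y)) + ennreal (8 * (1 / real (Suc n))))
          \<longlonglongrightarrow> ennreal (dist x y) * (g x + g y) + ennreal (8 * 0)"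
        by (intro tendsto_add)
      from LIMSEQ_le_const[OF this] le
      show "ennreal (norm (f x - f y)) \<le> ennreal (dist x y) * (g x + g y)" by simp
    qed
    have "(\<integral>\<^sup>+x\<in>U. epowr (g x) p \<partial>completion \<mu>) \<le> (\<integral>\<^sup>+x\<in>K. epowr (g x) p \<partial>completion \<mu>)"
      using U_K by (intro nn_integral_mono) (auto simp: indicator_def)
    also have "\<dots> = (\<integral>\<^sup>+x\<in>K. epowr (g x) p \<partial>\<mu>)"
      by (rule nn_integral_completion)
    also have "\<dots> = (\<integral>\<^sup>+x. epowr (g x) p \<partial>N)"
      unfolding N_def using K_sets by (intro nn_integral_restrict_space[symmetric]) simp
    also have "\<dots> \<le> (\<integral>\<^sup>+x. liminf (\<lambda>n. ennreal (h n x powr p)) \<partial>N)"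
    proof (rule nn_integral_mono)
      fix x assume "x \<in> space N"
      then show "epowr (g x) p \<le> liminf (\<lambda>n. ennreal (h n x powr p))"
        using epowr_liminf_le[OF p_pos, of "\<lambda>n. ennreal (h n x)"] unfolding spN
        by (simp add: gK epowr_ennreal h0)
    qed
    also have "\<dots> \<le> liminf (\<lambda>n. \<integral>\<^sup>+x. ennreal (h n x powr p) \<partial>N)"
      using hm by (intro nn_integral_liminf) measurable
    also have "\<dots> \<le> ennreal B" by (intro Liminf_le) (use hI in auto)
    finally have fin: "(\<integral>\<^sup>+x\<in>U. epowr (g x) p \<partial>completion \<mu>) \<le> ennreal B" .
    have "hajlasz_seminorm (completion \<mu>) p f U \<le> epowr (\<integral>\<^sup>+x\<in>U. epowr (g x) p \<partial>completion \<mu>) (1 / p)"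
      unfolding hajlasz_seminorm_def by (rule INF_lower) (use grad in simp)
    also have "\<dots> \<le> epowr (ennreal B) (1 / p)" using p_pos by (intro epowr_mono fin) auto
    finally show ?thesis unfolding B_def by (subst epowr_le_iff[OF p_pos])
  qed
  have "epowr (hajlasz_seminorm (completion \<mu>) p f U) p \<le> ennreal norm_const * X"
    by (rule ennreal_le_of_real_bounds[OF norm_const_pos main])
  then have "hajlasz_seminorm (completion \<mu>) p f U \<le> epowr (ennreal norm_const * X) (1 / p)"
    by (subst (asm) epowr_le_iff[OF p_pos])
  also have "\<dots> = ennreal (norm_const powr (1 / p)) * epowr X (1 / p)"
    using norm_const_pos p_pos by (intro epowr_mult) auto
  finally show ?thesis unfolding compactly_holder_seminorm_def X_def .
qed

end

section \<open>Comparison of the two seminorms\<close>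

text \<open>On a one-point space Ahlfors regularity says nothing, because the diameter is \<open>0\<close>; but all functions
are constant.\<close>
lemma seminorms_of_one_point_space:
  fixes f :: "'a::metric_space \<Rightarrow> 'b::real_normed_vector"
  assumes "\<And>x y :: 'a. x = y"
  shows "hajlasz_seminorm M p f A = 0" "compactly_holder_seminorm p \<alpha> \<epsilon> f K = 0"
proof -
  have e0: "epowr 0 a = 0" for a by (simp add: epowr_def)
  have f: "f x = f y" for x y using assms[of x y] by simp
  have "hajlasz_gradient M f A (\<lambda>_. 0)"
    unfolding hajlasz_gradient_def using f by (auto intro!: bexI[of _ "{}"])
  then have "hajlasz_seminorm M p f A \<le> epowr (\<integral>\<^sup>+x\<in>A. epowr 0 p \<partial>M) (1 / p)"
    unfolding hajlasz_seminorm_def by (intro INF_lower) simp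
  then show "hajlasz_seminorm M p f A = 0" by (simp add: e0)
  have no_pairs: "{(x, y). x \<in> B \<and> y \<in> B \<and> x \<noteq> y} = {}" for B :: "'a set" using assms by auto
  have h: "holder_seminorm \<alpha> f B = 0" for B
    unfolding holder_seminorm_def no_pairs by (simp add: bot_ennreal)
  have "(SUP (I, c, \<rho>)\<in>admissible_families \<epsilon> K (1 / 2).
      \<Sum>\<^sub>\<infinity>i\<in>I. epowr (holder_seminorm \<alpha> f (ball (c i) \<rho>)) p) \<le> 0"
    by (rule SUP_least) (simp add: h e0 split: prod.splits)
  then have "(INF r\<in>{0<..<1}. SUP (I, c, \<rho>)\<in>admissible_families \<epsilon> K r.
      \<Sum>\<^sub>\<infinity>i\<in>I. epowr (holder_seminorm \<alpha> f (ball (c i) \<rho>)) p) \<le> 0"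
    by (intro INF_lower2[of "1 / 2"]) auto
  then show "compactly_holder_seminorm p \<alpha> \<epsilon> f K = 0"
    unfolding compactly_holder_seminorm_def by (simp add: e0)
qed

text \<open>The inequality between \<open>\<lambda> diam U\<close> and the distance is strict, so it survives multiplication of
the left-hand side by \<open>1 + \<eta>\<close> for a small \<open>\<eta>\<close>. It also forces \<open>U\<close> to be bounded and contained in \<open>K\<close>.\<close>
lemma dilated_balls_inside:
  fixes U K :: "'a::metric_space set"
  assumes lam: "1 \<le> lam" and U: "U \<noteq> {}" and dist: "ennreal lam * ediam U < edistance U (UNIV - K)"
  obtains \<eta> D where "0 < \<eta>" "\<eta> \<le> 1" "0 \<le> D" "\<And>x y. x \<in> U \<Longrightarrow> y \<in> U \<Longrightarrow> dist x y \<le> D" "U \<subseteq> K"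
    "\<And>x y. x \<in> U \<Longrightarrow> y \<in> U \<Longrightarrow> ball x (lam * ((1 + \<eta>) * dist x y)) \<subseteq> K"
proof -
  define D where "D = enn2real (ediam U)"
  have far: "edistance U (UNIV - K) \<le> ennreal (dist x w)" if "x \<in> U" "w \<notin> K" for x w
    unfolding edistance_def using that by (intro INF_lower2[of x] INF_lower2[of w]) auto
  have "ennreal lam * ediam U < top" by (rule less_le_trans[OF dist]) simp
  then have "ediam U \<noteq> top" using lam by (auto simp: ennreal_mult_top)
  then have D: "ediam U = ennreal D" unfolding D_def by (simp add: less_top)
  have D0: "0 \<le> D" unfolding D_def by simp
  have dD: "dist x y \<le> D" if "x \<in> U" "y \<in> U" for x y
  proof -
    have "ennreal (dist x y) \<le> ediam U" unfolding ediam_def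
      using that by (intro SUP_upper2[of x] SUP_upper2[of y]) auto
    then show ?thesis unfolding D using D0 by (simp add: ennreal_le_iff)
  qed
  have lamD: "ennreal (lam * D) < edistance U (UNIV - K)"
    using dist lam D0 unfolding D by (simp add: ennreal_mult)
  have UK: "U \<subseteq> K"
  proof
    fix x assume "x \<in> U"
    then show "x \<in> K" using far[of x x] lamD by (cases "x \<in> K") (auto simp: not_less[symmetric])
  qed
  have "\<exists>\<eta>. 0 < \<eta> \<and> \<eta> \<le> 1 \<and> ennreal (lam * ((1 + \<eta>) * D)) \<le> edistance U (UNIV - K)"
  proof (cases "edistance U (UNIV - K)")
    case top
    then show ?thesis by (intro exI[of _ 1]) simp
  next
    case (real e)
    then have e: "lam * D < e" using lamD lam D0 by (simp add: ennreal_less_iff)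
    show ?thesis
    proof (cases "D = 0")
      case True
      then show ?thesis by (intro exI[of _ 1]) simp
    next
      case False
      define \<eta> where "\<eta> = min 1 ((e - lam * D) / (lam * D))"
      have lD: "0 < lam * D" using lam D0 False by simp
      have \<eta>: "0 < \<eta>" "\<eta> \<le> 1" "\<eta> \<le> (e - lam * D) / (lam * D)" unfolding \<eta>_def using e lD by auto
      have "\<eta> * (lam * D) \<le> e - lam * D" using \<eta>(3) lD by (subst (asm) pos_le_divide_eq)
      then have "lam * ((1 + \<eta>) * D) \<le> e" by (simp add: algebra_simps)
      then show ?thesis using \<eta>(1,2) real by (intro exI[of _ \<eta>]) (simp add: ennreal_leI)
    qed
  qed
  then obtain \<eta> where \<eta>: "0 < \<eta>" "\<eta> \<le> 1" "ennreal (lam * ((1 + \<eta>) * D)) \<le> edistance U (UNIV - K)" by blast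
  show ?thesis
  proof (rule that[OF \<eta>(1,2) D0 dD UK])
    fix x y assume xy: "x \<in> U" "y \<in> U"
    show "ball x (lam * ((1 + \<eta>) * dist x y)) \<subseteq> K"
    proof (rule subsetI, rule ccontr)
      fix w assume w: "w \<in> ball x (lam * ((1 + \<eta>) * dist x y))" "w \<notin> K"
      have "ennreal (lam * ((1 + \<eta>) * D)) \<le> ennreal (dist x w)"
        by (rule order_trans[OF \<eta>(3) far[OF xy(1) w(2)]])
      then have "lam * ((1 + \<eta>) * D) \<le> dist x w" by (simp add: ennreal_le_iff)
      moreover have "lam * ((1 + \<eta>) * dist x y) \<le> lam * ((1 + \<eta>) * D)"
        using lam \<eta>(1) dD[OF xy] by (intro mult_left_mono) auto
      ultimately show False using w(1) by simp
    qed
  qed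
qed

theorem theorem4p2:
  fixes \<mu> :: "'a::complete_space measure"
    and Q p s C\<^sub>P lam \<epsilon> \<alpha>\<^sub>p :: real
    and K \<Omega> U :: "'a set"
  assumes "metric_measure_space \<mu>"
    and "1 \<le> Q" and "ahlfors_regular \<mu> Q"
    and "Q < p" and "supports_poincare \<mu> p"
    and "1 \<le> s" and "s < p" and "poincare_inequality_with \<mu> s C\<^sub>P lam"
    and "0 < \<epsilon>" and "\<epsilon> < 1 / 8" and "\<alpha>\<^sub>p = 1 - Q / p"
    and "compact K" and "open \<Omega>" and "K \<subseteq> \<Omega>"
    and "U \<noteq> {}" and "U \<in> sets (completion \<mu>)"
    and "ennreal lam * ediam U < edistance U (UNIV - K)"
  shows "\<exists>C>0. \<forall>f :: 'a \<Rightarrow> 'v::banach. continuous_on UNIV f \<longrightarrow>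
           ennreal (1 / C) * hajlasz_seminorm (completion \<mu>) p f U
             \<le> compactly_holder_seminorm p \<alpha>\<^sub>p \<epsilon> f K \<and>
           compactly_holder_seminorm p \<alpha>\<^sub>p \<epsilon> f K
             \<le> ennreal C * hajlasz_seminorm (completion \<mu>) p f \<Omega>"
proof (cases "\<forall>x y :: 'a. x = y")
  case True
  then have "hajlasz_seminorm M p f A = 0" "compactly_holder_seminorm p \<alpha>\<^sub>p \<epsilon> f K = 0"
    for M A and f :: "'a \<Rightarrow> 'v"
    by (blast intro: seminorms_of_one_point_space)+
  then show ?thesis by (intro exI[of _ 1]) simp
next
  case False
  then obtain x0 y0 :: 'a where xy0: "x0 \<noteq> y0" by blast
  have lam: "1 \<le> lam" using assms(8) unfolding poincare_inequality_with_def by simp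
  obtain \<eta> D where \<eta>: "0 < \<eta>" "\<eta> \<le> 1" and D: "0 \<le> D" "\<And>x y. x \<in> U \<Longrightarrow> y \<in> U \<Longrightarrow> dist x y \<le> D"
    and UK: "U \<subseteq> K" and balls: "\<And>x y. x \<in> U \<Longrightarrow> y \<in> U \<Longrightarrow> ball x (lam * ((1 + \<eta>) * dist x y)) \<subseteq> K"
    using dilated_balls_inside[OF lam assms(15,17)] by metis
  \<comment> \<open>The radii at which the maximal function is used are at most \<open>lam * (2 * D)\<close>.\<close>
  define R where "R = 12 * (lam * (2 * D)) + 1"
  have R: "0 < R" unfolding R_def using lam D(1) by (intro add_nonneg_pos mult_nonneg_nonneg) auto
  obtain C where "regular_measure \<mu> Q C R"
    using regular_measure_exists[OF assms(1-3) R xy0] by blast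
  then interpret regular_measure \<mu> Q C R .
  interpret poincare_domain \<mu> Q C R p s C\<^sub>P lam \<epsilon> \<eta> K U
  proof
    fix x y assume xy: "x \<in> U" "y \<in> U"
    show "ball x (lam * ((1 + \<eta>) * dist x y)) \<subseteq> K" by (rule balls[OF xy])
    have "lam * ((1 + \<eta>) * dist x y) \<le> lam * (2 * D)"
      using lam \<eta> D(1) D(2)[OF xy] by (intro mult_left_mono mult_mono) auto
    then show "12 * (lam * ((1 + \<eta>) * dist x y)) \<le> R" unfolding R_def by linarith
  qed (use assms \<eta> UK in auto)
  obtain C2 where C2: "0 < C2" "\<And>f :: 'a \<Rightarrow> 'v. continuous_on UNIV f \<Longrightarrow>
      compactly_holder_seminorm p (1 - Q / p) \<epsilon> f K \<le> ennreal C2 * hajlasz_seminorm (completion \<mu>) p f \<Omega>"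
    using compactly_holder_le_hajlasz[OF assms(4) eps compact_K assms(13,14), where 'b='v] by blast
  define C1 where "C1 = norm_const powr (1 / p)"
  have C1: "0 < C1" unfolding C1_def using norm_const_pos by simp
  define C' where "C' = max C1 C2"
  have C': "0 < C'" "C1 \<le> C'" "C2 \<le> C'" unfolding C'_def using C1 by auto
  show ?thesis
  proof (intro exI[of _ C'] conjI allI impI C')
    fix f :: "'a \<Rightarrow> 'v" assume f: "continuous_on UNIV f"
    let ?h = "compactly_holder_seminorm p \<alpha>\<^sub>p \<epsilon> f K"
    have "hajlasz_seminorm (completion \<mu>) p f U \<le> ennreal C1 * ?h"
      unfolding assms(11) C1_def
      using assms(10) continuous_on_subset[OF f] by (intro hajlasz_le_compactly_holder) auto
    then have "ennreal (1 / C') * hajlasz_seminorm (completion \<mu>) p f U \<le> ennreal (1 / C') * (ennreal C1 * ?h)"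
      by (intro mult_left_mono) auto
    also have "\<dots> = ennreal (C1 / C') * ?h"
      using C1 C' by (simp add: mult.assoc[symmetric] ennreal_mult[symmetric])
    also have "\<dots> \<le> 1 * ?h"
      using C1 C' by (intro mult_right_mono) (auto simp: ennreal_le_1)
    finally show "ennreal (1 / C') * hajlasz_seminorm (completion \<mu>) p f U \<le> ?h" by simp
    have "?h \<le> ennreal C2 * hajlasz_seminorm (completion \<mu>) p f \<Omega>"
      unfolding assms(11) by (rule C2(2)[OF f])
    also have "\<dots> \<le> ennreal C' * hajlasz_seminorm (completion \<mu>) p f \<Omega>"
      using C' by (intro mult_right_mono ennreal_leI) auto
    finally show "?h \<le> ennreal C' * hajlasz_seminorm (completion \<mu>) p f \<Omega>" .
  qed
qed

end
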